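(* Let $n\ge1$, let $\mathcal{Z}=\{z_1,\dots,z_m\}\subset\mathbb{D}^n$ be $m$ distinct points and let $w_1,\dots,w_m\in\mathbb{D}$. Let $\mathcal{Q}_{\mathcal{Z}}=\operatorname{span}\{\mathbb{S}(\cdot,z_i):i=1,\dots,m\}$ and $\mathcal{M}_{\mathcal{Q}_{\mathcal{Z}}}=\mathcal{Q}_{\mathcal{Z}}^{conj}+\mathcal{M}_n+H^2_0(\mathbb{T}^n)$, regarded as a subspace of $L^1(\mathbb{T}^n)$. Define $c=(c_1,\dots,c_m)^T$ by \[ c=\big(\mathbb{S}(z_j,z_i)\big)_{j,i=1}^m{}^{-1}\,(w_1,\dots,w_m)^T \] (the matrix whose $(j,i)$ entry is $\mathbb{S}(z_j,z_i)$), and set $\psi_{\mathcal{Z},\mathcal{W}}=\sum_{i=1}^m c_i\mathbb{S}(\cdot,z_i)$. Then there exists $\varphi\in\mathcal{S}(\mathbb{D}^n)$ with $\varphi(z_i)=w_i$ for all $i=1,\dots,m$ if and only if the functional $f\mapsto\int_{\mathbb{T}^n}\psi_{\mathcal{Z},\mathcal{W}}f\,d\mu$ is a contraction on $(\mathcal{M}_{\mathcal{Q}_{\mathcal{Z}}},\|\cdot\|_1)$.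
   Context: $\mu$ is normalized Lebesgue measure on $\mathbb{T}^n$, $\|\cdot\|_1$ the $L^1(\mathbb{T}^n,\mu)$ norm. $\mathbb{S}(z,w)=\prod_{i=1}^n(1-z_i\bar w_i)^{-1}$ is the Szegő kernel of $\mathbb{D}^n$, and $\mathbb{S}(\cdot,w)$ is the function $z\mapsto\mathbb{S}(z,w)$, an element of $H^2(\mathbb{T}^n)$ (the closed subspace of $L^2(\mathbb{T}^n)$ of functions with Fourier coefficients supported in $\mathbb{Z}_+^n$, identified with analytic functions on $\mathbb{D}^n$). $\mathcal{S}(\mathbb{D}^n)$ is the closed unit ball of $H^\infty(\mathbb{D}^n)$. $S^{conj}=\{\bar f:f\in S\}$; $H^2_0(\mathbb{T}^n)=\{f\in H^2:f(0)=0\}$; $\mathcal{M}_n=L^2(\mathbb{T}^n)\ominus(H^2(\mathbb{T}^n)^{conj}+H^2(\mathbb{T}^n))$. A functional $\Lambda$ is a contraction if $|\Lambda f|\le\|f\|_1$ for all $f$. *)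

theory Defs
  imports "HOL-Analysis.Analysis"
begin

definition polydisc :: "(complex^'n::finite) set" where
  "polydisc = {z. \<forall>k. cmod (z$k) < 1}"

definition torus_pt :: "real^'n::finite \<Rightarrow> complex^'n" where
  "torus_pt t = (\<chi> k. cis (t$k))"

definition torus_mu :: "(complex^'n::finite) measure" where
  "torus_mu = distr (uniform_measure lborel (cbox 0 (\<chi> _. 2*pi))) borel torus_pt"

definition torus_char :: "int^'n::finite \<Rightarrow> complex^'n \<Rightarrow> complex" where
  "torus_char k \<zeta> = (\<Prod>j\<in>UNIV. (\<zeta>$j) powi (k$j))"

definition fourier_coeff :: "(complex^'n::finite \<Rightarrow> complex) \<Rightarrow> int^'n \<Rightarrow> complex" where
  "fourier_coeff f k = (LINT \<zeta>|torus_mu. f \<zeta> * cnj (torus_char k \<zeta>))"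

definition L2_torus :: "(complex^'n::finite \<Rightarrow> complex) set" where
  "L2_torus = {f. f \<in> borel_measurable torus_mu \<and> integrable torus_mu (\<lambda>\<zeta>. (cmod (f \<zeta>))^2)}"

definition L2_inner :: "(complex^'n::finite \<Rightarrow> complex) \<Rightarrow> (complex^'n \<Rightarrow> complex) \<Rightarrow> complex" where
  "L2_inner f g = (LINT \<zeta>|torus_mu. f \<zeta> * cnj (g \<zeta>))"

definition H2_torus :: "(complex^'n::finite \<Rightarrow> complex) set" where
  "H2_torus = {f \<in> L2_torus. \<forall>k. (\<exists>j. k$j < 0) \<longrightarrow> fourier_coeff f k = 0}"

text \<open>H^2_0: f(0) = 0, i.e. the 0-th Fourier coefficient vanishes.\<close>
definition H2_0_torus :: "(complex^'n::finite \<Rightarrow> complex) set" where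
  "H2_0_torus = {f \<in> H2_torus. fourier_coeff f 0 = 0}"

definition conj_set :: "('a \<Rightarrow> complex) set \<Rightarrow> ('a \<Rightarrow> complex) set" where
  "conj_set S = {(\<lambda>x. cnj (f x)) | f. f \<in> S}"

definition set_plus_fun :: "('a \<Rightarrow> complex) set \<Rightarrow> ('a \<Rightarrow> complex) set \<Rightarrow> ('a \<Rightarrow> complex) set" where
  "set_plus_fun A B = {(\<lambda>x. f x + g x) | f g. f \<in> A \<and> g \<in> B}"

definition M_torus :: "(complex^'n::finite \<Rightarrow> complex) set" where
  "M_torus = {g \<in> L2_torus. \<forall>h \<in> set_plus_fun (conj_set H2_torus) H2_torus. L2_inner g h = 0}"

definition szego :: "complex^'n::finite \<Rightarrow> complex^'n \<Rightarrow> complex" where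
  "szego z w = (\<Prod>i\<in>UNIV. inverse (1 - z$i * cnj (w$i)))"

definition Q_span :: "('m::finite \<Rightarrow> complex^'n::finite) \<Rightarrow> (complex^'n \<Rightarrow> complex) set" where
  "Q_span z = {(\<lambda>\<zeta>. \<Sum>i\<in>UNIV. a i * szego \<zeta> (z i)) | a. True}"

definition M_Q :: "('m::finite \<Rightarrow> complex^'n::finite) \<Rightarrow> (complex^'n \<Rightarrow> complex) set" where
  "M_Q z = set_plus_fun (set_plus_fun (conj_set (Q_span z)) M_torus) H2_0_torus"

definition psi_ZW :: "('m::finite \<Rightarrow> complex^'n::finite) \<Rightarrow> ('m \<Rightarrow> complex) \<Rightarrow> complex^'n \<Rightarrow> complex" where
  "psi_ZW z w = (let c = matrix_inv (\<chi> j i. szego (z j) (z i)) *v (\<chi> i. w i)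
                 in (\<lambda>\<zeta>. \<Sum>i\<in>UNIV. c$i * szego \<zeta> (z i)))"

text \<open>Holomorphic on the polydisc: Frechet differentiable with C-linear derivative.\<close>
definition holo_polydisc :: "(complex^'n::finite \<Rightarrow> complex) \<Rightarrow> bool" where
  "holo_polydisc f \<longleftrightarrow> (\<forall>z\<in>polydisc. \<exists>L. (f has_derivative L) (at z) \<and>
      (\<forall>x. L (\<chi> k. \<i> * x$k) = \<i> * L x))"

definition schur_class :: "(complex^'n::finite \<Rightarrow> complex) set" where
  "schur_class = {f. holo_polydisc f \<and> (\<forall>z\<in>polydisc. cmod (f z) \<le> 1)}"

end

theory Submission
  imports Defs "HOL-Complex_Analysis.Cauchy_Integral_Formula" "HOL-Library.Function_Algebras"
begin

text \<open>
  Testing a function \<open>u\<close> of the polydisc algebra against \<open>f = cnj q + m + h\<close> in \<open>M_Q\<close>, with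
  \<open>q = \<Sum>\<^sub>i a\<^sub>i S(\<cdot>, z\<^sub>i)\<close>, kills \<open>m\<close> and \<open>h\<close> and gives \<open>\<Sum>\<^sub>i cnj a\<^sub>i u(z\<^sub>i)\<close>: only the values of
  \<open>u\<close> at the nodes matter.  If a Schur function \<open>\<phi>\<close> interpolates, the dilates of \<open>\<phi>\<close> are uniform
  limits of polynomials, bounded by 1 on the torus, whose values at the nodes tend to those of
  \<open>\<psi>\<close>; hence \<open>\<psi>\<close> is contractive.  Conversely, extend the functional of \<open>\<psi>\<close> by Hahn-Banach to a
  contraction \<open>\<Lambda>\<close> on \<open>L\<^sup>1\<close> and put \<open>\<phi>(v) = \<Lambda>(cnj S\<^sub>v)\<close>, so that no representation of \<open>\<Lambda>\<close> by a
  bounded function is needed.  Then \<open>\<phi>\<close> is holomorphic, it interpolates because \<open>\<psi>\<close> does, and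
  \<open>|\<phi>| \<le> 1\<close> because the Poisson kernel \<open>|S\<^sub>v|\<^sup>2 / S(v,v)\<close> has \<open>L\<^sup>1\<close> norm 1 and differs from \<open>cnj S\<^sub>v\<close>
  by an element of \<open>M_Q\<close> annihilated by \<open>\<psi>\<close>.
\<close>

section \<open>The Hahn-Banach theorem\<close>

text \<open>Bounded analytic functions are never given boundary values, and elements of H^2 are
  never evaluated inside the polydisc. The link between torus and polydisc is carried by
  \<open>H2_multiplier\<close>: multiplication by such a function preserves H^2, and the function
  comes out of every pairing with a Szego kernel as its value at the point. The property passes from
  the coordinates to polynomials and on to uniform limits. In the converse, \<Lambda> is unknown off
  \<open>M_Q\<close>, and the L^1 norm of the conjugated kernel exceeds 1 in general, so it cannot
  give |\<phi>| \<le> 1 directly. Hence the exchange for the Poisson kernel, a positive function of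
  mass 1. The difference consists of an analytic part vanishing at 0 and of mixed frequencies, which
  occur only for n \<ge> 2 and are absorbed by M_n. The functional of \<psi> annihilates it because
  S_v comes out of the pairing of \<psi> S_v with S_v as the constant S(v,v).\<close>

instantiation "fun" :: (type, real_vector) real_vector
begin

text \<open>Pointwise operations make function types real vector spaces, so that
  \<open>subspace\<close> and the real Hahn-Banach theorem apply to sets of functions.\<close>

definition scaleR_fun :: "real \<Rightarrow> ('a \<Rightarrow> 'b) \<Rightarrow> 'a \<Rightarrow> 'b" where
  "scaleR_fun r f = (\<lambda>x. r *\<^sub>R f x)"

instance
  by standard (auto simp: scaleR_fun_def fun_eq_iff algebra_simps)

end

text \<open>The extension is wanted on the integrable functions, which form a subset of a function
  type. So \<open>E\<close> is an explicit subspace, \<open>p\<close> is sublinear and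
  \<open>L\<close> linear on \<open>E\<close> only. No definiteness of \<open>p\<close> is asked
  for: the L^1 seminorm on functions, without identification almost everywhere, qualifies.\<close>

lemma hahn_banach_real:
  fixes E M :: "'v::real_vector set" and p l :: "'v \<Rightarrow> real"
  assumes E: "subspace E" and M: "subspace M" and ME: "M \<subseteq> E"
    and p_add: "\<And>x y. x \<in> E \<Longrightarrow> y \<in> E \<Longrightarrow> p (x + y) \<le> p x + p y"
    and p_scale: "\<And>r x. x \<in> E \<Longrightarrow> 0 \<le> r \<Longrightarrow> p (r *\<^sub>R x) = r * p x"
    and l_add: "\<And>x y. x \<in> M \<Longrightarrow> y \<in> M \<Longrightarrow> l (x + y) = l x + l y"
    and l_scale: "\<And>r x. x \<in> M \<Longrightarrow> l (r *\<^sub>R x) = r * l x"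
    and l_le: "\<And>x. x \<in> M \<Longrightarrow> l x \<le> p x"
  obtains L where "\<And>x y. x \<in> E \<Longrightarrow> y \<in> E \<Longrightarrow> L (x + y) = L x + L y"
    and "\<And>r x. x \<in> E \<Longrightarrow> L (r *\<^sub>R x) = r * L x"
    and "\<And>x. x \<in> M \<Longrightarrow> L x = l x"
    and "\<And>x. x \<in> E \<Longrightarrow> L x \<le> p x"
proof -
  \<comment> \<open>Zorn's lemma is applied to the graphs, ordered by inclusion, of the dominated extensions.\<close>
  define \<A> where "\<A> = {G :: ('v \<times> real) set. subspace G \<and> (\<lambda>x. (x, l x)) ` M \<subseteq> G
      \<and> G \<subseteq> E \<times> UNIV \<and> (\<forall>(x, y)\<in>G. y \<le> p x)}"
  have l0: "l 0 = 0"
    using l_scale[of 0 0] subspace_0[OF M] by simp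
  have graph: "(\<lambda>x. (x, l x)) ` M \<in> \<A>"
  proof -
    have "subspace ((\<lambda>x. (x, l x)) ` M)"
      unfolding subspace_def
    proof (intro conjI ballI allI)
      show "0 \<in> (\<lambda>x. (x, l x)) ` M"
        using subspace_0[OF M] l0 by (force simp: zero_prod_def)
      show "u + v \<in> (\<lambda>x. (x, l x)) ` M"
        if "u \<in> (\<lambda>x. (x, l x)) ` M" "v \<in> (\<lambda>x. (x, l x)) ` M" for u v
        using that subspace_add[OF M] by (force simp: l_add)
      show "c *\<^sub>R u \<in> (\<lambda>x. (x, l x)) ` M" if "u \<in> (\<lambda>x. (x, l x)) ` M" for c u
        using that subspace_scale[OF M] by (force simp: l_scale)
    qed
    then show ?thesis
      using ME l_le by (auto simp: \<A>_def)
  qed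
  have "\<exists>G\<in>\<A>. \<forall>X\<in>\<A>. G \<subseteq> X \<longrightarrow> X = G"
  proof (rule subset_Zorn_nonempty)
    show "\<A> \<noteq> {}" using graph by blast
    fix \<C> assume ne: "\<C> \<noteq> {}" and ch: "subset.chain \<A> \<C>"
    have CA: "\<C> \<subseteq> \<A>" and tot: "\<And>X Y. X \<in> \<C> \<Longrightarrow> Y \<in> \<C> \<Longrightarrow> X \<subseteq> Y \<or> Y \<subseteq> X"
      using ch by (auto simp: subset_chain_def)
    have sub: "\<And>X. X \<in> \<C> \<Longrightarrow> subspace X"
      using CA by (auto simp: \<A>_def)
    have "subspace (\<Union>\<C>)"
      unfolding subspace_def
    proof (intro conjI ballI allI)
      show "0 \<in> \<Union>\<C>" using ne sub subspace_0 by blast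
      show "u + v \<in> \<Union>\<C>" if uv: "u \<in> \<Union>\<C>" "v \<in> \<Union>\<C>" for u v
      proof -
        obtain X Y where XY: "X \<in> \<C>" "u \<in> X" "Y \<in> \<C>" "v \<in> Y" using uv by blast
        then show ?thesis
          using tot[OF XY(1,3)] subspace_add[OF sub[OF XY(1)]] subspace_add[OF sub[OF XY(3)]] by blast
      qed
      show "c *\<^sub>R u \<in> \<Union>\<C>" if "u \<in> \<Union>\<C>" for c u
        using that sub subspace_scale by blast
    qed
    then show "\<Union>\<C> \<in> \<A>"
      using ne CA unfolding \<A>_def by blast
  qed
  then obtain G where GA: "G \<in> \<A>" and Gmax: "\<And>X. X \<in> \<A> \<Longrightarrow> G \<subseteq> X \<Longrightarrow> X = G" by blast
  have G: "subspace G" and lG: "\<And>x. x \<in> M \<Longrightarrow> (x, l x) \<in> G"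
    and GE: "\<And>x y. (x, y) \<in> G \<Longrightarrow> x \<in> E" and Gp: "\<And>x y. (x, y) \<in> G \<Longrightarrow> y \<le> p x"
    using GA by (auto simp: \<A>_def)
  have Gadd: "(x + x', a + a') \<in> G" if "(x, a) \<in> G" "(x', a') \<in> G" for x x' a a'
    using subspace_add[OF G that] by simp
  have Gscale: "(r *\<^sub>R x, r * a) \<in> G" if "(x, a) \<in> G" for x a r
    using subspace_scale[OF G that, of r] by simp
  have dom: "\<exists>y. (x0, y) \<in> G" if x0: "x0 \<in> E" for x0
  proof -
    \<comment> \<open>Every lower bound for a value at \<open>x0\<close> lies below every upper
      bound, which is all that a dominated extension by one dimension needs; the supremum of the
      lower bounds is then admissible.\<close>
    have cut: "a - p (x - x0) \<le> p (y + x0) - b" if "(x, a) \<in> G" "(y, b) \<in> G" for x a y b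
    proof -
      have "a + b \<le> p ((x - x0) + (y + x0))"
        using Gp[OF Gadd[OF that]] by simp
      also have "\<dots> \<le> p (x - x0) + p (y + x0)"
        using that GE x0 E by (intro p_add subspace_diff subspace_add) auto
      finally show ?thesis by simp
    qed
    define S where "S = (\<lambda>(x, a). a - p (x - x0)) ` G"
    have G0: "(0, 0) \<in> G" using subspace_0[OF G] by (simp add: zero_prod_def)
    have Sne: "S \<noteq> {}" using G0 by (auto simp: S_def)
    have bdd: "bdd_above S"
      using cut[OF _ G0] by (intro bdd_aboveI[of _ "p (0 + x0) - 0"]) (auto simp: S_def)
    define c where "c = Sup S"
    have c1: "a - c \<le> p (x - x0)" if "(x, a) \<in> G" for x a
    proof -
      have "a - p (x - x0) \<in> S" using that by (force simp: S_def)
      from cSup_upper[OF this bdd] show ?thesis by (simp add: c_def)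
    qed
    have c2: "b + c \<le> p (y + x0)" if yb: "(y, b) \<in> G" for y b
    proof -
      have "c \<le> p (y + x0) - b"
        unfolding c_def using Sne cut[OF _ yb] by (intro cSup_least) (auto simp: S_def)
      then show ?thesis by simp
    qed
    define G' where "G' = {(x + r *\<^sub>R x0, a + r * c) |x a r. (x, a) \<in> G}"
    have G'I: "(x + r *\<^sub>R x0, a + r * c) \<in> G'" if "(x, a) \<in> G" for x a r
      using that by (auto simp: G'_def)
    have GG': "G \<subseteq> G'"
      using G'I[where r = 0] by auto
    have "subspace G'"
      unfolding subspace_def
    proof (intro conjI ballI allI)
      show "0 \<in> G'" using subspace_0[OF G] GG' by blast
      show "u + v \<in> G'" if uv: "u \<in> G'" "v \<in> G'" for u v
      proof -
        obtain x a r x' a' r' where *: "u = (x + r *\<^sub>R x0, a + r * c)" "(x, a) \<in> G"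
          "v = (x' + r' *\<^sub>R x0, a' + r' * c)" "(x', a') \<in> G"
          using uv by (auto simp: G'_def)
        have "u + v = ((x + x') + (r + r') *\<^sub>R x0, (a + a') + (r + r') * c)"
          by (simp add: * algebra_simps)
        then show ?thesis using G'I[OF Gadd[OF *(2,4)]] by metis
      qed
      show "k *\<^sub>R u \<in> G'" if u: "u \<in> G'" for k u
      proof -
        obtain x a r where *: "u = (x + r *\<^sub>R x0, a + r * c)" "(x, a) \<in> G"
          using u by (auto simp: G'_def)
        have "k *\<^sub>R u = (k *\<^sub>R x + (k * r) *\<^sub>R x0, k * a + (k * r) * c)"
          by (simp add: * algebra_simps)
        then show ?thesis using G'I[OF Gscale[OF *(2)]] by metis
      qed
    qed
    moreover have "(\<lambda>x. (x, l x)) ` M \<subseteq> G'"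
      using lG GG' by blast
    moreover have "G' \<subseteq> E \<times> UNIV"
      using GE x0 E by (auto simp: G'_def intro!: subspace_add subspace_scale)
    moreover have "a + r * c \<le> p (x + r *\<^sub>R x0)" if xa: "(x, a) \<in> G" for x a r
    proof -
      \<comment> \<open>Homogeneity of \<open>p\<close> reduces the domination to the coefficients 1
        and -1 of \<open>x0\<close>, where it is \<open>c2\<close> and \<open>c1\<close>.\<close>
      consider "r = 0" | "r > 0" | "r < 0" by linarith
      then show ?thesis
      proof cases
        case 1
        then show ?thesis using Gp[OF xa] by simp
      next
        case 2
        have "a + r * c = r * (inverse r * a + c)" using 2 by (simp add: field_simps)
        also have "\<dots> \<le> r * p (inverse r *\<^sub>R x + x0)"
          using 2 by (intro mult_left_mono c2 Gscale xa) auto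
        also have "\<dots> = p (r *\<^sub>R (inverse r *\<^sub>R x + x0))"
          using 2 xa GE x0 E by (intro p_scale[symmetric] subspace_add subspace_scale) auto
        also have "r *\<^sub>R (inverse r *\<^sub>R x + x0) = x + r *\<^sub>R x0"
          using 2 by (simp add: algebra_simps)
        finally show ?thesis .
      next
        case 3
        have "a + r * c = - r * (inverse (- r) * a - c)" using 3 by (simp add: field_simps)
        also have "\<dots> \<le> - r * p (inverse (- r) *\<^sub>R x - x0)"
          using 3 by (intro mult_left_mono c1 Gscale xa) auto
        also have "\<dots> = p ((- r) *\<^sub>R (inverse (- r) *\<^sub>R x - x0))"
          using 3 xa GE x0 E by (intro p_scale[symmetric] subspace_diff subspace_scale) auto
        also have "(- r) *\<^sub>R (inverse (- r) *\<^sub>R x - x0) = x + r *\<^sub>R x0"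
          using 3 by (simp add: algebra_simps)
        finally show ?thesis .
      qed
    qed
    ultimately have "G' \<in> \<A>"
      unfolding \<A>_def by (auto simp: G'_def)
    then have "G' = G" using Gmax GG' by blast
    moreover have "(0 + 1 *\<^sub>R x0, 0 + 1 * c) \<in> G'" by (intro G'I G0)
    ultimately show ?thesis by auto
  qed
  have p0: "p 0 = 0"
    using p_scale[of 0 0] subspace_0[OF E] by simp
  \<comment> \<open>Single-valuedness is not demanded of the graphs in \<open>\<A>\<close>. It
    follows from domination: if both \<open>y\<close> and \<open>y'\<close> are values at
    \<open>x\<close>, then \<open>y - y'\<close> and \<open>y' - y\<close> are values at 0, hence at
    most \<open>p 0 = 0\<close>.\<close>
  have uniq: "y = y'" if "(x, y) \<in> G" "(x, y') \<in> G" for x y y'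
    using Gp[of 0 "y - y'"] Gp[of 0 "y' - y"] Gadd[OF that(1) Gscale[OF that(2), of "-1"]]
      Gadd[OF that(2) Gscale[OF that(1), of "-1"]] by (simp add: p0)
  define L where "L x = (SOME y. (x, y) \<in> G)" for x
  have LG: "(x, L x) \<in> G" if "x \<in> E" for x
    unfolding L_def using dom[OF that] by (rule someI_ex)
  show thesis
  proof (rule that[of L])
    show "L (x + y) = L x + L y" if "x \<in> E" "y \<in> E" for x y
      using uniq[OF LG Gadd[OF LG LG]] that subspace_add[OF E] by blast
    show "L (r *\<^sub>R x) = r * L x" if "x \<in> E" for r x
      using uniq[OF LG Gscale[OF LG]] that subspace_scale[OF E] by blast
    show "L x = l x" if "x \<in> M" for x
      using uniq[OF LG lG] that ME by blast
    show "L x \<le> p x" if "x \<in> E" for x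
      using Gp[OF LG] that by blast
  qed
qed

text \<open>Closure under complex scalars, which \<open>subspace\<close> does not express, written
  with lambda terms to match \<open>set_plus_fun\<close> and the integrands.\<close>

definition fun_subspace :: "('a \<Rightarrow> complex) set \<Rightarrow> bool" where
  "fun_subspace V \<longleftrightarrow> (\<lambda>x. 0) \<in> V \<and> (\<forall>f\<in>V. \<forall>g\<in>V. (\<lambda>x. f x + g x) \<in> V)
    \<and> (\<forall>c. \<forall>f\<in>V. (\<lambda>x. c * f x) \<in> V)"

lemma fun_subspaceD:
  assumes "fun_subspace V"
  shows "(\<lambda>x. 0) \<in> V" and "f \<in> V \<Longrightarrow> g \<in> V \<Longrightarrow> (\<lambda>x. f x + g x) \<in> V"
    and "f \<in> V \<Longrightarrow> (\<lambda>x. c * f x) \<in> V"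
  using assms by (auto simp: fun_subspace_def)

lemma fun_subspace_imp_subspace:
  assumes "fun_subspace V"
  shows "subspace V"
proof -
  have "(\<lambda>x. complex_of_real c * f x) \<in> V" if "f \<in> V" for c f
    using fun_subspaceD(3)[OF assms that] by blast
  then show ?thesis
    using fun_subspaceD[OF assms]
    by (auto simp: subspace_def zero_fun_def plus_fun_def scaleR_fun_def scaleR_conv_of_real)
qed

definition clinear_on :: "('a \<Rightarrow> complex) set \<Rightarrow> (('a \<Rightarrow> complex) \<Rightarrow> complex) \<Rightarrow> bool" where
  "clinear_on V L \<longleftrightarrow> (\<forall>f\<in>V. \<forall>g\<in>V. L (\<lambda>x. f x + g x) = L f + L g)
    \<and> (\<forall>c. \<forall>f\<in>V. L (\<lambda>x. c * f x) = c * L f)"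

text \<open>A complex linear functional is determined by its real part. The real part is extended as
  a real linear functional, the imaginary part is rebuilt from it, and a rotation turns the bound on
  the real part into one on the modulus.\<close>

lemma hahn_banach_complex:
  fixes E M :: "('a \<Rightarrow> complex) set" and p :: "('a \<Rightarrow> complex) \<Rightarrow> real"
  assumes E: "fun_subspace E" and M: "fun_subspace M" and ME: "M \<subseteq> E"
    and p_add: "\<And>f g. f \<in> E \<Longrightarrow> g \<in> E \<Longrightarrow> p (\<lambda>x. f x + g x) \<le> p f + p g"
    and p_scale: "\<And>c f. f \<in> E \<Longrightarrow> p (\<lambda>x. c * f x) = cmod c * p f"
    and l: "clinear_on M l"
    and l_le: "\<And>f. f \<in> M \<Longrightarrow> cmod (l f) \<le> p f"
  obtains L where "clinear_on E L" and "\<And>f. f \<in> M \<Longrightarrow> L f = l f"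
    and "\<And>f. f \<in> E \<Longrightarrow> cmod (L f) \<le> p f"
proof -
  have sc: "r *\<^sub>R f = (\<lambda>x. complex_of_real r * f x)" for r and f :: "'a \<Rightarrow> complex"
    by (auto simp: scaleR_fun_def scaleR_conv_of_real)
  have l1: "l (\<lambda>x. f x + g x) = l f + l g" if "f \<in> M" "g \<in> M" for f g
    using l that by (auto simp: clinear_on_def)
  have l2: "l (\<lambda>x. c * f x) = c * l f" if "f \<in> M" for c f
    using l that by (auto simp: clinear_on_def)
  obtain R where R_add: "\<And>f g. f \<in> E \<Longrightarrow> g \<in> E \<Longrightarrow> R (f + g) = R f + R g"
    and R_scale: "\<And>r f. f \<in> E \<Longrightarrow> R (r *\<^sub>R f) = r * R f"
    and R_l: "\<And>f. f \<in> M \<Longrightarrow> R f = Re (l f)"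
    and R_le: "\<And>f. f \<in> E \<Longrightarrow> R f \<le> p f"
  proof (rule hahn_banach_real[of E M p "\<lambda>f. Re (l f)"])
    show "subspace E" "subspace M" using E M by (auto intro: fun_subspace_imp_subspace)
    show "Re (l f) \<le> p f" if "f \<in> M" for f
      using l_le[OF that] complex_Re_le_cmod order_trans by blast
  qed (use ME p_add p_scale l1 l2 in \<open>auto simp: plus_fun_def sc\<close>)
  have R1: "R (\<lambda>x. f x + g x) = R f + R g" if "f \<in> E" "g \<in> E" for f g
    using R_add[OF that] by (simp add: plus_fun_def)
  have R2: "R (\<lambda>x. complex_of_real r * f x) = r * R f" if "f \<in> E" for r f
    using R_scale[OF that, of r] by (simp add: sc)
  \<comment> \<open>Complex linearity forces Im (l f) = - Re (l (i f)), which dictates this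
    formula.\<close>
  define L where "L f = Complex (R f) (- R (\<lambda>x. \<i> * f x))" for f
  have iE: "(\<lambda>x. c * f x) \<in> E" if "f \<in> E" for c f
    using fun_subspaceD(3)[OF E that] .
  have L1: "L (\<lambda>x. f x + g x) = L f + L g" if "f \<in> E" "g \<in> E" for f g
    using R1[OF that] R1[OF iE iE, OF that, of \<i> \<i>] by (simp add: L_def complex_eq_iff algebra_simps)
  have L2: "L (\<lambda>x. c * f x) = c * L f" if f: "f \<in> E" for c f
  proof -
    have *: "R (\<lambda>x. c * f x) = Re c * R f + Im c * R (\<lambda>x. \<i> * f x)" if f: "f \<in> E" for c f
    proof -
      have "R (\<lambda>x. complex_of_real (Re c) * f x + complex_of_real (Im c) * (\<i> * f x))
          = Re c * R f + Im c * R (\<lambda>x. \<i> * f x)"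
        using R1[OF iE iE[OF iE], OF f f] R2[OF f] R2[OF iE[OF f]] by simp
      moreover have "(\<lambda>x. complex_of_real (Re c) * f x + complex_of_real (Im c) * (\<i> * f x)) = (\<lambda>x. c * f x)"
        by (rule ext) (simp add: complex_eq_iff algebra_simps)
      ultimately show ?thesis by simp
    qed
    have "R (\<lambda>x. \<i> * (c * f x)) = R (\<lambda>x. (\<i> * c) * f x)" by (simp add: mult.assoc)
    then show ?thesis
      using *[OF f, of c] *[OF f, of "\<i> * c"] by (simp add: L_def complex_eq_iff algebra_simps)
  qed
  show thesis
  proof (rule that[of L])
    show "clinear_on E L" using L1 L2 by (auto simp: clinear_on_def)
    show "L f = l f" if f: "f \<in> M" for f
      using R_l[OF f] R_l[OF fun_subspaceD(3)[OF M f]] l2[OF f]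
      by (simp add: L_def complex_eq_iff)
    show "cmod (L f) \<le> p f" if f: "f \<in> E" for f
    proof (cases "L f = 0")
      case True
      have "0 \<le> p f"
      proof -
        have "p (\<lambda>x. f x + (-1) * f x) \<le> p f + p (\<lambda>x. (-1) * f x)"
          using p_add[OF f iE[OF f, of "-1"]] .
        moreover have "p (\<lambda>x. f x + (-1) * f x) = 0" using p_scale[OF f, of 0] by simp
        ultimately show ?thesis using p_scale[OF f, of "-1"] by simp
      qed
      then show ?thesis using True by simp
    next
      case False
      \<comment> \<open>The unimodular \<open>c\<close> rotates \<open>L f\<close> to the positive
        real axis, so the real bound at \<open>c * f\<close> is the bound on the modulus at
        \<open>f\<close>.\<close>
      define c where "c = cnj (sgn (L f))"
      have "c * L f = cmod (L f)"
        using False complex_norm_square[of "L f"]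
        by (simp add: c_def sgn_eq power2_eq_square field_simps)
      then have "cmod (L f) = Re (L (\<lambda>x. c * f x))"
        using L2[OF f] by simp
      also have "\<dots> = R (\<lambda>x. c * f x)" by (simp add: L_def)
      also have "\<dots> \<le> p (\<lambda>x. c * f x)" by (intro R_le iE f)
      also have "\<dots> = p f" using False by (simp add: p_scale[OF f] c_def norm_sgn)
      finally show ?thesis .
    qed
  qed
qed

section \<open>Haar measure on the torus\<close>

definition torus :: "(complex^'n::finite) set" where
  "torus = {\<zeta>. \<forall>k. cmod (\<zeta>$k) = 1}"

lemma torusD: "\<zeta> \<in> torus \<Longrightarrow> cmod (\<zeta>$k) = 1"
  by (simp add: torus_def)

lemma torus_cnj_mult: "\<zeta> \<in> torus \<Longrightarrow> \<zeta>$k * cnj (\<zeta>$k) = 1"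
  using complex_norm_square[of "\<zeta>$k"] by (simp add: torusD)

lemma torus_nonzero: "\<zeta> \<in> torus \<Longrightarrow> \<zeta>$k \<noteq> 0"
  using torusD[of \<zeta> k] by auto

lemma torus_pt_in_torus: "torus_pt t \<in> torus"
  by (simp add: torus_pt_def torus_def)

lemma continuous_on_vecI:
  fixes f :: "'a::topological_space \<Rightarrow> 'b::real_normed_vector^'n::finite"
  shows "(\<And>k. continuous_on S (\<lambda>x. f x $ k)) \<Longrightarrow> continuous_on S f"
  by (auto simp: continuous_on_def intro: vec_tendstoI)

lemma borel_measurable_vec_component [measurable]:
  "(\<lambda>\<zeta>::'a::real_normed_vector^'n::finite. \<zeta>$k) \<in> borel_measurable borel"
  by (intro borel_measurable_continuous_onI continuous_intros)

lemma continuous_torus_pt: "continuous_on UNIV (torus_pt :: real^'n::finite \<Rightarrow> complex^'n)"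
  by (rule continuous_on_vecI) (auto simp: torus_pt_def intro!: continuous_intros)

lemma measurable_torus_pt [measurable]: "torus_pt \<in> borel_measurable borel"
  by (intro borel_measurable_continuous_onI continuous_torus_pt)

lemma closed_torus: "closed (torus :: (complex^'n::finite) set)"
proof -
  have "torus = (\<Inter>k. {\<zeta> :: complex^'n. cmod (\<zeta>$k) = 1})"
    by (auto simp: torus_def)
  moreover have "closed (\<Inter>k. {\<zeta> :: complex^'n. cmod (\<zeta>$k) = 1})"
    by (intro closed_INT ballI closed_Collect_eq continuous_intros)
  ultimately show ?thesis by metis
qed

lemma sets_torus_mu [simp, measurable_cong]: "sets (torus_mu :: (complex^'n::finite) measure) = sets borel"
  by (simp add: torus_mu_def)

lemma space_torus_mu [simp]: "space (torus_mu :: (complex^'n::finite) measure) = UNIV"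
  by (simp add: torus_mu_def)

abbreviation torus_box :: "(real^'n::finite) set" where
  "torus_box \<equiv> cbox 0 (\<chi> _. 2*pi)"

lemma measure_torus_box: "measure lborel (torus_box :: (real^'n::finite) set) = (2*pi) ^ CARD('n)"
proof -
  have "(torus_box :: (real^'n) set) \<noteq> {}"
    by (auto simp: interval_ne_empty_cart)
  from content_cbox_cart[OF this] show ?thesis by simp
qed

lemma emeasure_torus_box:
  "emeasure lborel (torus_box :: (real^'n::finite) set) = ennreal ((2*pi) ^ CARD('n))"
proof -
  have "emeasure lborel (torus_box :: (real^'n) set) \<noteq> \<infinity>"
    using emeasure_lborel_cbox_finite by (metis infinity_ennreal_def less_irrefl)
  then show ?thesis
    using measure_torus_box[where 'n = 'n] by (simp add: emeasure_eq_ennreal_measure)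
qed

lemma emeasure_torus_mu_UNIV: "emeasure torus_mu (UNIV :: (complex^'n::finite) set) = 1"
proof -
  have "emeasure torus_mu (UNIV :: (complex^'n) set)
      = emeasure (uniform_measure lborel (torus_box :: (real^'n) set)) UNIV"
    unfolding torus_mu_def by (subst emeasure_distr) auto
  also have "\<dots> = 1"
    by (subst emeasure_uniform_measure) (auto simp: emeasure_torus_box intro!: ennreal_divide_self)
  finally show ?thesis .
qed

lemma finite_measure_torus_mu: "finite_measure (torus_mu :: (complex^'n::finite) measure)"
  by (rule finite_measureI) (simp add: emeasure_torus_mu_UNIV)

text \<open>The measure \<open>torus_mu\<close> lives on the whole vector space but is carried by
  the closed set \<open>torus\<close>. This licenses identities such as
  \<open>\<zeta>$k * cnj (\<zeta>$k) = 1\<close>, and bounds valid on the torus only, under the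
  integral.\<close>

lemma AE_torus: "AE \<zeta> in (torus_mu :: (complex^'n::finite) measure). \<zeta> \<in> torus"
proof -
  have "AE \<zeta> in distr (uniform_measure lborel (torus_box :: (real^'n) set)) borel torus_pt. \<zeta> \<in> torus"
    using borel_closed[OF closed_torus] by (subst AE_distr_iff) (auto simp: torus_pt_in_torus)
  then show ?thesis unfolding torus_mu_def .
qed

lemma measure_torus_mu_UNIV [simp]: "measure torus_mu (UNIV :: (complex^'n::finite) set) = 1"
  by (simp add: measure_def emeasure_torus_mu_UNIV)

lemma integrable_torus_bounded:
  fixes f :: "complex^'n::finite \<Rightarrow> 'b::{banach, second_countable_topology}"
  assumes "f \<in> borel_measurable borel" and "\<And>\<zeta>. \<zeta> \<in> torus \<Longrightarrow> norm (f \<zeta>) \<le> B"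
  shows "integrable torus_mu f"
proof -
  interpret finite_measure "torus_mu :: (complex^'n) measure" by (rule finite_measure_torus_mu)
  show ?thesis
    using assms AE_torus by (intro integrable_const_bound[where B = B]) (auto elim: eventually_mono)
qed

lemma integral_torus_cong:
  fixes f g :: "complex^'n::finite \<Rightarrow> 'b::{banach, second_countable_topology}"
  assumes "f \<in> borel_measurable borel" "g \<in> borel_measurable borel"
    and "\<And>\<zeta>. \<zeta> \<in> torus \<Longrightarrow> f \<zeta> = g \<zeta>"
  shows "(LINT \<zeta>|torus_mu. f \<zeta>) = (LINT \<zeta>|torus_mu. g \<zeta>)"
  using assms AE_torus by (intro integral_cong_AE) (auto elim: eventually_mono)

lemma integral_torus_lborel:
  fixes G :: "complex^'n::finite \<Rightarrow> complex"
  assumes [measurable]: "G \<in> borel_measurable borel"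
  shows "(LINT \<zeta>|torus_mu. G \<zeta>)
    = inverse ((2*pi) ^ CARD('n)) *\<^sub>R (LINT t|lborel. indicator torus_box t *\<^sub>R G (torus_pt t))"
proof -
  have eq: "uniform_measure lborel (torus_box :: (real^'n) set)
      = density lborel (\<lambda>x. ennreal (indicator torus_box x * inverse ((2*pi) ^ CARD('n))))"
    unfolding uniform_measure_def emeasure_torus_box
    by (intro arg_cong2[where f = density] refl ext)
       (auto simp: indicator_def divide_ennreal_def inverse_ennreal split: if_splits)
  have "(LINT \<zeta>|torus_mu. G \<zeta>)
      = (LINT t|uniform_measure lborel (torus_box :: (real^'n) set). G (torus_pt t))"
    unfolding torus_mu_def by (subst integral_distr) auto
  also have "\<dots> = (LINT t|lborel. (indicator torus_box t * inverse ((2*pi) ^ CARD('n))) *\<^sub>R G (torus_pt t))"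
    unfolding eq by (subst integral_density) auto
  also have "\<dots> = (LINT t|lborel. inverse ((2*pi) ^ CARD('n)) *\<^sub>R (indicator torus_box t *\<^sub>R G (torus_pt t)))"
    by (intro Bochner_Integration.integral_cong refl) (simp add: algebra_simps)
  finally show ?thesis
    by (simp only: integral_scaleR_right)
qed

lemma measurable_vec_lambda_PiM [measurable]:
  "(\<lambda>f. \<chi> k. f k) \<in> borel_measurable (Pi\<^sub>M UNIV (\<lambda>_::'n::finite. lborel :: real measure))"
  by (subst borel_measurable_euclidean_space)
     (auto simp: Basis_vec_def inner_axis intro!: measurable_component_singleton)

text \<open>Both measures give boxes their volume, and that determines Lebesgue measure. The product
  form is what allows a single angle to be split off by Fubini.\<close>

lemma lborel_vec_eq_distr_PiM:
  "(lborel :: (real^'n::finite) measure)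
    = distr (Pi\<^sub>M UNIV (\<lambda>_. lborel)) borel (\<lambda>f. \<chi> k. f k)"
proof (rule lborel_eqI)
  interpret product_sigma_finite "\<lambda>_::'n. lborel :: real measure" by standard
  fix l u :: "real^'n"
  assume le: "\<And>b. b \<in> Basis \<Longrightarrow> l \<bullet> b \<le> u \<bullet> b"
  have le': "l $ k \<le> u $ k" for k
    using le[of "axis k 1"] by (auto simp add: Basis_vec_def cart_eq_inner_axis)
  have "emeasure (distr (Pi\<^sub>M UNIV (\<lambda>_. lborel)) borel (\<lambda>f. \<chi> k. f k)) (box l u)
      = emeasure (Pi\<^sub>M UNIV (\<lambda>_. lborel)) (Pi\<^sub>E UNIV (\<lambda>k. {l$k<..<u$k}))"
    by (subst emeasure_distr)
       (auto simp: space_PiM mem_box_cart PiE_iff intro!: arg_cong[where f = "emeasure _"])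
  also have "\<dots> = (\<Prod>k\<in>UNIV. emeasure lborel {l$k<..<u$k})"
    by (rule emeasure_PiM) auto
  also have "\<dots> = ennreal (\<Prod>k\<in>UNIV. u$k - l$k)"
    using le' by (simp add: prod_ennreal)
  also have "(\<Prod>k\<in>UNIV. u$k - l$k) = (\<Prod>b\<in>Basis. (u - l) \<bullet> b)"
    by (simp add: Basis_vec_def cart_eq_inner_axis axis_eq_axis prod.UNION_disjoint inner_diff_left)
  finally show "emeasure (distr (Pi\<^sub>M UNIV (\<lambda>_. lborel)) borel (\<lambda>f. \<chi> k. f k)) (box l u)
      = ennreal (\<Prod>b\<in>Basis. (u - l) \<bullet> b)" .
qed simp

definition vec_upd :: "'a^'n::finite \<Rightarrow> 'n \<Rightarrow> 'a \<Rightarrow> 'a^'n" where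
  "vec_upd z j x = (\<chi> k. if k = j then x else z$k)"

lemma vec_upd_nth [simp]: "vec_upd z j x $ k = (if k = j then x else z$k)"
  by (simp add: vec_upd_def)

lemma vec_upd_upd [simp]: "vec_upd (vec_upd z j x) j y = vec_upd z j y"
  by (simp add: vec_eq_iff)

lemma vec_upd_torus: "\<zeta> \<in> torus \<Longrightarrow> cmod x = 1 \<Longrightarrow> vec_upd \<zeta> j x \<in> torus"
  by (simp add: torus_def)

text \<open>Fubini in the j-th angle. It reduces integrals over the torus to circle integrals, one
  coordinate at a time, while both integrands remain functions on the full torus.\<close>

lemma torus_average:
  fixes G G' :: "complex^'n::finite \<Rightarrow> complex"
  assumes [measurable]: "G \<in> borel_measurable borel" "G' \<in> borel_measurable borel"
    and bd: "\<And>\<zeta>. \<zeta> \<in> torus \<Longrightarrow> cmod (G \<zeta>) \<le> B" "\<And>\<zeta>. \<zeta> \<in> torus \<Longrightarrow> cmod (G' \<zeta>) \<le> B'"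
    and avg: "\<And>\<zeta>. \<zeta> \<in> torus \<Longrightarrow>
      (LINT s|lborel. indicator {0..2*pi} s *\<^sub>R G (vec_upd \<zeta> j (cis s))) = (2*pi) *\<^sub>R G' \<zeta>"
  shows "(LINT \<zeta>|torus_mu. G \<zeta>) = (LINT \<zeta>|torus_mu. G' \<zeta>)"
proof -
  interpret product_sigma_finite "\<lambda>_::'n. lborel :: real measure" by standard
  let ?I = "UNIV - {j}"
  let ?M = "\<lambda>I. Pi\<^sub>M I (\<lambda>_::'n. lborel :: real measure)"
  have ins: "insert j ?I = UNIV" by auto
  have split: "(LINT t|lborel. indicator torus_box t *\<^sub>R H (torus_pt t))
     = (LINT x|?M ?I. (if \<forall>k\<in>?I. 0 \<le> x k \<and> x k \<le> 2*pi then 1 else 0) *\<^sub>R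
          (LINT y|lborel. indicator {0..2*pi} y *\<^sub>R H (vec_upd (torus_pt (\<chi> k. x k)) j (cis y))))"
    if [measurable]: "H \<in> borel_measurable borel" and Hb: "\<And>\<zeta>. \<zeta> \<in> torus \<Longrightarrow> cmod (H \<zeta>) \<le> C"
    for H :: "complex^'n \<Rightarrow> complex" and C
  proof -
    have int: "integrable lborel (\<lambda>t::real^'n. indicator torus_box t *\<^sub>R H (torus_pt t))"
      using Hb[OF torus_pt_in_torus]
      by (intro integrableI_bounded_set_indicator[where B = C])
         (auto simp: emeasure_torus_box)
    have int': "integrable (?M UNIV) (\<lambda>f. indicator torus_box (\<chi> k. f k) *\<^sub>R H (torus_pt (\<chi> k. f k)))"
      using int unfolding lborel_vec_eq_distr_PiM by (subst (asm) integrable_distr_eq) auto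
    have "(LINT t|lborel. indicator torus_box t *\<^sub>R H (torus_pt t))
      = (LINT f|?M (insert j ?I). indicator torus_box (\<chi> k. f k) *\<^sub>R H (torus_pt (\<chi> k. f k)))"
      unfolding lborel_vec_eq_distr_PiM ins by (subst integral_distr) auto
    also have "\<dots> = (LINT x|?M ?I. LINT y|lborel. indicator torus_box (\<chi> k. (x(j:=y)) k) *\<^sub>R
        H (torus_pt (\<chi> k. (x(j:=y)) k)))"
      using int' by (intro product_integral_insert) (auto simp: insert_absorb ins)
    also have "\<dots> = (LINT x|?M ?I. (if \<forall>k\<in>?I. 0 \<le> x k \<and> x k \<le> 2*pi then 1 else 0) *\<^sub>R
          (LINT y|lborel. indicator {0..2*pi} y *\<^sub>R H (vec_upd (torus_pt (\<chi> k. x k)) j (cis y))))"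
    proof (rule Bochner_Integration.integral_cong[OF refl])
      fix x
      have 1: "torus_pt (\<chi> k. (x(j:=y)) k) = vec_upd (torus_pt (\<chi> k. x k)) j (cis y)" for y
        by (auto simp: torus_pt_def vec_eq_iff)
      have 2: "indicator torus_box (\<chi> k. (x(j:=y)) k)
          = (if \<forall>k\<in>?I. 0 \<le> x k \<and> x k \<le> 2*pi then 1 else 0) * (indicator {0..2*pi} y :: real)" for y
        by (auto simp: indicator_def mem_box_cart)
      show "(LINT y|lborel. indicator torus_box (\<chi> k. (x(j:=y)) k) *\<^sub>R
          H (torus_pt (\<chi> k. (x(j:=y)) k)))
        = (if \<forall>k\<in>?I. 0 \<le> x k \<and> x k \<le> 2*pi then 1 else 0) *\<^sub>R
          (LINT y|lborel. indicator {0..2*pi} y *\<^sub>R H (vec_upd (torus_pt (\<chi> k. x k)) j (cis y)))"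
        unfolding 1 2 by simp
    qed
    finally show ?thesis .
  qed
  \<comment> \<open>The left side of \<open>avg\<close> does not see the j-th coordinate of \<zeta>,
    because \<open>vec_upd\<close> overwrites it. So \<open>G'\<close> is constant in that
    coordinate, its own average is again \<open>G'\<close>, and both integrals have the same
    iterated form.\<close>
  have inv: "G' (vec_upd \<zeta> j (cis y)) = G' \<zeta>" if "\<zeta> \<in> torus" for \<zeta> y
    using avg[OF that] avg[OF vec_upd_torus[OF that, of "cis y" j]] by simp
  have "(LINT y|lborel. indicator {0..2*pi} y *\<^sub>R G' (vec_upd \<zeta> j (cis y))) = (2*pi) *\<^sub>R G' \<zeta>"
    if "\<zeta> \<in> torus" for \<zeta>
    using inv[OF that] by simp
  note avg' = this
  have "(LINT t|lborel. indicator torus_box t *\<^sub>R G (torus_pt t))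
      = (LINT t|lborel. indicator torus_box t *\<^sub>R G' (torus_pt t))"
    by (rule trans[OF split[OF assms(1) bd(1)] trans[OF _ split[OF assms(2) bd(2), symmetric]]])
       (simp_all only: avg[OF torus_pt_in_torus] avg'[OF torus_pt_in_torus])
  then show ?thesis by (simp add: integral_torus_lborel)
qed

section \<open>Fourier coefficients and the Szego kernel\<close>

lemma borel_measurable_power_int [measurable]:
  "(\<lambda>x::complex. x powi k) \<in> borel_measurable borel"
  by (cases "k \<ge> 0") (simp_all add: power_int_def)

lemma borel_measurable_cnj [measurable]: "cnj \<in> borel_measurable borel"
  by (intro borel_measurable_continuous_onI continuous_intros)

lemma borel_measurable_torus_char [measurable]:
  "torus_char k \<in> borel_measurable (borel :: (complex^'n::finite) measure)"
  unfolding torus_char_def by measurable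

lemma norm_torus_char: "\<zeta> \<in> torus \<Longrightarrow> cmod (torus_char k \<zeta>) = 1"
  by (simp add: torus_char_def prod_norm[symmetric] norm_power_int torusD)

text \<open>On the torus conjugation is inversion, so a factor \<open>cnj (\<zeta>$j)\<close> lowers
  the j-th exponent by one. Multiplication by a coordinate thereby becomes a shift of Fourier
  coefficients.\<close>

lemma torus_char_shift:
  assumes "\<zeta> \<in> torus"
  shows "torus_char (vec_upd k j (k$j - 1)) \<zeta> = torus_char k \<zeta> * cnj (\<zeta>$j)"
proof -
  have "cnj (\<zeta>$j) = inverse (\<zeta>$j)"
    using torus_cnj_mult[OF assms, of j] by (metis inverse_unique)
  moreover have "\<zeta>$j powi (k$j - 1) = \<zeta>$j powi (k$j) * inverse (\<zeta>$j)"
    using torus_nonzero[OF assms, of j] by (simp add: power_int_diff divide_inverse)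
  moreover have "(\<Prod>i\<in>UNIV-{j}. \<zeta>$i powi (vec_upd k j (k$j - 1) $ i)) = (\<Prod>i\<in>UNIV-{j}. \<zeta>$i powi (k$i))"
    by (intro prod.cong) auto
  ultimately show ?thesis
    unfolding torus_char_def by (simp add: prod.remove[of UNIV j])
qed

section \<open>Square integrable functions on the torus and products with bounded functions\<close>

lemma L2_torusD:
  assumes "f \<in> L2_torus"
  shows L2_borel: "f \<in> borel_measurable borel" and L2_square: "integrable torus_mu (\<lambda>\<zeta>. (cmod (f \<zeta>))\<^sup>2)"
  using assms by (auto simp: L2_torus_def cong: measurable_cong_sets)

lemma L2I:
  assumes "f \<in> borel_measurable borel" "integrable torus_mu (\<lambda>\<zeta>. (cmod (f \<zeta>))\<^sup>2)"
  shows "f \<in> L2_torus"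
  using assms by (auto simp: L2_torus_def cong: measurable_cong_sets)

lemma L2_mult_integrable:
  fixes f g :: "complex^'n::finite \<Rightarrow> complex"
  assumes f: "f \<in> L2_torus" and g: "g \<in> L2_torus"
  shows "integrable torus_mu (\<lambda>\<zeta>. f \<zeta> * g \<zeta>)"
proof -
  note [measurable] = L2_borel[OF f] L2_borel[OF g]
  have "integrable torus_mu (\<lambda>\<zeta>. (cmod (f \<zeta>))\<^sup>2 + (cmod (g \<zeta>))\<^sup>2)"
    using L2_square[OF f] L2_square[OF g] by simp
  moreover have "cmod (f \<zeta> * g \<zeta>) \<le> (cmod (f \<zeta>))\<^sup>2 + (cmod (g \<zeta>))\<^sup>2" for \<zeta>
    using sum_squares_bound[of "cmod (f \<zeta>)" "cmod (g \<zeta>)"]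
      mult_nonneg_nonneg[OF norm_ge_zero norm_ge_zero, of "f \<zeta>" "g \<zeta>"]
    unfolding norm_mult by linarith
  ultimately show ?thesis
    by (intro Bochner_Integration.integrable_bound[of torus_mu _ "\<lambda>\<zeta>. f \<zeta> * g \<zeta>"]) auto
qed

lemma bounded_in_L2:
  fixes u :: "complex^'n::finite \<Rightarrow> complex"
  assumes [measurable]: "u \<in> borel_measurable borel" and "\<And>\<zeta>. \<zeta> \<in> torus \<Longrightarrow> cmod (u \<zeta>) \<le> B"
  shows "u \<in> L2_torus"
proof (rule L2I)
  show "integrable torus_mu (\<lambda>\<zeta>. (cmod (u \<zeta>))\<^sup>2)"
    using assms(2) by (intro integrable_torus_bounded[where B = "B\<^sup>2"]) (auto intro: power_mono)
qed simp

lemma L2_integrable: "f \<in> L2_torus \<Longrightarrow> integrable torus_mu f"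
  using L2_mult_integrable[of f "\<lambda>_. 1"] bounded_in_L2[of "\<lambda>_. 1" 1] by simp

lemma L2_mult_bounded:
  fixes f u :: "complex^'n::finite \<Rightarrow> complex"
  assumes f: "f \<in> L2_torus" and [measurable]: "u \<in> borel_measurable borel"
    and u: "\<And>\<zeta>. \<zeta> \<in> torus \<Longrightarrow> cmod (u \<zeta>) \<le> B"
  shows "(\<lambda>\<zeta>. f \<zeta> * u \<zeta>) \<in> L2_torus"
proof (rule L2I)
  note [measurable] = L2_borel[OF f]
  show "(\<lambda>\<zeta>. f \<zeta> * u \<zeta>) \<in> borel_measurable borel" by simp
  have "integrable torus_mu (\<lambda>\<zeta>. B\<^sup>2 * (cmod (f \<zeta>))\<^sup>2)"
    using L2_square[OF f] by simp
  moreover have "AE \<zeta> in torus_mu. norm ((cmod (f \<zeta> * u \<zeta>))\<^sup>2) \<le> norm (B\<^sup>2 * (cmod (f \<zeta>))\<^sup>2)"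
    using AE_torus
  proof (rule eventually_mono)
    fix \<zeta> :: "complex^'n" assume "\<zeta> \<in> torus"
    then have "(cmod (u \<zeta>))\<^sup>2 \<le> B\<^sup>2" using u by (intro power_mono) auto
    then show "norm ((cmod (f \<zeta> * u \<zeta>))\<^sup>2) \<le> norm (B\<^sup>2 * (cmod (f \<zeta>))\<^sup>2)"
      using mult_right_mono[of "(cmod (u \<zeta>))\<^sup>2" "B\<^sup>2" "(cmod (f \<zeta>))\<^sup>2"]
      by (simp add: norm_mult power_mult_distrib mult.commute)
  qed
  ultimately show "integrable torus_mu (\<lambda>\<zeta>. (cmod (f \<zeta> * u \<zeta>))\<^sup>2)"
    by (rule_tac Bochner_Integration.integrable_bound) (assumption, simp)
qed

lemma L2_add:
  fixes f g :: "complex^'n::finite \<Rightarrow> complex"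
  assumes f: "f \<in> L2_torus" and g: "g \<in> L2_torus"
  shows "(\<lambda>\<zeta>. f \<zeta> + g \<zeta>) \<in> L2_torus"
proof (rule L2I)
  note [measurable] = L2_borel[OF f] L2_borel[OF g]
  show "(\<lambda>\<zeta>. f \<zeta> + g \<zeta>) \<in> borel_measurable borel" by simp
  have "integrable torus_mu (\<lambda>\<zeta>. 2 * (cmod (f \<zeta>))\<^sup>2 + 2 * (cmod (g \<zeta>))\<^sup>2)"
    using L2_square[OF f] L2_square[OF g] by simp
  moreover have "(cmod (f \<zeta> + g \<zeta>))\<^sup>2 \<le> 2 * (cmod (f \<zeta>))\<^sup>2 + 2 * (cmod (g \<zeta>))\<^sup>2" for \<zeta>
  proof -
    have "(cmod (f \<zeta> + g \<zeta>))\<^sup>2 \<le> (cmod (f \<zeta>) + cmod (g \<zeta>))\<^sup>2"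
      by (intro power_mono norm_triangle_ineq) auto
    also have "\<dots> \<le> 2 * (cmod (f \<zeta>))\<^sup>2 + 2 * (cmod (g \<zeta>))\<^sup>2"
      using sum_squares_bound[of "cmod (f \<zeta>)" "cmod (g \<zeta>)"] by (simp add: power2_sum)
    finally show ?thesis .
  qed
  ultimately show "integrable torus_mu (\<lambda>\<zeta>. (cmod (f \<zeta> + g \<zeta>))\<^sup>2)"
    by (intro Bochner_Integration.integrable_bound[of torus_mu _ "\<lambda>\<zeta>. (cmod (f \<zeta> + g \<zeta>))\<^sup>2"]) auto
qed

lemma L2_cmult: "f \<in> L2_torus \<Longrightarrow> (\<lambda>\<zeta>. c * f \<zeta>) \<in> L2_torus"
  using L2_mult_bounded[of f "\<lambda>_. c" "cmod c"] by (simp add: mult.commute)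

lemma L2_cnj: "f \<in> L2_torus \<Longrightarrow> (\<lambda>\<zeta>. cnj (f \<zeta>)) \<in> L2_torus"
  by (rule L2I) (auto dest: L2_torusD)

text \<open>Hoelder's inequality for an integrable and a bounded function. The bound is asked on the
  torus only, since kernels and powers are unbounded elsewhere.\<close>

lemma integrable_mult_bounded:
  fixes G u :: "complex^'n::finite \<Rightarrow> complex"
  assumes G: "integrable torus_mu G" and [measurable]: "u \<in> borel_measurable borel"
    and u: "\<And>\<zeta>. \<zeta> \<in> torus \<Longrightarrow> cmod (u \<zeta>) \<le> B"
  shows "integrable torus_mu (\<lambda>\<zeta>. G \<zeta> * u \<zeta>)"
    and "cmod (LINT \<zeta>|torus_mu. G \<zeta> * u \<zeta>) \<le> B * (LINT \<zeta>|torus_mu. cmod (G \<zeta>))"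
proof -
  have [measurable]: "G \<in> borel_measurable borel"
    using borel_measurable_integrable[OF G] by (simp cong: measurable_cong_sets)
  have i: "integrable torus_mu (\<lambda>\<zeta>. B * cmod (G \<zeta>))" using G by simp
  have ae: "AE \<zeta> in torus_mu. cmod (G \<zeta> * u \<zeta>) \<le> B * cmod (G \<zeta>)"
    using AE_torus by (rule eventually_mono)
      (use u in \<open>auto simp: norm_mult mult.commute[of "cmod (G _)"] intro!: mult_right_mono\<close>)
  show int: "integrable torus_mu (\<lambda>\<zeta>. G \<zeta> * u \<zeta>)"
    by (rule Bochner_Integration.integrable_bound[OF i]) (use ae in \<open>auto elim!: eventually_mono\<close>)
  have "cmod (LINT \<zeta>|torus_mu. G \<zeta> * u \<zeta>) \<le> (LINT \<zeta>|torus_mu. cmod (G \<zeta> * u \<zeta>))"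
    by (rule integral_norm_bound)
  also have "\<dots> \<le> (LINT \<zeta>|torus_mu. B * cmod (G \<zeta>))"
    using int i ae by (intro integral_mono_AE) auto
  finally show "cmod (LINT \<zeta>|torus_mu. G \<zeta> * u \<zeta>) \<le> B * (LINT \<zeta>|torus_mu. cmod (G \<zeta>))" by simp
qed

lemma fourier_integrable:
  "f \<in> L2_torus \<Longrightarrow> integrable torus_mu (\<lambda>\<zeta>. f \<zeta> * cnj (torus_char k \<zeta>))"
  by (rule integrable_mult_bounded[where B = 1]) (auto simp: L2_integrable norm_torus_char)

section \<open>The Hardy space and the orthogonality of characters\<close>

lemma H2_fun_subspace: "fun_subspace (H2_torus :: (complex^'n::finite \<Rightarrow> complex) set)"
  unfolding fun_subspace_def
proof (intro conjI ballI allI)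
  show "(\<lambda>x. 0) \<in> H2_torus"
    using bounded_in_L2[of "\<lambda>_. 0" 0] by (simp add: H2_torus_def fourier_coeff_def)
  show "(\<lambda>\<zeta>. f \<zeta> + g \<zeta>) \<in> H2_torus" if "f \<in> H2_torus" "g \<in> H2_torus"
    for f g :: "complex^'n \<Rightarrow> complex"
    using that fourier_integrable[of f] fourier_integrable[of g]
    by (auto simp: H2_torus_def fourier_coeff_def distrib_right L2_add)
  show "(\<lambda>\<zeta>. c * f \<zeta>) \<in> H2_torus" if "f \<in> H2_torus" for c and f :: "complex^'n \<Rightarrow> complex"
    using that by (auto simp: H2_torus_def fourier_coeff_def mult.assoc L2_cmult)
qed

lemma H2_L2: "f \<in> H2_torus \<Longrightarrow> f \<in> L2_torus"
  by (simp add: H2_torus_def)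

lemma cis_integral_period:
  assumes "m \<noteq> (0::int)"
  shows "(LINT s|lborel. indicator {0..2*pi} s *\<^sub>R cis (of_int m * s)) = 0"
proof -
  have "(LINT s|lborel. indicator {0..2*pi} s *\<^sub>R cis (of_int m * s))
      = (cis (of_int m * (2*pi)) / (\<i> * of_int m)) - (cis (of_int m * 0) / (\<i> * of_int m))"
  proof (rule integral_FTC_Icc)
    fix x :: real
    have "((\<lambda>s. exp (\<i> * of_int m * s) / (\<i> * of_int m)) has_field_derivative exp (\<i> * of_int m * complex_of_real x))
        (at (complex_of_real x))"
      using assms by (auto intro!: derivative_eq_intros)
    from has_vector_derivative_real_field[OF this]
    show "((\<lambda>s. cis (of_int m * s) / (\<i> * of_int m)) has_vector_derivative cis (of_int m * x))
        (at x within {0..2*pi})"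
      by (simp add: cis_conv_exp mult.assoc has_vector_derivative_at_within)
  next
    show "continuous_on {0..2*pi} (\<lambda>s. cis (of_int m * s))"
      by (intro continuous_intros)
  qed simp
  moreover have "cis (of_int m * (2*pi)) = 1"
    using cis_multiple_2pi[of "of_int m"] by (simp add: mult.commute)
  ultimately show ?thesis by simp
qed

text \<open>The integral over the angle of a coordinate with nonzero exponent already vanishes,
  since a nontrivial power of \<open>cis\<close> has mean zero over a period.\<close>

lemma integral_torus_char:
  fixes k :: "int^'n::finite"
  assumes "k$j \<noteq> 0"
  shows "(LINT \<zeta>|torus_mu. torus_char k \<zeta>) = 0"
proof -
  have "(LINT \<zeta>|torus_mu. torus_char k \<zeta>) = (LINT \<zeta>|(torus_mu :: (complex^'n) measure). 0)"
  proof (rule torus_average[where B = 1 and B' = 0 and j = j])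
    fix \<zeta> :: "complex^'n"
    define c where "c = (\<Prod>i\<in>UNIV-{j}. \<zeta>$i powi (k$i))"
    have "torus_char k (vec_upd \<zeta> j (cis s)) = c * cis (of_int (k$j) * s)" for s
    proof -
      have "(\<Prod>i\<in>UNIV-{j}. vec_upd \<zeta> j (cis s) $ i powi (k$i)) = c"
        unfolding c_def by (intro prod.cong) auto
      then show ?thesis
        unfolding torus_char_def by (simp add: prod.remove[of UNIV j] cis_power_int mult.commute)
    qed
    then have "(LINT s|lborel. indicator {0..2*pi} s *\<^sub>R torus_char k (vec_upd \<zeta> j (cis s)))
        = (LINT s|lborel. c * (indicator {0..2*pi} s *\<^sub>R cis (of_int (k$j) * s)))"
      by (simp add: algebra_simps)
    also have "\<dots> = c * (LINT s|lborel. indicator {0..2*pi} s *\<^sub>R cis (of_int (k$j) * s))"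
      by (rule integral_mult_right_zero)
    finally show "(LINT s|lborel. indicator {0..2*pi} s *\<^sub>R torus_char k (vec_upd \<zeta> j (cis s)))
        = (2*pi) *\<^sub>R 0"
      using cis_integral_period[OF assms] by simp
  qed (auto simp: norm_torus_char)
  then show ?thesis by simp
qed

text \<open>As the test function \<open>g\<close> in \<open>H2_multiplier\<close>, the constant 1
  turns membership of \<open>g * u\<close> into membership of \<open>u\<close>, and the reproducing
  formula into Cauchy's formula.\<close>

lemma one_in_H2: "(\<lambda>_. 1) \<in> (H2_torus :: (complex^'n::finite \<Rightarrow> complex) set)"
proof -
  have "fourier_coeff (\<lambda>_. 1) k = 0" if "k$j < 0" for k :: "int^'n" and j
  proof -
    have "fourier_coeff (\<lambda>_. 1) k = cnj (LINT \<zeta>|torus_mu. torus_char k \<zeta>)"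
      by (simp add: fourier_coeff_def)
    then show ?thesis using integral_torus_char[of k j] that by simp
  qed
  moreover have "(\<lambda>_. 1) \<in> (L2_torus :: (complex^'n \<Rightarrow> complex) set)"
    by (rule bounded_in_L2[where B = 1]) auto
  ultimately show ?thesis by (auto simp: H2_torus_def)
qed

text \<open>\<open>N\<close> is chosen before \<open>a\<close>: truncated geometric series
  approximate a product kernel uniformly. Kernels are replaced by polynomials in this way, so that
  no infinite series has to be interchanged with an integral.\<close>

lemma geometric_product_approx:
  fixes q \<epsilon> :: real
  assumes q: "0 \<le> q" "q < 1" and e: "0 < \<epsilon>"
  obtains N where "\<And>a :: 'n::finite \<Rightarrow> complex. (\<And>j. cmod (a j) \<le> q) \<Longrightarrow>
    cmod ((\<Prod>j\<in>UNIV. inverse (1 - a j)) - (\<Prod>j\<in>UNIV. \<Sum>l<N. a j ^ l)) \<le> \<epsilon>"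
proof -
  have "(\<lambda>N. real CARD('n) * q ^ N) \<longlonglongrightarrow> real CARD('n) * 0"
    using q by (intro tendsto_intros LIMSEQ_power_zero) auto
  then have "eventually (\<lambda>N. real CARD('n) * q ^ N < \<epsilon> * (1 - q) ^ CARD('n)) sequentially"
    using q e by (rule_tac order_tendstoD(2)) (assumption, simp)
  then obtain N where N: "real CARD('n) * q ^ N < \<epsilon> * (1 - q) ^ CARD('n)"
    by (auto simp: eventually_sequentially)
  show thesis
  proof (rule that[of N])
    fix a :: "'n \<Rightarrow> complex" assume a: "\<And>j. cmod (a j) \<le> q"
    have le: "1 - q \<le> cmod (1 - a j)" for j
      using norm_triangle_ineq2[of 1 "a j"] a[of j] by simp
    have ne: "1 - a j \<noteq> 0" for j using le[of j] q by auto
    have geo: "(\<Sum>l<N. a j ^ l) = inverse (1 - a j) * (1 - a j ^ N)" for j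
      using ne[of j] by (simp add: sum_gp_strict field_simps)
    have q1: "cmod (complex_of_real (1 - q)) = 1 - q"
      using q by (simp only: norm_of_real)
    \<comment> \<open>Scaling by \<open>1 - q\<close> brings every factor into the closed unit disc,
      where two products differ by at most the sum of the differences of their factors. The
      resulting power of \<open>1 - q\<close> is built into the choice of \<open>N\<close>.\<close>
    define x y where "x j = complex_of_real (1 - q) * inverse (1 - a j)"
      and "y j = complex_of_real (1 - q) * (\<Sum>l<N. a j ^ l)" for j
    have xn: "cmod (x j) \<le> 1" for j
      unfolding x_def norm_mult norm_inverse q1
      using le[of j] q by (simp add: divide_inverse[symmetric] divide_le_eq_1)
    have yn: "cmod (y j) \<le> 1" for j
    proof -
      have "cmod (\<Sum>l<N. a j ^ l) \<le> (\<Sum>l<N. q ^ l)"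
        by (rule sum_norm_le) (auto simp: norm_power intro!: power_mono a)
      also have "\<dots> \<le> 1 / (1 - q)" using q by (simp add: sum_gp_strict divide_right_mono)
      finally have "(1 - q) * cmod (\<Sum>l<N. a j ^ l) \<le> 1" using q by (simp add: field_simps)
      then show ?thesis unfolding y_def norm_mult q1 .
    qed
    have d: "cmod (x j - y j) \<le> q ^ N" for j
    proof -
      have "x j - y j = x j * a j ^ N" by (simp add: x_def y_def geo algebra_simps)
      then have "cmod (x j - y j) = cmod (x j) * cmod (a j) ^ N" by (simp add: norm_mult norm_power)
      also have "\<dots> \<le> 1 * q ^ N" using xn a by (intro mult_mono power_mono) auto
      finally show ?thesis by simp
    qed
    have "(1 - q) ^ CARD('n) * cmod ((\<Prod>j\<in>UNIV. inverse (1 - a j)) - (\<Prod>j\<in>UNIV. \<Sum>l<N. a j ^ l))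
        = cmod (complex_of_real (1 - q) ^ CARD('n) *
            ((\<Prod>j\<in>UNIV. inverse (1 - a j)) - (\<Prod>j\<in>UNIV. \<Sum>l<N. a j ^ l)))"
      unfolding norm_mult norm_power norm_of_real using q by simp
    also have "\<dots> = cmod ((\<Prod>j\<in>UNIV. x j) - (\<Prod>j\<in>UNIV. y j))"
      by (simp add: x_def y_def prod.distrib right_diff_distrib)
    also have "\<dots> \<le> (\<Sum>j\<in>(UNIV::'n set). cmod (x j - y j))"
      using xn yn by (intro norm_prod_diff) auto
    also have "\<dots> \<le> (\<Sum>j\<in>(UNIV::'n set). q ^ N)" by (intro sum_mono d)
    also have "\<dots> \<le> (1 - q) ^ CARD('n) * \<epsilon>" using N by (simp add: mult.commute)
    finally show "cmod ((\<Prod>j\<in>UNIV. inverse (1 - a j)) - (\<Prod>j\<in>UNIV. \<Sum>l<N. a j ^ l)) \<le> \<epsilon>"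
      using q by simp
  qed
qed

lemma polydisc_radius:
  fixes z :: "complex^'n::finite"
  assumes "z \<in> polydisc"
  obtains q where "0 \<le> q" "q < 1" "\<And>k. cmod (z$k) \<le> q"
proof (rule that[of "Max (range (\<lambda>k. cmod (z$k)))"])
  show "Max (range (\<lambda>k. cmod (z$k))) < 1"
    using assms by (subst Max_less_iff) (auto simp: polydisc_def)
  show le: "cmod (z$k) \<le> Max (range (\<lambda>k. cmod (z$k)))" for k by simp
  show "0 \<le> Max (range (\<lambda>k. cmod (z$k)))"
    using le norm_ge_zero order_trans by blast
qed

lemma borel_measurable_szego [measurable]:
  "(\<lambda>\<zeta>. szego \<zeta> z) \<in> borel_measurable (borel :: (complex^'n::finite) measure)"
  unfolding szego_def by measurable

lemma cnj_szego: "cnj (szego \<zeta> z) = (\<Prod>j\<in>UNIV. inverse (1 - z$j * cnj (\<zeta>$j)))"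
  by (simp add: szego_def mult.commute)

lemma szego_bounded:
  fixes z :: "complex^'n::finite"
  assumes "z \<in> polydisc"
  obtains B where "0 \<le> B" and "\<And>\<zeta>. (\<And>k. cmod (\<zeta>$k) \<le> 1) \<Longrightarrow> cmod (szego \<zeta> z) \<le> B"
proof (rule that[of "\<Prod>j\<in>UNIV. inverse (1 - cmod (z$j))"])
  have z: "cmod (z$j) < 1" for j using assms by (simp add: polydisc_def)
  show "0 \<le> (\<Prod>j\<in>UNIV. inverse (1 - cmod (z$j)))"
    using z by (intro prod_nonneg) (simp add: less_imp_le)
  fix \<zeta> :: "complex^'n" assume \<zeta>: "\<And>k. cmod (\<zeta>$k) \<le> 1"
  have "inverse (cmod (1 - \<zeta>$j * cnj (z$j))) \<le> inverse (1 - cmod (z$j))" for j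
  proof (rule le_imp_inverse_le)
    have "cmod (\<zeta>$j * cnj (z$j)) \<le> 1 * cmod (z$j)"
      unfolding norm_mult complex_mod_cnj by (intro mult_right_mono \<zeta>) auto
    then show "1 - cmod (z$j) \<le> cmod (1 - \<zeta>$j * cnj (z$j))"
      using norm_triangle_ineq2[of 1 "\<zeta>$j * cnj (z$j)"] by simp
  qed (use z in simp)
  then show "cmod (szego \<zeta> z) \<le> (\<Prod>j\<in>UNIV. inverse (1 - cmod (z$j)))"
    unfolding szego_def prod_norm[symmetric] norm_inverse by (intro prod_mono) auto
qed

lemma szego_torus_bounded:
  fixes z :: "complex^'n::finite"
  assumes "z \<in> polydisc"
  obtains B where "0 \<le> B" and "\<And>\<zeta>. \<zeta> \<in> torus \<Longrightarrow> cmod (szego \<zeta> z) \<le> B"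
proof -
  obtain B where B: "0 \<le> B" "\<And>\<zeta>. (\<And>k. cmod (\<zeta>$k) \<le> 1) \<Longrightarrow> cmod (szego \<zeta> z) \<le> B"
    using szego_bounded[OF assms] by blast
  show thesis
    by (rule that[of B]) (auto intro!: B simp: torusD)
qed

lemma eq_zero_if_norm_le_eps:
  fixes x :: "'a::real_normed_vector"
  assumes C: "0 \<le> C" and le: "\<And>\<epsilon>. 0 < \<epsilon> \<Longrightarrow> norm x \<le> \<epsilon> * C"
  shows "x = 0"
proof -
  have "norm x \<le> 0 + \<delta>" if "\<delta> > 0" for \<delta>
  proof -
    have "\<delta> / (C + 1) * C \<le> \<delta>" using that C by (simp add: field_simps)
    then show ?thesis using le[of "\<delta> / (C + 1)"] that C by simp
  qed
  then have "norm x \<le> 0" by (rule field_le_epsilon)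
  then show ?thesis by simp
qed

text \<open>Up to a uniform error, the conjugated kernel is a finite sum of conjugated monomials
  weighted by powers of \<open>z\<close>, and \<open>G\<close> pairs to zero with each weighted
  term. The weight stays in the hypothesis because the application has a point with a vanishing
  coordinate: monomials containing that coordinate drop out whatever their Fourier
  coefficient.\<close>

lemma szego_pairing_zero:
  fixes z :: "complex^'n::finite"
  assumes G: "integrable torus_mu G" and z: "z \<in> polydisc"
    and zero: "\<And>l::'n \<Rightarrow> nat. (\<Prod>j\<in>UNIV. z$j ^ l j) * (LINT \<zeta>|torus_mu. G \<zeta> * cnj (\<Prod>j\<in>UNIV. \<zeta>$j ^ l j)) = 0"
  shows "(LINT \<zeta>|torus_mu. G \<zeta> * cnj (szego \<zeta> z)) = 0"
proof -
  obtain q where q: "0 \<le> q" "q < 1" "\<And>k. cmod (z$k) \<le> q" using polydisc_radius[OF z] by blast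
  obtain B where B: "0 \<le> B" "\<And>\<zeta>. \<zeta> \<in> torus \<Longrightarrow> cmod (szego \<zeta> z) \<le> B" using szego_torus_bounded[OF z] by blast
  define C where "C = (LINT \<zeta>|torus_mu. cmod (G \<zeta>))"
  have C0: "0 \<le> C" by (simp add: C_def)
  have bound: "cmod (LINT \<zeta>|torus_mu. G \<zeta> * cnj (szego \<zeta> z)) \<le> \<epsilon> * C" if e: "\<epsilon> > 0" for \<epsilon>
  proof -
    obtain N where N: "\<And>a :: 'n \<Rightarrow> complex. (\<And>j. cmod (a j) \<le> q) \<Longrightarrow>
        cmod ((\<Prod>j\<in>UNIV. inverse (1 - a j)) - (\<Prod>j\<in>UNIV. \<Sum>l<N. a j ^ l)) \<le> \<epsilon>"
      using geometric_product_approx[OF q(1,2) e] by blast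
    define P where "P \<zeta> = (\<Prod>j\<in>UNIV. \<Sum>l<N. (z$j * cnj (\<zeta>$j)) ^ l)" for \<zeta> :: "complex^'n"
    have [measurable]: "P \<in> borel_measurable borel" unfolding P_def by measurable
    have close: "cmod (cnj (szego \<zeta> z) - P \<zeta>) \<le> \<epsilon>" if "\<zeta> \<in> torus" for \<zeta>
      unfolding cnj_szego P_def using that q by (intro N) (simp add: norm_mult torusD)
    have Pexp: "P \<zeta> = (\<Sum>l\<in>Pi\<^sub>E UNIV (\<lambda>_. {..<N}). (\<Prod>j\<in>UNIV. z$j ^ l j) * cnj (\<Prod>j\<in>UNIV. \<zeta>$j ^ l j))" for \<zeta>
      unfolding P_def by (subst prod_sum_PiE) (auto simp: power_mult_distrib prod.distrib)
    have mono: "integrable torus_mu (\<lambda>\<zeta>. G \<zeta> * cnj (\<Prod>j\<in>UNIV. \<zeta>$j ^ l j))" for l :: "'n \<Rightarrow> nat"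
      by (rule integrable_mult_bounded[OF G, where B = 1])
         (auto simp: prod_norm[symmetric] norm_power torusD)
    have "(LINT \<zeta>|torus_mu. G \<zeta> * P \<zeta>)
        = (\<Sum>l\<in>Pi\<^sub>E UNIV (\<lambda>_. {..<N}). (\<Prod>j\<in>UNIV. z$j ^ l j) * (LINT \<zeta>|torus_mu. G \<zeta> * cnj (\<Prod>j\<in>UNIV. \<zeta>$j ^ l j)))"
    proof -
      have "(\<lambda>\<zeta>. G \<zeta> * P \<zeta>) = (\<lambda>\<zeta>. \<Sum>l\<in>Pi\<^sub>E UNIV (\<lambda>_. {..<N}). (\<Prod>j\<in>UNIV. z$j ^ l j) * (G \<zeta> * cnj (\<Prod>j\<in>UNIV. \<zeta>$j ^ l j)))"
        unfolding Pexp sum_distrib_left by (simp add: mult.left_commute)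
      then show ?thesis
        using mono by (simp only:) (subst Bochner_Integration.integral_sum, auto)
    qed
    also have "\<dots> = 0" by (simp only: zero sum.neutral_const)
    finally have P0: "(LINT \<zeta>|torus_mu. G \<zeta> * P \<zeta>) = 0" .
    have iS: "integrable torus_mu (\<lambda>\<zeta>. G \<zeta> * cnj (szego \<zeta> z))"
      by (rule integrable_mult_bounded[OF G, where B = B]) (auto simp: B)
    have iD: "integrable torus_mu (\<lambda>\<zeta>. G \<zeta> * (cnj (szego \<zeta> z) - P \<zeta>))"
      by (rule integrable_mult_bounded[OF G, where B = \<epsilon>]) (auto simp: close)
    have "integrable torus_mu (\<lambda>\<zeta>. G \<zeta> * P \<zeta>)"
      using Bochner_Integration.integrable_diff[OF iS iD] by (simp add: algebra_simps)
    then have "(LINT \<zeta>|torus_mu. G \<zeta> * cnj (szego \<zeta> z)) = (LINT \<zeta>|torus_mu. G \<zeta> * (cnj (szego \<zeta> z) - P \<zeta>))"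
      using iS P0 by (simp add: right_diff_distrib)
    also have "cmod \<dots> \<le> \<epsilon> * C"
      unfolding C_def by (rule integrable_mult_bounded(2)[OF G]) (auto simp: close)
    finally show ?thesis .
  qed
  show ?thesis by (rule eq_zero_if_norm_le_eps[OF C0 bound])
qed

section \<open>Multipliers of the Hardy space\<close>

text \<open>The coefficient of the product at \<open>k\<close> is that of \<open>g\<close> at
  \<open>k\<close> lowered by one in direction \<open>j\<close>; an index with a negative entry
  keeps one.\<close>

lemma H2_mult_coordinate:
  fixes g :: "complex^'n::finite \<Rightarrow> complex"
  assumes g: "g \<in> H2_torus"
  shows "(\<lambda>\<zeta>. g \<zeta> * \<zeta>$j) \<in> H2_torus"
proof -
  note [measurable] = L2_borel[OF H2_L2[OF g]]
  have "fourier_coeff (\<lambda>\<zeta>. g \<zeta> * \<zeta>$j) k = fourier_coeff g (vec_upd k j (k$j - 1))" for k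
    unfolding fourier_coeff_def by (rule integral_torus_cong) (auto simp: torus_char_shift)
  moreover have "fourier_coeff g (vec_upd k j (k$j - 1)) = 0" if "k$i < 0" for k i
  proof -
    have "\<exists>i. vec_upd k j (k$j - 1) $ i < 0" using that by (intro exI[of _ i]) auto
    then show ?thesis using g by (auto simp: H2_torus_def)
  qed
  moreover have "(\<lambda>\<zeta>. g \<zeta> * \<zeta>$j) \<in> L2_torus"
    by (rule L2_mult_bounded[OF H2_L2[OF g], where B = 1]) (auto simp: torusD)
  ultimately show ?thesis by (auto simp: H2_torus_def)
qed

text \<open>Nothing but the Fourier coefficients of \<open>g\<close> is at hand. It suffices that
  \<open>g * (\<zeta>$j - z$j)\<close> pairs to zero with the kernel, and for this \<open>g\<close>
  need only be free of frequencies with j-th entry -1.\<close>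

lemma szego_reproduces_coordinate:
  fixes g :: "complex^'n::finite \<Rightarrow> complex"
  assumes g: "g \<in> H2_torus" and z: "z \<in> polydisc"
  shows "(LINT \<zeta>|torus_mu. g \<zeta> * \<zeta>$j * cnj (szego \<zeta> z))
    = z$j * (LINT \<zeta>|torus_mu. g \<zeta> * cnj (szego \<zeta> z))"
proof -
  note [measurable] = L2_borel[OF H2_L2[OF g]]
  \<comment> \<open>Setting the j-th coordinate of \<open>z\<close> to 0 deletes the j-th factor of
    the kernel, and the same zero kills every monomial with \<open>l j > 0\<close> in the pairing
    below.\<close>
  define z' where "z' = vec_upd z j 0"
  have z': "z' \<in> polydisc" using z by (simp add: z'_def polydisc_def)
  obtain B where B: "0 \<le> B" "\<And>\<zeta>. \<zeta> \<in> torus \<Longrightarrow> cmod (szego \<zeta> z) \<le> B"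
    using szego_torus_bounded[OF z] by blast
  note i1 = L2_integrable[OF H2_L2[OF g]] and i2 = L2_integrable[OF H2_L2[OF H2_mult_coordinate[OF g, of j]]]
  have iS: "integrable torus_mu (\<lambda>\<zeta>. g \<zeta> * cnj (szego \<zeta> z))"
    by (rule integrable_mult_bounded[OF i1, where B = B]) (auto simp: B)
  have iS': "integrable torus_mu (\<lambda>\<zeta>. g \<zeta> * \<zeta>$j * cnj (szego \<zeta> z))"
    by (rule integrable_mult_bounded[OF i2, where B = B]) (auto simp: B)
  \<comment> \<open>On the torus \<open>(\<zeta>\<^sub>j - z\<^sub>j) cnj S\<^sub>z\<close> has only frequencies with positive \<open>j\<close>-th entry.\<close>
  have alg: "(\<zeta>$j - z$j) * cnj (szego \<zeta> z) = \<zeta>$j * cnj (szego \<zeta> z')" if \<zeta>: "\<zeta> \<in> torus" for \<zeta>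
  proof -
    have "cmod (z$j * cnj (\<zeta>$j)) < 1" using z \<zeta> by (simp add: norm_mult torusD polydisc_def)
    then have ne: "1 - z$j * cnj (\<zeta>$j) \<noteq> 0" by auto
    have eq: "cnj (szego \<zeta> z) = inverse (1 - z$j * cnj (\<zeta>$j)) * cnj (szego \<zeta> z')"
    proof -
      have "(\<Prod>i\<in>UNIV-{j}. inverse (1 - z'$i * cnj (\<zeta>$i))) = (\<Prod>i\<in>UNIV-{j}. inverse (1 - z$i * cnj (\<zeta>$i)))"
        by (intro prod.cong) (auto simp: z'_def)
      moreover have "z'$j = 0" by (simp add: z'_def)
      ultimately show ?thesis
        unfolding cnj_szego by (simp add: prod.remove[of UNIV j])
    qed
    have "\<zeta>$j - z$j = \<zeta>$j * (1 - z$j * cnj (\<zeta>$j))"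
      using torus_cnj_mult[OF \<zeta>, of j] by (simp add: algebra_simps)
    then show ?thesis using ne by (simp add: eq)
  qed
  have "(LINT \<zeta>|torus_mu. (g \<zeta> * \<zeta>$j) * cnj (szego \<zeta> z')) = 0"
  proof (rule szego_pairing_zero[OF i2 z'])
    fix l :: "'n \<Rightarrow> nat"
    show "(\<Prod>i\<in>UNIV. z'$i ^ l i) * (LINT \<zeta>|torus_mu. g \<zeta> * \<zeta>$j * cnj (\<Prod>i\<in>UNIV. \<zeta>$i ^ l i)) = 0"
    proof (cases "l j = 0")
      case False
      then have "(\<Prod>i\<in>UNIV. z'$i ^ l i) = 0"
        by (intro prod_zero) (auto simp: z'_def intro!: exI[of _ j])
      then show ?thesis by simp
    next
      case True
      define k where "k = (\<chi> i. int (l i))"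
      have "(LINT \<zeta>|torus_mu. g \<zeta> * \<zeta>$j * cnj (\<Prod>i\<in>UNIV. \<zeta>$i ^ l i))
          = fourier_coeff g (vec_upd k j (k$j - 1))"
        unfolding fourier_coeff_def
      proof (rule integral_torus_cong)
        show "g \<zeta> * \<zeta>$j * cnj (\<Prod>i\<in>UNIV. \<zeta>$i ^ l i)
            = g \<zeta> * cnj (torus_char (vec_upd k j (k$j - 1)) \<zeta>)" if "\<zeta> \<in> torus" for \<zeta>
          unfolding torus_char_shift[OF that] by (simp add: torus_char_def k_def mult_ac)
      qed auto
      also have "\<dots> = 0"
        using g True by (auto simp: H2_torus_def k_def intro!: exI[of _ j])
      finally show ?thesis by simp
    qed
  qed
  moreover have "(LINT \<zeta>|torus_mu. (g \<zeta> * \<zeta>$j) * cnj (szego \<zeta> z'))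
      = (LINT \<zeta>|torus_mu. g \<zeta> * \<zeta>$j * cnj (szego \<zeta> z) - z$j * (g \<zeta> * cnj (szego \<zeta> z)))"
  proof (rule integral_torus_cong)
    fix \<zeta> :: "complex^'n" assume "\<zeta> \<in> torus"
    then have "g \<zeta> * (\<zeta>$j * cnj (szego \<zeta> z')) = g \<zeta> * ((\<zeta>$j - z$j) * cnj (szego \<zeta> z))"
      by (simp only: alg)
    then show "(g \<zeta> * \<zeta>$j) * cnj (szego \<zeta> z')
        = g \<zeta> * \<zeta>$j * cnj (szego \<zeta> z) - z$j * (g \<zeta> * cnj (szego \<zeta> z))"
      by (simp add: algebra_simps)
  qed auto
  ultimately show ?thesis using iS iS' by simp
qed

definition closed_polydisc :: "(complex^'n::finite) set" where
  "closed_polydisc = {z. \<forall>k. cmod (z$k) \<le> 1}"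

lemma torus_subset_closed_polydisc: "\<zeta> \<in> torus \<Longrightarrow> \<zeta> \<in> closed_polydisc"
  by (simp add: torus_def closed_polydisc_def)

lemma polydisc_subset_closed_polydisc: "z \<in> polydisc \<Longrightarrow> z \<in> closed_polydisc"
  by (auto simp: polydisc_def closed_polydisc_def less_imp_le)

text \<open>A working substitute for the polydisc algebra. The integrals see \<open>u\<close> on the
  torus only, so its interior values are tied to the boundary by the reproducing formula. Demanding
  the formula against every \<open>g\<close> in H^2, and not just for \<open>g = 1\<close>, makes
  the class closed under products.\<close>

definition H2_multiplier :: "(complex^'n::finite \<Rightarrow> complex) \<Rightarrow> bool" where
  "H2_multiplier u \<longleftrightarrow> u \<in> borel_measurable borel \<and> (\<exists>B. \<forall>\<zeta>\<in>torus. cmod (u \<zeta>) \<le> B) \<and>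
    (\<forall>g\<in>H2_torus. (\<lambda>\<zeta>. g \<zeta> * u \<zeta>) \<in> H2_torus \<and>
      (\<forall>z\<in>polydisc. (LINT \<zeta>|torus_mu. g \<zeta> * u \<zeta> * cnj (szego \<zeta> z))
         = u z * (LINT \<zeta>|torus_mu. g \<zeta> * cnj (szego \<zeta> z))))"

lemma H2_multiplier_borel: "H2_multiplier u \<Longrightarrow> u \<in> borel_measurable borel"
  by (simp add: H2_multiplier_def)

lemma H2_multiplier_bounded:
  assumes "H2_multiplier u"
  obtains B where "0 \<le> B" "\<And>\<zeta>. \<zeta> \<in> torus \<Longrightarrow> cmod (u \<zeta>) \<le> B"
proof -
  obtain B where "\<And>\<zeta>. \<zeta> \<in> torus \<Longrightarrow> cmod (u \<zeta>) \<le> B" using assms by (auto simp: H2_multiplier_def)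
  then have "\<And>\<zeta>. \<zeta> \<in> torus \<Longrightarrow> cmod (u \<zeta>) \<le> max 0 B" by fastforce
  then show thesis using that[of "max 0 B"] by simp
qed

lemma H2_multiplier_mult_H2:
  "H2_multiplier u \<Longrightarrow> g \<in> H2_torus \<Longrightarrow> (\<lambda>\<zeta>. g \<zeta> * u \<zeta>) \<in> H2_torus"
  by (simp add: H2_multiplier_def)

lemma H2_multiplier_reproduces:
  "H2_multiplier u \<Longrightarrow> g \<in> H2_torus \<Longrightarrow> z \<in> polydisc \<Longrightarrow>
    (LINT \<zeta>|torus_mu. g \<zeta> * u \<zeta> * cnj (szego \<zeta> z)) = u z * (LINT \<zeta>|torus_mu. g \<zeta> * cnj (szego \<zeta> z))"
  by (simp add: H2_multiplier_def)

lemma H2_multiplier_in_H2: "H2_multiplier u \<Longrightarrow> u \<in> H2_torus"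
  using H2_multiplier_mult_H2[OF _ one_in_H2, of u] by simp

lemma integrable_mult_cnj_szego:
  fixes z :: "complex^'n::finite"
  assumes "integrable torus_mu g" and z: "z \<in> polydisc"
  shows "integrable torus_mu (\<lambda>\<zeta>. g \<zeta> * cnj (szego \<zeta> z))"
proof -
  obtain B where B: "0 \<le> B" "\<And>\<zeta>. \<zeta> \<in> torus \<Longrightarrow> cmod (szego \<zeta> z) \<le> B"
    using szego_torus_bounded[OF z] by blast
  show ?thesis
    by (rule integrable_mult_bounded[OF assms(1), where B = B]) (auto simp: B)
qed

lemma H2_integrable: "g \<in> H2_torus \<Longrightarrow> integrable torus_mu g"
  by (intro L2_integrable H2_L2)

lemma H2_multiplier_const: "H2_multiplier (\<lambda>_. c)"
  using fun_subspaceD(3)[OF H2_fun_subspace]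
  by (auto simp: H2_multiplier_def mult.commute[of _ c] mult.assoc)

lemma H2_multiplier_coordinate: "H2_multiplier (\<lambda>\<zeta>. \<zeta>$j)"
  unfolding H2_multiplier_def
  using H2_mult_coordinate szego_reproduces_coordinate by (auto intro!: exI[of _ 1] simp: torusD)

lemma H2_multiplier_add:
  fixes u v :: "complex^'n::finite \<Rightarrow> complex"
  assumes u: "H2_multiplier u" and v: "H2_multiplier v"
  shows "H2_multiplier (\<lambda>\<zeta>. u \<zeta> + v \<zeta>)"
  unfolding H2_multiplier_def
proof (intro conjI ballI)
  note [measurable] = H2_multiplier_borel[OF u] H2_multiplier_borel[OF v]
  show "(\<lambda>\<zeta>. u \<zeta> + v \<zeta>) \<in> borel_measurable borel" by simp
  obtain A B where "\<And>\<zeta>. \<zeta> \<in> torus \<Longrightarrow> cmod (u \<zeta>) \<le> A" "\<And>\<zeta>. \<zeta> \<in> torus \<Longrightarrow> cmod (v \<zeta>) \<le> B"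
    using H2_multiplier_bounded[OF u] H2_multiplier_bounded[OF v] by metis
  then show "\<exists>B. \<forall>\<zeta>\<in>torus. cmod (u \<zeta> + v \<zeta>) \<le> B"
    by (intro exI[of _ "A + B"] ballI norm_triangle_le add_mono) auto
  fix g :: "complex^'n \<Rightarrow> complex" assume g: "g \<in> H2_torus"
  note m = H2_multiplier_mult_H2[OF u g] H2_multiplier_mult_H2[OF v g]
  show "(\<lambda>\<zeta>. g \<zeta> * (u \<zeta> + v \<zeta>)) \<in> H2_torus"
    using fun_subspaceD(2)[OF H2_fun_subspace m] by (simp add: distrib_left)
  fix z :: "complex^'n" assume z: "z \<in> polydisc"
  show "(LINT \<zeta>|torus_mu. g \<zeta> * (u \<zeta> + v \<zeta>) * cnj (szego \<zeta> z))
      = (u z + v z) * (LINT \<zeta>|torus_mu. g \<zeta> * cnj (szego \<zeta> z))"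
    using H2_multiplier_reproduces[OF u g z] H2_multiplier_reproduces[OF v g z]
      integrable_mult_cnj_szego[OF H2_integrable[OF m(1)] z] integrable_mult_cnj_szego[OF H2_integrable[OF m(2)] z]
    by (simp add: distrib_left distrib_right)
qed

text \<open>Here the quantification over \<open>g\<close> pays off: the property of \<open>v\<close>
  is applied to the product of \<open>g\<close> and \<open>u\<close>, which is again in H^2.\<close>

lemma H2_multiplier_mult:
  fixes u v :: "complex^'n::finite \<Rightarrow> complex"
  assumes u: "H2_multiplier u" and v: "H2_multiplier v"
  shows "H2_multiplier (\<lambda>\<zeta>. u \<zeta> * v \<zeta>)"
  unfolding H2_multiplier_def
proof (intro conjI ballI)
  note [measurable] = H2_multiplier_borel[OF u] H2_multiplier_borel[OF v]
  show "(\<lambda>\<zeta>. u \<zeta> * v \<zeta>) \<in> borel_measurable borel" by simp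
  obtain A where A: "0 \<le> A" "\<And>\<zeta>. \<zeta> \<in> torus \<Longrightarrow> cmod (u \<zeta>) \<le> A"
    using H2_multiplier_bounded[OF u] by blast
  obtain B where B: "0 \<le> B" "\<And>\<zeta>. \<zeta> \<in> torus \<Longrightarrow> cmod (v \<zeta>) \<le> B"
    using H2_multiplier_bounded[OF v] by blast
  show "\<exists>B. \<forall>\<zeta>\<in>torus. cmod (u \<zeta> * v \<zeta>) \<le> B"
    using A B by (intro exI[of _ "A * B"] ballI) (auto simp: norm_mult intro!: mult_mono)
  fix g :: "complex^'n \<Rightarrow> complex" assume g: "g \<in> H2_torus"
  note m = H2_multiplier_mult_H2[OF u g]
  show "(\<lambda>\<zeta>. g \<zeta> * (u \<zeta> * v \<zeta>)) \<in> H2_torus"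
    using H2_multiplier_mult_H2[OF v m] by (simp add: mult.assoc)
  fix z :: "complex^'n" assume z: "z \<in> polydisc"
  show "(LINT \<zeta>|torus_mu. g \<zeta> * (u \<zeta> * v \<zeta>) * cnj (szego \<zeta> z))
      = (u z * v z) * (LINT \<zeta>|torus_mu. g \<zeta> * cnj (szego \<zeta> z))"
    using H2_multiplier_reproduces[OF u g z] H2_multiplier_reproduces[OF v m z]
    by (simp add: mult.assoc mult.left_commute)
qed

lemma H2_multiplier_sum: "(\<And>i. i \<in> I \<Longrightarrow> H2_multiplier (u i)) \<Longrightarrow> H2_multiplier (\<lambda>\<zeta>. \<Sum>i\<in>I. u i \<zeta>)"
  by (induction I rule: infinite_finite_induct) (auto intro: H2_multiplier_const H2_multiplier_add)

lemma H2_multiplier_prod: "(\<And>i. i \<in> I \<Longrightarrow> H2_multiplier (u i)) \<Longrightarrow> H2_multiplier (\<lambda>\<zeta>. \<Prod>i\<in>I. u i \<zeta>)"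
  by (induction I rule: infinite_finite_induct) (auto intro: H2_multiplier_const H2_multiplier_mult)

lemma H2_multiplier_power: "H2_multiplier u \<Longrightarrow> H2_multiplier (\<lambda>\<zeta>. u \<zeta> ^ n)"
  by (induction n) (auto intro: H2_multiplier_const H2_multiplier_mult)

lemmas H2_multiplier_intros = H2_multiplier_const H2_multiplier_coordinate H2_multiplier_add
  H2_multiplier_mult H2_multiplier_sum H2_multiplier_prod H2_multiplier_power

text \<open>The two sides of the reproducing formula see different sets, the integrals the torus and
  the factor \<open>u z\<close> the interior; hence uniform approximation on the closed polydisc,
  under which both sides are continuous.\<close>

lemma H2_multiplier_uniform_limit:
  fixes u :: "complex^'n::finite \<Rightarrow> complex"
  assumes [measurable]: "u \<in> borel_measurable borel"
    and approx: "\<And>\<epsilon>. 0 < \<epsilon> \<Longrightarrow> \<exists>v. H2_multiplier v \<and> (\<forall>\<zeta>\<in>closed_polydisc. cmod (u \<zeta> - v \<zeta>) \<le> \<epsilon>)"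
  shows "H2_multiplier u"
  unfolding H2_multiplier_def
proof (intro conjI ballI)
  show "u \<in> borel_measurable borel" by simp
  obtain v where v: "H2_multiplier v" "\<And>\<zeta>. \<zeta> \<in> closed_polydisc \<Longrightarrow> cmod (u \<zeta> - v \<zeta>) \<le> 1"
    using approx[of 1] by auto
  obtain B where B: "0 \<le> B" "\<And>\<zeta>. \<zeta> \<in> torus \<Longrightarrow> cmod (v \<zeta>) \<le> B" using H2_multiplier_bounded[OF v(1)] by blast
  have ub: "cmod (u \<zeta>) \<le> 1 + B" if "\<zeta> \<in> torus" for \<zeta>
    using norm_triangle_ineq[of "u \<zeta> - v \<zeta>" "v \<zeta>"] v(2)[OF torus_subset_closed_polydisc[OF that]] B(2)[OF that]
    by simp
  then show "\<exists>B. \<forall>\<zeta>\<in>torus. cmod (u \<zeta>) \<le> B" by blast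
  fix g assume g: "g \<in> (H2_torus :: (complex^'n \<Rightarrow> complex) set)"
  note [measurable] = L2_borel[OF H2_L2[OF g]]
  have gu: "(\<lambda>\<zeta>. g \<zeta> * u \<zeta>) \<in> L2_torus"
    by (rule L2_mult_bounded[OF H2_L2[OF g] _ ub]) auto
  define C where "C = (LINT \<zeta>|torus_mu. cmod (g \<zeta>))"
  have C0: "0 \<le> C" by (simp add: C_def)
  \<comment> \<open>One estimate serves twice: with \<open>w\<close> a conjugated character it
    transfers vanishing Fourier coefficients, with \<open>w\<close> a conjugated kernel the
    reproducing formula.\<close>
  have pair: "cmod ((LINT \<zeta>|torus_mu. g \<zeta> * u \<zeta> * w \<zeta>) - (LINT \<zeta>|torus_mu. g \<zeta> * v \<zeta> * w \<zeta>)) \<le> \<epsilon> * D * C"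
    if v: "H2_multiplier v" and close: "\<And>\<zeta>. \<zeta> \<in> closed_polydisc \<Longrightarrow> cmod (u \<zeta> - v \<zeta>) \<le> \<epsilon>"
      and [measurable]: "w \<in> borel_measurable borel" and w: "\<And>\<zeta>. \<zeta> \<in> torus \<Longrightarrow> cmod (w \<zeta>) \<le> D"
      and e: "0 < \<epsilon>" for v w \<epsilon> D
  proof -
    note [measurable] = H2_multiplier_borel[OF v]
    have "integrable torus_mu (\<lambda>\<zeta>. g \<zeta> * u \<zeta> * w \<zeta>)"
      by (rule integrable_mult_bounded[OF L2_integrable[OF gu] _ w]) auto
    moreover have "integrable torus_mu (\<lambda>\<zeta>. g \<zeta> * v \<zeta> * w \<zeta>)"
      by (rule integrable_mult_bounded[OF H2_integrable[OF H2_multiplier_mult_H2[OF v g]] _ w]) auto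
    ultimately have "(LINT \<zeta>|torus_mu. g \<zeta> * u \<zeta> * w \<zeta>) - (LINT \<zeta>|torus_mu. g \<zeta> * v \<zeta> * w \<zeta>)
        = (LINT \<zeta>|torus_mu. g \<zeta> * ((u \<zeta> - v \<zeta>) * w \<zeta>))"
      by (simp add: algebra_simps)
    also have "cmod \<dots> \<le> \<epsilon> * D * C"
      unfolding C_def
    proof (rule integrable_mult_bounded(2)[OF H2_integrable[OF g]])
      show "cmod ((u \<zeta> - v \<zeta>) * w \<zeta>) \<le> \<epsilon> * D" if "\<zeta> \<in> torus" for \<zeta>
        unfolding norm_mult using that close[OF torus_subset_closed_polydisc[OF that]] w[OF that] e
        by (intro mult_mono) auto
    qed auto
    finally show ?thesis .
  qed
  have "fourier_coeff (\<lambda>\<zeta>. g \<zeta> * u \<zeta>) k = 0" if "k$j < 0" for k j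
  proof (rule eq_zero_if_norm_le_eps[OF C0])
    fix \<epsilon> :: real assume e: "0 < \<epsilon>"
    obtain v where v: "H2_multiplier v" "\<And>\<zeta>. \<zeta> \<in> closed_polydisc \<Longrightarrow> cmod (u \<zeta> - v \<zeta>) \<le> \<epsilon>"
      using approx[OF e] by auto
    have "fourier_coeff (\<lambda>\<zeta>. g \<zeta> * v \<zeta>) k = 0"
      using H2_multiplier_mult_H2[OF v(1) g] that by (auto simp: H2_torus_def)
    then show "cmod (fourier_coeff (\<lambda>\<zeta>. g \<zeta> * u \<zeta>) k) \<le> \<epsilon> * C"
      using pair[OF v(1) v(2), where w = "\<lambda>\<zeta>. cnj (torus_char k \<zeta>)" and D = 1] e
      by (simp add: fourier_coeff_def norm_torus_char)
  qed
  then show "(\<lambda>\<zeta>. g \<zeta> * u \<zeta>) \<in> H2_torus" using gu by (auto simp: H2_torus_def)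
  fix z assume z: "z \<in> (polydisc :: (complex^'n) set)"
  obtain D where D: "0 \<le> D" "\<And>\<zeta>. \<zeta> \<in> torus \<Longrightarrow> cmod (szego \<zeta> z) \<le> D"
    using szego_torus_bounded[OF z] by blast
  define I where "I = (LINT \<zeta>|torus_mu. g \<zeta> * cnj (szego \<zeta> z))"
  have "(LINT \<zeta>|torus_mu. g \<zeta> * u \<zeta> * cnj (szego \<zeta> z)) - u z * I = 0"
  proof (rule eq_zero_if_norm_le_eps)
    show "0 \<le> D * C + cmod I" using D(1) C0 by simp
    fix \<epsilon> :: real assume e: "0 < \<epsilon>"
    obtain v where v: "H2_multiplier v" "\<And>\<zeta>. \<zeta> \<in> closed_polydisc \<Longrightarrow> cmod (u \<zeta> - v \<zeta>) \<le> \<epsilon>"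
      using approx[OF e] by auto
    have "(LINT \<zeta>|torus_mu. g \<zeta> * u \<zeta> * cnj (szego \<zeta> z)) - u z * I
        = ((LINT \<zeta>|torus_mu. g \<zeta> * u \<zeta> * cnj (szego \<zeta> z)) - (LINT \<zeta>|torus_mu. g \<zeta> * v \<zeta> * cnj (szego \<zeta> z)))
          - (u z - v z) * I"
      using H2_multiplier_reproduces[OF v(1) g z] by (simp add: I_def algebra_simps)
    also have "cmod \<dots> \<le> \<epsilon> * D * C + \<epsilon> * cmod I"
    proof (rule order_trans[OF norm_triangle_ineq4 add_mono])
      show "cmod ((LINT \<zeta>|torus_mu. g \<zeta> * u \<zeta> * cnj (szego \<zeta> z)) - (LINT \<zeta>|torus_mu. g \<zeta> * v \<zeta> * cnj (szego \<zeta> z))) \<le> \<epsilon> * D * C"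
        by (rule pair[OF v(1) v(2)]) (use D e in auto)
      show "cmod ((u z - v z) * I) \<le> \<epsilon> * cmod I"
        unfolding norm_mult by (intro mult_right_mono v(2) polydisc_subset_closed_polydisc z) auto
    qed
    finally show "cmod ((LINT \<zeta>|torus_mu. g \<zeta> * u \<zeta> * cnj (szego \<zeta> z)) - u z * I) \<le> \<epsilon> * (D * C + cmod I)"
      by (simp add: algebra_simps)
  qed
  then show "(LINT \<zeta>|torus_mu. g \<zeta> * u \<zeta> * cnj (szego \<zeta> z)) = u z * (LINT \<zeta>|torus_mu. g \<zeta> * cnj (szego \<zeta> z))"
    by (simp add: I_def)
qed

text \<open>For fixed \<open>w\<close> the arguments \<open>\<zeta>$j * cnj (w$j)\<close> stay in a
  disc of radius below 1 over the whole closed polydisc, so the truncated kernels, which are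
  polynomials, converge uniformly there.\<close>

lemma H2_multiplier_szego:
  fixes w :: "complex^'n::finite"
  assumes w: "w \<in> polydisc"
  shows "H2_multiplier (\<lambda>\<zeta>. szego \<zeta> w)"
proof (rule H2_multiplier_uniform_limit)
  fix \<epsilon> :: real assume e: "0 < \<epsilon>"
  obtain q where q: "0 \<le> q" "q < 1" "\<And>k. cmod (w$k) \<le> q" using polydisc_radius[OF w] by blast
  obtain N where N: "\<And>a :: 'n \<Rightarrow> complex. (\<And>j. cmod (a j) \<le> q) \<Longrightarrow>
      cmod ((\<Prod>j\<in>UNIV. inverse (1 - a j)) - (\<Prod>j\<in>UNIV. \<Sum>l<N. a j ^ l)) \<le> \<epsilon>"
    using geometric_product_approx[OF q(1,2) e] by blast
  have "cmod (szego \<zeta> w - (\<Prod>j\<in>UNIV. \<Sum>l<N. (\<zeta>$j * cnj (w$j)) ^ l)) \<le> \<epsilon>" if "\<zeta> \<in> closed_polydisc" for \<zeta>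
    unfolding szego_def
  proof (rule N)
    show "cmod (\<zeta>$j * cnj (w$j)) \<le> q" for j
      using that q(3)[of j] mult_mono[of "cmod (\<zeta>$j)" 1 "cmod (w$j)" q]
      by (simp add: norm_mult closed_polydisc_def)
  qed
  then show "\<exists>v. H2_multiplier v \<and> (\<forall>\<zeta>\<in>closed_polydisc. cmod (szego \<zeta> w - v \<zeta>) \<le> \<epsilon>)"
    by (intro exI[of _ "\<lambda>\<zeta>. \<Prod>j\<in>UNIV. \<Sum>l<N. (\<zeta>$j * cnj (w$j)) ^ l"])
       (auto intro!: H2_multiplier_intros)
qed simp

lemma zero_in_polydisc: "0 \<in> polydisc"
  by (simp add: polydisc_def)

lemma szego_zero [simp]: "szego \<zeta> 0 = 1" "szego 0 z = 1"
  by (simp_all add: szego_def)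

text \<open>The reproducing formula at the origin, where the kernel is constantly 1. It is the
  reason why products with elements of \<open>H2_0_torus\<close> integrate to 0.\<close>

lemma H2_multiplier_mean:
  assumes "H2_multiplier u" "g \<in> H2_torus"
  shows "(LINT \<zeta>|torus_mu. g \<zeta> * u \<zeta>) = u 0 * (LINT \<zeta>|torus_mu. g \<zeta>)"
  using H2_multiplier_reproduces[OF assms zero_in_polydisc] by simp

lemma integral_cnj_szego:
  assumes "z \<in> polydisc"
  shows "(LINT \<zeta>|torus_mu. cnj (szego \<zeta> z)) = 1"
  using H2_multiplier_mean[OF H2_multiplier_szego[OF assms] one_in_H2] by simp

lemma H2_multiplier_cauchy:
  assumes "H2_multiplier u" "z \<in> polydisc"
  shows "(LINT \<zeta>|torus_mu. u \<zeta> * cnj (szego \<zeta> z)) = u z"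
  using H2_multiplier_reproduces[OF assms(1) one_in_H2 assms(2)] integral_cnj_szego[OF assms(2)] by simp

section \<open>Cauchy's formula on the polydisc\<close>

lemma bounded_linear_axis: "bounded_linear (axis j :: complex \<Rightarrow> complex^'n::finite)"
  by (rule linear_conv_bounded_linear[THEN iffD1], rule linearI) (auto simp: axis_def vec_eq_iff)

text \<open>A real Frechet derivative that commutes with multiplication by i acts along one axis as
  multiplication by \<open>L (axis j 1)\<close>, that is, as a complex derivative.\<close>

lemma holo_polydisc_slice:
  fixes \<phi> :: "complex^'n::finite \<Rightarrow> complex"
  assumes \<phi>: "holo_polydisc \<phi>" and z: "z \<in> polydisc"
  shows "(\<lambda>\<xi>. \<phi> (vec_upd z j \<xi>)) holomorphic_on ball 0 1"
proof (rule holomorphic_onI)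
  fix \<xi> :: complex assume "\<xi> \<in> ball 0 1"
  then have "vec_upd z j \<xi> \<in> polydisc" using z by (auto simp: polydisc_def)
  then obtain L where L: "(\<phi> has_derivative L) (at (vec_upd z j \<xi>))"
    and Li: "\<And>x. L (\<chi> k. \<i> * x$k) = \<i> * L x"
    using \<phi> unfolding holo_polydisc_def by blast
  interpret L: bounded_linear L using L by (rule has_derivative_bounded_linear)
  have "vec_upd z j = (\<lambda>x. vec_upd z j 0 + axis j x)"
    by (auto simp: fun_eq_iff vec_eq_iff axis_def)
  moreover have "((\<lambda>x. vec_upd z j 0 + axis j x) has_derivative axis j) (at \<xi>)"
    using has_derivative_add[OF has_derivative_const bounded_linear_imp_has_derivative[OF bounded_linear_axis]]
    by simp
  ultimately have "(vec_upd z j has_derivative axis j) (at \<xi>)" by simp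
  from diff_chain_at[OF this L]
  have d: "((\<lambda>x. \<phi> (vec_upd z j x)) has_derivative (\<lambda>h. L (axis j h))) (at \<xi>)"
    by (simp add: o_def)
  have "L (axis j h) = L (axis j 1) * h" for h
  proof -
    have "axis j h = Re h *\<^sub>R axis j 1 + Im h *\<^sub>R (\<chi> k. \<i> * (axis j 1 :: complex^'n)$k)"
      by (auto simp: vec_eq_iff axis_def complex_eq_iff)
    then have "L (axis j h) = Re h *\<^sub>R L (axis j 1) + Im h *\<^sub>R (\<i> * L (axis j 1))"
      by (simp only: L.add L.scaleR Li)
    also have "\<dots> = L (axis j 1) * h" by (simp add: complex_eq_iff)
    finally show ?thesis .
  qed
  then have "(\<lambda>h. L (axis j h)) = (*) (L (axis j 1))" by (rule ext)
  with d have "((\<lambda>x. \<phi> (vec_upd z j x)) has_field_derivative L (axis j 1)) (at \<xi>)"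
    unfolding has_field_derivative_def by argo
  then have "(\<lambda>x. \<phi> (vec_upd z j x)) field_differentiable (at \<xi>)"
    by (auto simp: field_differentiable_def)
  then show "(\<lambda>x. \<phi> (vec_upd z j x)) field_differentiable (at \<xi> within ball 0 1)"
    by (rule field_differentiable_at_within)
qed

lemma holo_polydisc_continuous:
  assumes "holo_polydisc \<phi>"
  shows "continuous_on polydisc \<phi>"
proof -
  have "continuous (at z within polydisc) \<phi>" if "z \<in> polydisc" for z
    using assms that has_derivative_continuous continuous_at_imp_continuous_at_within
    unfolding holo_polydisc_def by blast
  then show ?thesis by (simp add: continuous_on_eq_continuous_within)
qed

text \<open>Cauchy's formula on the circle of radius \<rho> with du = i u ds: the quotient u / (u -
  z) is the conjugated one-variable Szego kernel at z / \<rho>.\<close>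

lemma cauchy_circle_average:
  assumes f: "f holomorphic_on ball 0 1" and \<rho>: "0 < \<rho>" "\<rho> < 1" and z: "cmod z < \<rho>"
  shows "(LINT s|lborel. indicator {0..2*pi} s *\<^sub>R
      (f (complex_of_real \<rho> * cis s) * inverse (1 - z / \<rho> * cnj (cis s)))) = (2*pi) *\<^sub>R f z"
proof -
  let ?g = "\<lambda>s. f (complex_of_real \<rho> * cis s) * inverse (1 - z / \<rho> * cnj (cis s))"
  have sub: "complex_of_real \<rho> * cis s \<in> ball 0 1" for s using \<rho> by (simp add: norm_mult)
  have "cmod (z / \<rho> * cnj (cis s)) < 1" for s
    using z \<rho> by (simp add: norm_mult norm_divide)
  then have ne: "1 - z / \<rho> * cnj (cis s) \<noteq> 0" for s by (metis eq_iff_diff_eq_0 less_irrefl norm_one)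
  have "f holomorphic_on cball 0 \<rho>"
    by (rule holomorphic_on_subset[OF f]) (use \<rho> in auto)
  then have "((\<lambda>u. f u / (u - z)) has_contour_integral (2 * of_real pi * \<i> * f z)) (circlepath 0 \<rho>)"
    by (rule Cauchy_integral_circlepath_simple) (use z in simp)
  then have "((\<lambda>t. f (\<rho> * cis t) / (\<rho> * cis t - z) * \<rho> * \<i> * cis t) has_integral (2 * of_real pi * \<i> * f z)) {0..2*pi}"
    unfolding circlepath_def by (subst (asm) has_contour_integral_part_circlepath_iff) auto
  then have "((\<lambda>t. - \<i> * (f (\<rho> * cis t) / (\<rho> * cis t - z) * \<rho> * \<i> * cis t)) has_integral - \<i> * (2 * of_real pi * \<i> * f z)) {0..2*pi}"
    by (rule has_integral_mult_right)
  moreover have "- \<i> * (f (\<rho> * cis t) / (\<rho> * cis t - z) * \<rho> * \<i> * cis t) = ?g t" for t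
  proof -
    have c: "cis t * cnj (cis t) = 1"
      using complex_norm_square[of "cis t"] by simp
    have "\<rho> * cis t - z = (\<rho> * cis t) * (1 - z / \<rho> * cnj (cis t))"
      using \<rho> c by (simp add: algebra_simps)
    moreover have "complex_of_real \<rho> * cis t \<noteq> 0" using \<rho> by simp
    moreover have "- \<i> * (x / y * \<rho> * \<i> * cis t) = x * ((\<rho> * cis t) / y)" for x y :: complex
      by (simp add: divide_inverse mult_ac)
    ultimately show ?thesis
      by (simp only: nonzero_divide_mult_cancel_left inverse_eq_divide not_False_eq_True)
  qed
  ultimately have hi: "(?g has_integral (2*pi) *\<^sub>R f z) {0..2*pi}"
    by (simp add: scaleR_conv_of_real algebra_simps)
  have "continuous_on {0..2*pi} ?g"
  proof (intro continuous_intros)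
    show "continuous_on {0..2*pi} (\<lambda>s. f (complex_of_real \<rho> * cis s))"
      by (rule continuous_on_compose2[OF holomorphic_on_imp_continuous_on[OF f]])
         (use sub in \<open>auto intro!: continuous_intros\<close>)
  qed (use ne in auto)
  then have si: "set_integrable lborel {0..2*pi} ?g"
    by (rule borel_integrable_atLeastAtMost')
  show ?thesis
    using set_borel_integral_eq_integral(2)[OF si] integral_unique[OF hi]
    by (simp add: set_lebesgue_integral_def)
qed

lemma compact_torus: "compact (torus :: (complex^'n::finite) set)"
proof -
  have "norm \<zeta> \<le> real CARD('n)" if "\<zeta> \<in> torus" for \<zeta> :: "complex^'n"
    using L2_set_le_sum[of UNIV "\<lambda>k. norm (\<zeta>$k)"] that by (simp add: norm_vec_def torusD)
  then have "bounded (torus :: (complex^'n) set)" by (auto simp: bounded_iff)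
  then show ?thesis using closed_torus compact_eq_bounded_closed by blast
qed

lemma continuous_on_torus_borel_bounded:
  fixes f :: "complex^'n::finite \<Rightarrow> complex"
  assumes f: "continuous_on torus f"
  shows "(\<lambda>\<zeta>. if \<zeta> \<in> torus then f \<zeta> else 0) \<in> borel_measurable borel"
    and "\<exists>B. \<forall>\<zeta>\<in>torus. cmod (f \<zeta>) \<le> B"
proof -
  have "(\<lambda>\<zeta>. indicator torus \<zeta> *\<^sub>R f \<zeta>) \<in> borel_measurable borel"
    by (rule borel_measurable_continuous_on_indicator[OF borel_closed[OF closed_torus] f])
  moreover have "(\<lambda>\<zeta>. indicator torus \<zeta> *\<^sub>R f \<zeta>) = (\<lambda>\<zeta>. if \<zeta> \<in> torus then f \<zeta> else 0)"
    by (auto simp: indicator_def)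
  ultimately show "(\<lambda>\<zeta>. if \<zeta> \<in> torus then f \<zeta> else 0) \<in> borel_measurable borel" by simp
  have "bounded (f ` torus)"
    by (intro compact_imp_bounded compact_continuous_image f compact_torus)
  then show "\<exists>B. \<forall>\<zeta>\<in>torus. cmod (f \<zeta>) \<le> B" by (auto simp: bounded_iff)
qed

text \<open>The one-variable formula is used once per coordinate. The integrand is cut off outside
  the torus because \<phi> is arbitrary off the polydisc and need not even be measurable
  there.\<close>

lemma cauchy_polydisc:
  fixes \<phi> :: "complex^'n::finite \<Rightarrow> complex"
  assumes \<phi>: "holo_polydisc \<phi>" and \<rho>: "0 < \<rho>" "\<rho> < 1" and z: "\<And>k. cmod (z$k) < \<rho>"
  shows "(LINT \<zeta>|torus_mu. (if \<zeta> \<in> torus then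
      \<phi> (\<chi> k. \<rho> * \<zeta>$k) * (\<Prod>k\<in>UNIV. inverse (1 - z$k / \<rho> * cnj (\<zeta>$k))) else 0)) = \<phi> z"
proof -
  \<comment> \<open>\<open>p J\<close> puts the coordinates in \<open>J\<close> on the circle of
    radius \<rho> and leaves the others at \<open>z\<close>. The integral of \<open>G J\<close>
    stays constant as \<open>J\<close> grows from the empty set, where it is
    \<open>\<phi> z\<close>, to \<open>UNIV\<close>.\<close>
  define p where "p J \<zeta> = (\<chi> k. if k \<in> J then \<rho> * \<zeta>$k else z$k)" for J and \<zeta> :: "complex^'n"
  define K where "K J \<zeta> = (\<Prod>k\<in>J. inverse (1 - z$k / \<rho> * cnj (\<zeta>$k)))" for J and \<zeta> :: "complex^'n"
  define G where "G J \<zeta> = (if \<zeta> \<in> torus then \<phi> (p J \<zeta>) * K J \<zeta> else 0)" for J \<zeta>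
  have p: "p J \<zeta> \<in> polydisc" if "\<zeta> \<in> torus" for J \<zeta>
    using \<rho> less_trans[OF z \<rho>(2)] that by (auto simp: p_def polydisc_def norm_mult torusD)
  have ne: "1 - z$k / \<rho> * cnj (\<zeta>$k) \<noteq> 0" if "\<zeta> \<in> torus" for k \<zeta>
  proof -
    have "cmod (z$k / \<rho> * cnj (\<zeta>$k)) < 1"
      using z[of k] \<rho> that by (simp add: norm_mult norm_divide torusD)
    then show ?thesis by (metis eq_iff_diff_eq_0 less_irrefl norm_one)
  qed
  have "continuous_on torus (p J)" for J
  proof (rule continuous_on_vecI)
    show "continuous_on torus (\<lambda>\<zeta>. p J \<zeta> $ k)" for k
      by (cases "k \<in> J") (auto simp: p_def intro!: continuous_intros)
  qed
  then have "continuous_on torus (\<lambda>\<zeta>. \<phi> (p J \<zeta>))" for J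
    using p by (intro continuous_on_compose2[OF holo_polydisc_continuous[OF \<phi>]]) auto
  moreover have "continuous_on torus (K J)" for J
    unfolding K_def using ne by (intro continuous_intros) auto
  ultimately have cont: "continuous_on torus (\<lambda>\<zeta>. \<phi> (p J \<zeta>) * K J \<zeta>)" for J
    by (intro continuous_on_mult)
  have G_borel [measurable]: "G J \<in> borel_measurable borel" for J
    unfolding G_def by (rule continuous_on_torus_borel_bounded(1)[OF cont])
  have G_bd: "\<exists>B. \<forall>\<zeta>\<in>torus. cmod (G J \<zeta>) \<le> B" for J
    using continuous_on_torus_borel_bounded(2)[OF cont, of J] by (simp add: G_def)
  have "(LINT \<zeta>|torus_mu. G J \<zeta>) = \<phi> z" if "finite J" for J
    using that
  proof (induction J)
    case empty
    have "p {} \<zeta> = z" for \<zeta> by (simp add: p_def vec_eq_iff)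
    then have "(LINT \<zeta>|torus_mu. G {} \<zeta>) = (LINT \<zeta>|(torus_mu :: (complex^'n) measure). \<phi> z)"
      by (intro integral_torus_cong G_borel) (auto simp: G_def K_def)
    then show ?case by simp
  next
    case (insert j J)
    obtain B B' where B: "\<And>\<zeta>. \<zeta> \<in> torus \<Longrightarrow> cmod (G (insert j J) \<zeta>) \<le> B"
      and B': "\<And>\<zeta>. \<zeta> \<in> torus \<Longrightarrow> cmod (G J \<zeta>) \<le> B'"
      using G_bd by metis
    have "(LINT \<zeta>|torus_mu. G (insert j J) \<zeta>) = (LINT \<zeta>|torus_mu. G J \<zeta>)"
    proof (rule torus_average[OF G_borel G_borel B B', where j = j])
      fix \<zeta> :: "complex^'n" assume \<zeta>: "\<zeta> \<in> torus"
      have eq: "G (insert j J) (vec_upd \<zeta> j (cis s))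
          = K J \<zeta> * (\<phi> (vec_upd (p J \<zeta>) j (\<rho> * cis s)) * inverse (1 - z$j / \<rho> * cnj (cis s)))" for s
      proof -
        have "p (insert j J) (vec_upd \<zeta> j (cis s)) = vec_upd (p J \<zeta>) j (\<rho> * cis s)"
          by (auto simp: p_def vec_eq_iff)
        moreover have "K J (vec_upd \<zeta> j (cis s)) = K J \<zeta>"
          unfolding K_def using insert.hyps by (intro prod.cong) auto
        then have "K (insert j J) (vec_upd \<zeta> j (cis s)) = inverse (1 - z$j / \<rho> * cnj (cis s)) * K J \<zeta>"
          using insert.hyps by (simp add: K_def)
        ultimately show ?thesis
          using vec_upd_torus[OF \<zeta>, of "cis s" j] by (simp add: G_def)
      qed
      have "(LINT s|lborel. indicator {0..2*pi} s *\<^sub>R G (insert j J) (vec_upd \<zeta> j (cis s)))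
         = (LINT s|lborel. K J \<zeta> * (indicator {0..2*pi} s *\<^sub>R
            (\<phi> (vec_upd (p J \<zeta>) j (\<rho> * cis s)) * inverse (1 - z$j / \<rho> * cnj (cis s)))))"
        unfolding eq by (simp add: mult_scaleR_right)
      also have "\<dots> = K J \<zeta> * (LINT s|lborel. indicator {0..2*pi} s *\<^sub>R
            (\<phi> (vec_upd (p J \<zeta>) j (\<rho> * cis s)) * inverse (1 - z$j / \<rho> * cnj (cis s))))"
        by (rule integral_mult_right_zero)
      also have "\<dots> = K J \<zeta> * ((2*pi) *\<^sub>R \<phi> (vec_upd (p J \<zeta>) j (z$j)))"
        by (subst cauchy_circle_average[OF holo_polydisc_slice[OF \<phi> p[OF \<zeta>]] \<rho> z]) simp
      also have "vec_upd (p J \<zeta>) j (z$j) = p J \<zeta>"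
        using insert.hyps by (auto simp: p_def vec_eq_iff)
      finally show "(LINT s|lborel. indicator {0..2*pi} s *\<^sub>R G (insert j J) (vec_upd \<zeta> j (cis s)))
          = (2*pi) *\<^sub>R G J \<zeta>"
        using \<zeta> by (simp add: G_def mult.commute)
    qed
    then show ?case using insert.IH by simp
  qed
  from this[of UNIV] show ?thesis by (simp add: G_def p_def K_def cong: if_cong)
qed

text \<open>Cauchy's formula represents the dilate through kernels whose arguments have modulus at
  most \<rho> < 1, uniformly for z in the closed polydisc; truncating these kernels leaves a
  polynomial in z.\<close>

lemma holo_polydisc_dilate_approx:
  fixes \<phi> :: "complex^'n::finite \<Rightarrow> complex"
  assumes \<phi>: "holo_polydisc \<phi>" and r: "0 < r" "r < 1" and e: "0 < \<epsilon>"
  obtains v where "H2_multiplier v"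
    and "\<And>z. z \<in> closed_polydisc \<Longrightarrow> cmod (\<phi> (\<chi> k. complex_of_real r * z$k) - v z) \<le> \<epsilon>"
proof -
  \<comment> \<open>The square root splits the dilation evenly: with integration at radius \<rho>,
    the point r z enters the kernel as \<rho> z, so the values of \<phi> and the kernel both keep
    away from the boundary.\<close>
  define \<rho> where "\<rho> = sqrt r"
  have \<rho>: "0 < \<rho>" "\<rho> < 1" and r_eq: "r = \<rho> * \<rho>" using r by (auto simp: \<rho>_def)
  define F where "F \<zeta> = (if \<zeta> \<in> torus then \<phi> (\<chi> k. \<rho> * \<zeta>$k) else 0)" for \<zeta> :: "complex^'n"
  have cont: "continuous_on torus (\<lambda>\<zeta>. \<phi> (\<chi> k. \<rho> * \<zeta>$k))"
  proof (rule continuous_on_compose2[OF holo_polydisc_continuous[OF \<phi>]])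
    show "continuous_on torus (\<lambda>\<zeta>. \<chi> k. \<rho> * \<zeta>$k)"
      by (rule continuous_on_vecI) (auto intro!: continuous_intros)
    show "(\<lambda>\<zeta>. \<chi> k. \<rho> * \<zeta>$k) ` torus \<subseteq> polydisc"
      using \<rho> by (auto simp: polydisc_def norm_mult torusD)
  qed
  have [measurable]: "F \<in> borel_measurable borel"
    unfolding F_def by (rule continuous_on_torus_borel_bounded(1)[OF cont])
  obtain B where "\<And>\<zeta>. \<zeta> \<in> torus \<Longrightarrow> cmod (F \<zeta>) \<le> B"
    using continuous_on_torus_borel_bounded(2)[OF cont] by (auto simp: F_def)
  then have F: "integrable torus_mu F" by (intro integrable_torus_bounded) auto
  define C where "C = (LINT \<zeta>|torus_mu. cmod (F \<zeta>))"
  have C0: "0 \<le> C" by (simp add: C_def)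
  have e': "0 < \<epsilon> / (C + 1)" using e C0 by simp
  obtain N where N: "\<And>a :: 'n \<Rightarrow> complex. (\<And>j. cmod (a j) \<le> \<rho>) \<Longrightarrow>
      cmod ((\<Prod>j\<in>UNIV. inverse (1 - a j)) - (\<Prod>j\<in>UNIV. \<Sum>l<N. a j ^ l)) \<le> \<epsilon> / (C + 1)"
    using geometric_product_approx[OF less_imp_le[OF \<rho>(1)] \<rho>(2) e'] by blast
  let ?L = "Pi\<^sub>E (UNIV :: 'n set) (\<lambda>_. {..<N})"
  \<comment> \<open>These are the Taylor coefficients of the dilate: for each degree, one power of
    \<rho> comes from the Fourier coefficient of \<open>F\<close> and one from the explicit
    factor.\<close>
  define c where "c l = (LINT \<zeta>|torus_mu. F \<zeta> * (\<Prod>k\<in>UNIV. (\<rho> * cnj (\<zeta>$k)) ^ l k))" for l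
  define v where "v z = (\<Sum>l\<in>?L. c l * (\<Prod>k\<in>UNIV. z$k ^ l k))" for z :: "complex^'n"
  show thesis
  proof (rule that[of v])
    show "H2_multiplier v" unfolding v_def by (intro H2_multiplier_intros)
    fix z :: "complex^'n" assume z: "z \<in> closed_polydisc"
    define a where "a \<zeta> k = \<rho> * z$k * cnj (\<zeta>$k)" for \<zeta> :: "complex^'n" and k
    have a: "cmod (a \<zeta> k) \<le> \<rho>" if "\<zeta> \<in> torus" for \<zeta> k
      using that z \<rho> mult_left_mono[of "cmod (z$k)" 1 \<rho>]
      by (simp add: a_def norm_mult torusD closed_polydisc_def)
    define S P where "S \<zeta> = (\<Prod>k\<in>UNIV. inverse (1 - a \<zeta> k))"
      and "P \<zeta> = (\<Prod>k\<in>UNIV. \<Sum>l<N. a \<zeta> k ^ l)" for \<zeta>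
    have [measurable]: "S \<in> borel_measurable borel" "P \<in> borel_measurable borel"
      unfolding S_def P_def a_def by measurable
    have SP: "cmod (S \<zeta> - P \<zeta>) \<le> \<epsilon> / (C + 1)" if "\<zeta> \<in> torus" for \<zeta>
      unfolding S_def P_def by (rule N) (rule a[OF that])
    have "\<phi> (\<chi> k. complex_of_real r * z$k) = (LINT \<zeta>|torus_mu. F \<zeta> * S \<zeta>)"
    proof -
      have zr: "cmod ((\<chi> k. complex_of_real r * z$k) $ k) < \<rho>" for k
      proof -
        have "r * cmod (z$k) \<le> r * 1" using r z by (intro mult_left_mono) (auto simp: closed_polydisc_def)
        also have "\<dots> < \<rho>" using \<rho> by (simp add: r_eq)
        finally show ?thesis using r by (simp add: norm_mult)
      qed
      have a_eq: "(\<chi> k. complex_of_real r * z$k) $ k / \<rho> * cnj (\<zeta>$k) = a \<zeta> k" for \<zeta> k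
        using \<rho> by (simp add: a_def r_eq)
      show ?thesis
        unfolding cauchy_polydisc[OF \<phi> \<rho> zr, symmetric] a_eq F_def S_def[symmetric]
        by (intro arg_cong[where f = "integral\<^sup>L torus_mu"]) auto
    qed
    moreover have "v z = (LINT \<zeta>|torus_mu. F \<zeta> * P \<zeta>)"
    proof -
      have "F \<zeta> * P \<zeta> = (\<Sum>l\<in>?L. (F \<zeta> * (\<Prod>k\<in>UNIV. (\<rho> * cnj (\<zeta>$k)) ^ l k)) * (\<Prod>k\<in>UNIV. z$k ^ l k))" for \<zeta>
      proof -
        have "P \<zeta> = (\<Sum>l\<in>?L. (\<Prod>k\<in>UNIV. (\<rho> * cnj (\<zeta>$k)) ^ l k) * (\<Prod>k\<in>UNIV. z$k ^ l k))"
          unfolding P_def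
          by (subst prod_sum_PiE) (auto simp: a_def prod.distrib[symmetric] power_mult_distrib mult_ac)
        then show ?thesis by (simp add: sum_distrib_left mult.assoc)
      qed
      moreover have "integrable torus_mu (\<lambda>\<zeta>. F \<zeta> * (\<Prod>k\<in>UNIV. (\<rho> * cnj (\<zeta>$k)) ^ l k))" for l :: "'n \<Rightarrow> nat"
      proof (rule integrable_mult_bounded[OF F, where B = 1])
        show "cmod (\<Prod>k\<in>UNIV. (\<rho> * cnj (\<zeta>$k)) ^ l k) \<le> 1" if "\<zeta> \<in> torus" for \<zeta>
          unfolding prod_norm[symmetric] using \<rho> that
          by (intro prod_le_1) (auto simp: norm_mult norm_power torusD power_le_one)
      qed auto
      ultimately show ?thesis
        unfolding v_def c_def by (simp add: Bochner_Integration.integral_sum)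
    qed
    moreover have "(LINT \<zeta>|torus_mu. F \<zeta> * S \<zeta>) - (LINT \<zeta>|torus_mu. F \<zeta> * P \<zeta>)
        = (LINT \<zeta>|torus_mu. F \<zeta> * (S \<zeta> - P \<zeta>))"
    proof -
      have Pb: "cmod (P \<zeta>) \<le> real N ^ CARD('n)" if "\<zeta> \<in> torus" for \<zeta>
      proof -
        have "cmod (\<Sum>l<N. a \<zeta> k ^ l) \<le> real N" for k
        proof -
          have "cmod (\<Sum>l<N. a \<zeta> k ^ l) \<le> (\<Sum>l<N. 1)"
            using a[OF that, of k] \<rho> by (intro sum_norm_le) (auto simp: norm_power power_le_one)
          then show ?thesis by simp
        qed
        then show ?thesis
          unfolding P_def prod_norm[symmetric]
          using prod_mono[of UNIV "\<lambda>k. cmod (\<Sum>l<N. a \<zeta> k ^ l)" "\<lambda>_. real N"] by simp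
      qed
      have iP: "integrable torus_mu (\<lambda>\<zeta>. F \<zeta> * P \<zeta>)"
        by (rule integrable_mult_bounded[OF F _ Pb]) auto
      have iD: "integrable torus_mu (\<lambda>\<zeta>. F \<zeta> * (S \<zeta> - P \<zeta>))"
        by (rule integrable_mult_bounded[OF F _ SP]) auto
      have "integrable torus_mu (\<lambda>\<zeta>. F \<zeta> * S \<zeta>)"
        using Bochner_Integration.integrable_add[OF iP iD] by (simp add: algebra_simps)
      then show ?thesis using iP by (simp add: right_diff_distrib)
    qed
    moreover have "cmod (LINT \<zeta>|torus_mu. F \<zeta> * (S \<zeta> - P \<zeta>)) \<le> \<epsilon> / (C + 1) * C"
      unfolding C_def using SP[unfolded C_def] by (intro integrable_mult_bounded(2)[OF F]) auto
    moreover have "\<epsilon> / (C + 1) * C \<le> \<epsilon>" using e C0 by (simp add: field_simps)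
    ultimately show "cmod (\<phi> (\<chi> k. complex_of_real r * z$k) - v z) \<le> \<epsilon>" by simp
  qed
qed

section \<open>Interpolation\<close>

lemma H2_multiplier_pairing_Q:
  fixes z :: "'m::finite \<Rightarrow> complex^'n::finite"
  assumes u: "H2_multiplier u" and z: "\<And>i. z i \<in> polydisc"
  shows "(LINT \<zeta>|torus_mu. u \<zeta> * cnj (\<Sum>i\<in>UNIV. a i * szego \<zeta> (z i))) = (\<Sum>i\<in>UNIV. cnj (a i) * u (z i))"
proof -
  have eq: "u \<zeta> * cnj (\<Sum>i\<in>UNIV. a i * szego \<zeta> (z i)) = (\<Sum>i\<in>UNIV. cnj (a i) * (u \<zeta> * cnj (szego \<zeta> (z i))))" for \<zeta>
    by (simp add: sum_distrib_left mult_ac)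
  have "integrable torus_mu (\<lambda>\<zeta>. u \<zeta> * cnj (szego \<zeta> (z i)))" for i
    by (intro integrable_mult_cnj_szego H2_integrable H2_multiplier_in_H2 u z)
  then show ?thesis
    unfolding eq by (simp add: Bochner_Integration.integral_sum H2_multiplier_cauchy[OF u z])
qed

text \<open>Each factor is affine in one coordinate that tells node \<open>i\<close> from node
  \<open>i'\<close>, with value 1 at the former and 0 at the latter; the coordinate may vary with
  \<open>i'\<close>.\<close>

lemma H2_multiplier_separating:
  fixes z :: "'m::finite \<Rightarrow> complex^'n::finite"
  assumes "inj z"
  obtains u where "H2_multiplier u" "u (z i) = 1" "\<And>i'. i' \<noteq> i \<Longrightarrow> u (z i') = 0"
proof -
  have "\<forall>i'. \<exists>k. i' \<noteq> i \<longrightarrow> z i $ k \<noteq> z i' $ k"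
    using assms by (metis injD vec_eq_iff)
  then obtain k where k: "\<And>i'. i' \<noteq> i \<Longrightarrow> z i $ k i' \<noteq> z i' $ k i'" by metis
  define u where "u \<zeta> = (\<Prod>i'\<in>UNIV-{i}. (\<zeta> $ k i' + (- z i' $ k i')) * inverse (z i $ k i' - z i' $ k i'))"
    for \<zeta> :: "complex^'n"
  show thesis
  proof (rule that[of u])
    show "H2_multiplier u" unfolding u_def by (intro H2_multiplier_intros)
    show "u (z i) = 1" unfolding u_def using k by (intro prod.neutral) auto
    show "u (z i') = 0" if "i' \<noteq> i" for i'
      unfolding u_def using that by (intro prod_zero) (auto intro!: bexI[of _ i'])
  qed
qed

text \<open>A vector in the kernel of the Gram matrix yields a combination \<open>q\<close> of
  kernels vanishing at all nodes. Its squared L^2 norm is a combination of these values, so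
  \<open>q\<close> is 0 almost everywhere, and pairing with a separating multiplier isolates each
  coefficient.\<close>

lemma szego_gram_injective:
  fixes z :: "'m::finite \<Rightarrow> complex^'n::finite"
  assumes inj: "inj z" and z: "\<And>i. z i \<in> polydisc"
    and ker: "\<And>j. (\<Sum>i\<in>UNIV. c i * szego (z j) (z i)) = 0"
  shows "c i = 0"
proof -
  define q where "q \<zeta> = (\<Sum>i\<in>UNIV. c i * szego \<zeta> (z i))" for \<zeta>
  have q: "H2_multiplier q"
    unfolding q_def by (intro H2_multiplier_intros H2_multiplier_szego z)
  note [measurable] = H2_multiplier_borel[OF q]
  have "(LINT \<zeta>|torus_mu. q \<zeta> * cnj (q \<zeta>)) = (\<Sum>i\<in>UNIV. cnj (c i) * q (z i))"
    using H2_multiplier_pairing_Q[OF q z, where a = c] by (simp add: q_def)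
  also have "\<dots> = 0" using ker by (simp add: q_def)
  finally have "(LINT \<zeta>|torus_mu. complex_of_real ((cmod (q \<zeta>))\<^sup>2)) = 0"
    by (simp only: complex_norm_square)
  then have "(LINT \<zeta>|torus_mu. (cmod (q \<zeta>))\<^sup>2) = 0"
    unfolding integral_complex_of_real by (simp only: of_real_eq_0_iff)
  then have "AE \<zeta> in torus_mu. (cmod (q \<zeta>))\<^sup>2 = 0"
    using L2_square[OF H2_L2[OF H2_multiplier_in_H2[OF q]]]
    by (subst (asm) integral_nonneg_eq_0_iff_AE) auto
  then have q0: "AE \<zeta> in torus_mu. q \<zeta> = 0" by (rule eventually_mono) simp
  obtain u where u: "H2_multiplier u" "u (z i) = 1" "\<And>i'. i' \<noteq> i \<Longrightarrow> u (z i') = 0"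
    using H2_multiplier_separating[OF inj, of i] by blast
  note [measurable] = H2_multiplier_borel[OF u(1)]
  have "(LINT \<zeta>|torus_mu. u \<zeta> * cnj (q \<zeta>)) = (LINT \<zeta>|(torus_mu :: (complex^'n) measure). 0)"
    using q0 by (intro integral_cong_AE) (auto elim: eventually_mono)
  moreover have "(LINT \<zeta>|torus_mu. u \<zeta> * cnj (q \<zeta>)) = (\<Sum>i'\<in>UNIV. cnj (c i') * u (z i'))"
    unfolding q_def by (rule H2_multiplier_pairing_Q[OF u(1) z])
  moreover have "(\<Sum>i'\<in>UNIV. cnj (c i') * u (z i')) = (\<Sum>i'\<in>UNIV. if i' = i then cnj (c i) else 0)"
    using u by (intro sum.cong) auto
  ultimately show ?thesis by simp
qed

lemma psi_ZW_eq:
  "psi_ZW z w = (\<lambda>\<zeta>. \<Sum>i\<in>UNIV. (matrix_inv (\<chi> j i. szego (z j) (z i)) *v (\<chi> i. w i))$i * szego \<zeta> (z i))"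
  by (simp add: psi_ZW_def Let_def)

lemma H2_multiplier_psi_ZW:
  assumes "\<And>i. z i \<in> polydisc"
  shows "H2_multiplier (psi_ZW z w)"
  unfolding psi_ZW_eq by (intro H2_multiplier_intros H2_multiplier_szego assms)

text \<open>\<open>matrix_inv\<close> is a Hilbert choice and meaningful only for invertible
  matrices. Trivial kernel of the Gram matrix makes it a genuine inverse, and the interpolation
  conditions are the rows of the linear system that the coefficients solve.\<close>

lemma psi_ZW_interpolates:
  fixes z :: "'m::finite \<Rightarrow> complex^'n::finite"
  assumes inj: "inj z" and z: "\<And>i. z i \<in> polydisc"
  shows "psi_ZW z w (z j) = w j"
proof -
  define A :: "complex^'m^'m" where "A = (\<chi> j i. szego (z j) (z i))"
  have "x = 0" if "A *v x = 0" for x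
  proof -
    have "(\<Sum>i\<in>UNIV. x$i * szego (z j) (z i)) = 0" for j
      using arg_cong[OF that, of "\<lambda>y. y$j"] by (simp add: A_def matrix_vector_mult_def mult.commute)
    then show ?thesis using szego_gram_injective[OF inj z, of "\<lambda>i. x$i"] by (simp add: vec_eq_iff)
  qed
  then have "\<exists>B. A ** B = mat 1 \<and> B ** A = mat 1"
    using matrix_left_invertible_ker[of A] matrix_left_right_inverse by metis
  from someI_ex[OF this] have "A ** matrix_inv A = mat 1"
    by (simp add: matrix_inv_def)
  then have "A *v (matrix_inv A *v (\<chi> i. w i)) = (\<chi> i. w i)"
    by (simp add: matrix_vector_mul_assoc)
  from arg_cong[OF this, of "\<lambda>y. y$j"] show ?thesis
    unfolding psi_ZW_eq A_def[symmetric]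
    by (simp add: matrix_vector_mult_def[of A] mult.commute) (simp add: A_def)
qed

section \<open>The space \<open>M_Q\<close> and its pairing with multipliers\<close>

lemma set_plus_funI: "f \<in> A \<Longrightarrow> g \<in> B \<Longrightarrow> (\<lambda>x. f x + g x) \<in> set_plus_fun A B"
  by (auto simp: set_plus_fun_def)

lemma conj_setI: "f \<in> A \<Longrightarrow> (\<lambda>x. cnj (f x)) \<in> conj_set A"
  by (auto simp: conj_set_def)

lemma Q_spanI: "(\<lambda>\<zeta>. \<Sum>i\<in>UNIV. a i * szego \<zeta> (z i)) \<in> Q_span z"
  by (auto simp: Q_span_def)

lemma fun_subspace_set_plus:
  assumes A: "fun_subspace A" and B: "fun_subspace B"
  shows "fun_subspace (set_plus_fun A B)"
  unfolding fun_subspace_def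
proof (intro conjI ballI allI)
  note I = set_plus_funI[of _ A _ B]
  show "(\<lambda>x. 0) \<in> set_plus_fun A B"
    using I[OF fun_subspaceD(1)[OF A] fun_subspaceD(1)[OF B]] by simp
  show "(\<lambda>x. f x + g x) \<in> set_plus_fun A B" if fg: "f \<in> set_plus_fun A B" "g \<in> set_plus_fun A B" for f g
  proof -
    obtain f1 f2 g1 g2 where *: "f = (\<lambda>x. f1 x + f2 x)" "g = (\<lambda>x. g1 x + g2 x)"
      "f1 \<in> A" "g1 \<in> A" "f2 \<in> B" "g2 \<in> B"
      using fg by (auto simp: set_plus_fun_def)
    show ?thesis
      using I[OF fun_subspaceD(2)[OF A *(3,4)] fun_subspaceD(2)[OF B *(5,6)]] by (simp add: * add_ac)
  qed
  show "(\<lambda>x. c * f x) \<in> set_plus_fun A B" if f: "f \<in> set_plus_fun A B" for c f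
  proof -
    obtain f1 f2 where *: "f = (\<lambda>x. f1 x + f2 x)" "f1 \<in> A" "f2 \<in> B"
      using f by (auto simp: set_plus_fun_def)
    show ?thesis
      using I[OF fun_subspaceD(3)[OF A *(2)] fun_subspaceD(3)[OF B *(3)], of c c]
      by (simp add: * distrib_left)
  qed
qed

lemma fun_subspace_conj_set:
  assumes A: "fun_subspace A"
  shows "fun_subspace (conj_set A)"
  unfolding fun_subspace_def
proof (intro conjI ballI allI)
  note I = conj_setI[of _ A]
  show "(\<lambda>x. 0) \<in> conj_set A" using I[OF fun_subspaceD(1)[OF A]] by simp
  show "(\<lambda>x. f x + g x) \<in> conj_set A" if fg: "f \<in> conj_set A" "g \<in> conj_set A" for f g
  proof -
    obtain f' g' where *: "f = (\<lambda>x. cnj (f' x))" "g = (\<lambda>x. cnj (g' x))" "f' \<in> A" "g' \<in> A"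
      using fg by (auto simp: conj_set_def)
    show ?thesis using I[OF fun_subspaceD(2)[OF A *(3,4)]] by (simp add: *)
  qed
  show "(\<lambda>x. c * f x) \<in> conj_set A" if f: "f \<in> conj_set A" for c f
  proof -
    obtain f' where *: "f = (\<lambda>x. cnj (f' x))" "f' \<in> A" using f by (auto simp: conj_set_def)
    show ?thesis using I[OF fun_subspaceD(3)[OF A *(2), of "cnj c"]] by (simp add: *)
  qed
qed

lemma fun_subspace_Q_span: "fun_subspace (Q_span z)"
  unfolding fun_subspace_def
proof (intro conjI ballI allI)
  note I = Q_spanI[of _ z]
  show "(\<lambda>x. 0) \<in> Q_span z" using I[of "\<lambda>_. 0"] by simp
  show "(\<lambda>x. f x + g x) \<in> Q_span z" if fg: "f \<in> Q_span z" "g \<in> Q_span z" for f g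
  proof -
    obtain a b where *: "f = (\<lambda>\<zeta>. \<Sum>i\<in>UNIV. a i * szego \<zeta> (z i))" "g = (\<lambda>\<zeta>. \<Sum>i\<in>UNIV. b i * szego \<zeta> (z i))"
      using fg by (auto simp: Q_span_def)
    show ?thesis using I[of "\<lambda>i. a i + b i"] by (simp add: * distrib_right sum.distrib)
  qed
  show "(\<lambda>x. c * f x) \<in> Q_span z" if f: "f \<in> Q_span z" for c f
  proof -
    obtain a where *: "f = (\<lambda>\<zeta>. \<Sum>i\<in>UNIV. a i * szego \<zeta> (z i))" using f by (auto simp: Q_span_def)
    show ?thesis using I[of "\<lambda>i. c * a i"] by (simp add: * sum_distrib_left mult.assoc)
  qed
qed

text \<open>\<open>L2_inner\<close> conjugates its second argument, so orthogonality to conjugated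
  H^2 functions becomes a bilinear pairing with \<open>g\<close> itself, the form in which
  multipliers enter.\<close>

lemma M_torusI:
  fixes m :: "complex^'n::finite \<Rightarrow> complex"
  assumes m: "m \<in> L2_torus"
    and m1: "\<And>g. g \<in> H2_torus \<Longrightarrow> (LINT \<zeta>|torus_mu. m \<zeta> * g \<zeta>) = 0"
    and m2: "\<And>g. g \<in> H2_torus \<Longrightarrow> (LINT \<zeta>|torus_mu. m \<zeta> * cnj (g \<zeta>)) = 0"
  shows "m \<in> M_torus"
proof -
  have "L2_inner m (\<lambda>\<zeta>. cnj (g \<zeta>) + h \<zeta>) = 0" if "g \<in> H2_torus" "h \<in> H2_torus" for g h
    using m1[OF that(1)] m2[OF that(2)] L2_mult_integrable[OF m H2_L2[OF that(1)]]
      L2_mult_integrable[OF m L2_cnj[OF H2_L2[OF that(2)]]]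
    by (simp add: L2_inner_def distrib_left)
  then show ?thesis
    using m by (auto simp: M_torus_def set_plus_fun_def conj_set_def)
qed

lemma M_torusD:
  fixes m :: "complex^'n::finite \<Rightarrow> complex"
  assumes m: "m \<in> M_torus"
  shows M_torus_L2: "m \<in> L2_torus"
    and M_torus_orth: "g \<in> H2_torus \<Longrightarrow> (LINT \<zeta>|torus_mu. m \<zeta> * g \<zeta>) = 0"
    and M_torus_orth_cnj: "g \<in> H2_torus \<Longrightarrow> (LINT \<zeta>|torus_mu. m \<zeta> * cnj (g \<zeta>)) = 0"
proof -
  have inner: "L2_inner m (\<lambda>\<zeta>. cnj (g \<zeta>) + h \<zeta>) = 0" if "g \<in> H2_torus" "h \<in> H2_torus" for g h
    using m that by (fastforce simp: M_torus_def set_plus_fun_def conj_set_def)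
  note zero = fun_subspaceD(1)[OF H2_fun_subspace]
  show "m \<in> L2_torus" using m by (simp add: M_torus_def)
  show "(LINT \<zeta>|torus_mu. m \<zeta> * g \<zeta>) = 0" if "g \<in> H2_torus"
    using inner[OF that zero] by (simp add: L2_inner_def)
  show "(LINT \<zeta>|torus_mu. m \<zeta> * cnj (g \<zeta>)) = 0" if "g \<in> H2_torus"
    using inner[OF zero that] by (simp add: L2_inner_def)
qed

lemma fun_subspace_M_torus: "fun_subspace (M_torus :: (complex^'n::finite \<Rightarrow> complex) set)"
  unfolding fun_subspace_def
proof (intro conjI ballI allI)
  show "(\<lambda>x. 0) \<in> M_torus"
    using H2_L2[OF fun_subspaceD(1)[OF H2_fun_subspace]] by (intro M_torusI) auto
  show "(\<lambda>x. f x + g x) \<in> M_torus" if f: "f \<in> M_torus" and g: "g \<in> M_torus" for f g :: "complex^'n \<Rightarrow> complex"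
  proof (rule M_torusI)
    show "(\<lambda>x. f x + g x) \<in> L2_torus" by (intro L2_add M_torus_L2 f g)
    fix h :: "complex^'n \<Rightarrow> complex" assume h: "h \<in> H2_torus"
    note h2 = H2_L2[OF h] L2_cnj[OF H2_L2[OF h]]
    show "(LINT \<zeta>|torus_mu. (f \<zeta> + g \<zeta>) * h \<zeta>) = 0"
      using L2_mult_integrable[OF M_torus_L2[OF f] h2(1)] L2_mult_integrable[OF M_torus_L2[OF g] h2(1)]
      by (simp add: distrib_right M_torus_orth[OF f h] M_torus_orth[OF g h])
    show "(LINT \<zeta>|torus_mu. (f \<zeta> + g \<zeta>) * cnj (h \<zeta>)) = 0"
      using L2_mult_integrable[OF M_torus_L2[OF f] h2(2)] L2_mult_integrable[OF M_torus_L2[OF g] h2(2)]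
      by (simp add: distrib_right M_torus_orth_cnj[OF f h] M_torus_orth_cnj[OF g h])
  qed
  show "(\<lambda>x. c * f x) \<in> M_torus" if f: "f \<in> M_torus" for c and f :: "complex^'n \<Rightarrow> complex"
    by (rule M_torusI)
       (simp_all add: L2_cmult M_torus_L2 M_torus_orth M_torus_orth_cnj f mult.assoc)
qed

lemma H2_0_torus_iff: "f \<in> H2_0_torus \<longleftrightarrow> f \<in> H2_torus \<and> (LINT \<zeta>|torus_mu. f \<zeta>) = 0"
  by (simp add: H2_0_torus_def fourier_coeff_def torus_char_def)

lemma fun_subspace_H2_0: "fun_subspace (H2_0_torus :: (complex^'n::finite \<Rightarrow> complex) set)"
  unfolding fun_subspace_def
proof (intro conjI ballI allI)
  note H = fun_subspaceD[OF H2_fun_subspace[where 'n = 'n]]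
  show "(\<lambda>x::complex^'n. 0) \<in> H2_0_torus" using H(1) by (simp add: H2_0_torus_iff)
  show "(\<lambda>x. f x + g x) \<in> H2_0_torus" if "f \<in> H2_0_torus" "g \<in> H2_0_torus"
    for f g :: "complex^'n \<Rightarrow> complex"
    using that H(2)[of f g] H2_integrable[of f] H2_integrable[of g] by (simp add: H2_0_torus_iff)
  show "(\<lambda>x. c * f x) \<in> H2_0_torus" if "f \<in> H2_0_torus" for c and f :: "complex^'n \<Rightarrow> complex"
    using that H(3)[of f c] by (simp add: H2_0_torus_iff)
qed

lemma fun_subspace_M_Q: "fun_subspace (M_Q z)"
  unfolding M_Q_def
  by (intro fun_subspace_set_plus fun_subspace_conj_set fun_subspace_Q_span fun_subspace_M_torus fun_subspace_H2_0)

lemma M_Q_I: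
  "q \<in> Q_span z \<Longrightarrow> m \<in> M_torus \<Longrightarrow> h \<in> H2_0_torus \<Longrightarrow> (\<lambda>\<zeta>. cnj (q \<zeta>) + m \<zeta> + h \<zeta>) \<in> M_Q z"
  unfolding M_Q_def by (intro set_plus_funI conj_setI)

text \<open>The coefficients \<open>a\<close> depend on \<open>f\<close> alone, so \<open>f\<close>
  cannot distinguish multipliers that agree at the nodes. Orthogonality of \<open>m\<close> to the
  conjugates of H^2 removes \<open>u * m\<close>; the mean of \<open>u * h\<close> is
  \<open>u 0\<close> times the mean of \<open>h\<close>, which is 0.\<close>

lemma M_Q_pairing:
  fixes z :: "'m::finite \<Rightarrow> complex^'n::finite"
  assumes f: "f \<in> M_Q z" and z: "\<And>i. z i \<in> polydisc"
  obtains a where "integrable torus_mu f"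
    and "\<And>u. H2_multiplier u \<Longrightarrow> (LINT \<zeta>|torus_mu. u \<zeta> * f \<zeta>) = (\<Sum>i\<in>UNIV. cnj (a i) * u (z i))"
proof -
  obtain a m h where f_eq: "f = (\<lambda>\<zeta>. cnj (\<Sum>i\<in>UNIV. a i * szego \<zeta> (z i)) + m \<zeta> + h \<zeta>)"
    and m: "m \<in> M_torus" and h: "h \<in> H2_0_torus"
    using f unfolding M_Q_def set_plus_fun_def conj_set_def Q_span_def by fast
  define q where "q \<zeta> = (\<Sum>i\<in>UNIV. a i * szego \<zeta> (z i))" for \<zeta>
  have q: "H2_multiplier q" unfolding q_def by (intro H2_multiplier_intros H2_multiplier_szego z)
  have h2: "h \<in> H2_torus" and h0: "(LINT \<zeta>|torus_mu. h \<zeta>) = 0" using h by (auto simp: H2_0_torus_iff)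
  note l2 = L2_cnj[OF H2_L2[OF H2_multiplier_in_H2[OF q]]] M_torus_L2[OF m] H2_L2[OF h2]
  show thesis
  proof (rule that[of a])
    show "integrable torus_mu f"
      unfolding f_eq q_def[symmetric] by (intro L2_integrable L2_add l2)
    fix u :: "complex^'n \<Rightarrow> complex" assume u: "H2_multiplier u"
    note uH = H2_multiplier_in_H2[OF u]
    have "(LINT \<zeta>|torus_mu. u \<zeta> * f \<zeta>)
        = (LINT \<zeta>|torus_mu. u \<zeta> * cnj (q \<zeta>)) + (LINT \<zeta>|torus_mu. u \<zeta> * m \<zeta>) + (LINT \<zeta>|torus_mu. u \<zeta> * h \<zeta>)"
      unfolding f_eq q_def[symmetric]
      using L2_mult_integrable[OF H2_L2[OF uH] l2(1)] L2_mult_integrable[OF H2_L2[OF uH] l2(2)]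
        L2_mult_integrable[OF H2_L2[OF uH] l2(3)]
      by (simp add: distrib_left)
    moreover have "(LINT \<zeta>|torus_mu. u \<zeta> * m \<zeta>) = 0"
      using M_torus_orth[OF m uH] by (simp add: mult.commute)
    moreover have "(LINT \<zeta>|torus_mu. u \<zeta> * h \<zeta>) = 0"
      using H2_multiplier_mean[OF u h2] h0 by (simp add: mult.commute)
    ultimately show "(LINT \<zeta>|torus_mu. u \<zeta> * f \<zeta>) = (\<Sum>i\<in>UNIV. cnj (a i) * u (z i))"
      using H2_multiplier_pairing_Q[OF u z, where a = a] by (simp add: q_def)
  qed
qed

lemma cnj_szego_in_M_Q:
  fixes z :: "'m::finite \<Rightarrow> complex^'n::finite"
  shows "(\<lambda>\<zeta>. cnj (szego \<zeta> (z i))) \<in> M_Q z"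
proof -
  have "(\<lambda>\<zeta>. \<Sum>i'\<in>UNIV. (if i' = i then 1 else 0) * szego \<zeta> (z i')) \<in> Q_span z"
    by (rule Q_spanI)
  moreover have "(\<Sum>i'\<in>UNIV. (if i' = i then 1 else 0) * szego \<zeta> (z i')) = szego \<zeta> (z i)" for \<zeta>
    by (simp add: if_distrib[of "\<lambda>x. x * _"] cong: if_cong)
  ultimately have "(\<lambda>\<zeta>. szego \<zeta> (z i)) \<in> Q_span z" by simp
  from M_Q_I[OF this fun_subspaceD(1)[OF fun_subspace_M_torus] fun_subspaceD(1)[OF fun_subspace_H2_0]]
  show ?thesis by simp
qed

text \<open>Up to the factor \<open>S(v,v)\<close> this is the Poisson kernel at \<open>v\<close> minus the conjugated
  Szego kernel: its analytic part goes to \<open>H\<^sup>2\<^sub>0\<close> and the rest has only mixed frequencies.\<close>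

lemma poisson_defect_in_M_Q:
  fixes z :: "'m::finite \<Rightarrow> complex^'n::finite"
  assumes v: "v \<in> polydisc"
  shows "(\<lambda>\<zeta>. szego \<zeta> v * cnj (szego \<zeta> v) - szego v v * cnj (szego \<zeta> v)) \<in> M_Q z"
proof -
  define S where "S \<zeta> = szego \<zeta> v" for \<zeta>
  define c where "c = szego v v"
  have cnj_c: "cnj c = c" by (simp add: c_def szego_def mult.commute)
  have S: "H2_multiplier S" unfolding S_def by (rule H2_multiplier_szego[OF v])
  note [measurable] = H2_multiplier_borel[OF S]
  obtain B where B: "0 \<le> B" "\<And>\<zeta>. \<zeta> \<in> torus \<Longrightarrow> cmod (S \<zeta>) \<le> B" using H2_multiplier_bounded[OF S] by blast
  \<comment> \<open>The subtracted \<open>c * (cnj (S \<zeta>) + S \<zeta> - 1)\<close> in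
    \<open>m\<close> is the part of |S|^2 lying in the sum of H^2 and its conjugate; the -1 corrects
    for the constant term occurring in both. \<open>h\<close> is the analytic half of it without its
    constant.\<close>
  define h where "h \<zeta> = c * (S \<zeta> + (- 1))" for \<zeta>
  define m where "m \<zeta> = S \<zeta> * cnj (S \<zeta>) + (- c) * (cnj (S \<zeta>) + S \<zeta> + (- 1))" for \<zeta>
  have "H2_multiplier h" unfolding h_def by (intro H2_multiplier_intros S)
  then have hH: "h \<in> H2_torus" by (rule H2_multiplier_in_H2)
  have "(LINT \<zeta>|torus_mu. h \<zeta>) = 0"
    using H2_multiplier_mean[OF \<open>H2_multiplier h\<close> one_in_H2] by (simp add: h_def S_def)
  with hH have h: "h \<in> H2_0_torus" by (simp add: H2_0_torus_iff)
  have one: "(\<lambda>_. - 1) \<in> L2_torus" by (rule bounded_in_L2[where B = 1]) auto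
  note SL = H2_L2[OF H2_multiplier_in_H2[OF S]]
  have SS: "(\<lambda>\<zeta>. S \<zeta> * cnj (S \<zeta>)) \<in> L2_torus"
    by (rule L2_mult_bounded[OF SL, where B = B]) (auto simp: B)
  have mL: "m \<in> L2_torus"
    unfolding m_def by (intro L2_add L2_cmult L2_cnj SL SS one)
  have orth: "(LINT \<zeta>|torus_mu. m \<zeta> * g \<zeta>) = 0" if g: "g \<in> H2_torus" for g
  proof -
    have i1: "integrable torus_mu (\<lambda>\<zeta>. g \<zeta> * S \<zeta> * cnj (S \<zeta>))"
      using L2_mult_integrable[OF H2_L2[OF g] SS] by (simp add: mult.assoc)
    have i2: "integrable torus_mu (\<lambda>\<zeta>. g \<zeta> * cnj (S \<zeta>))" by (rule L2_mult_integrable[OF H2_L2[OF g] L2_cnj[OF SL]])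
    have i3: "integrable torus_mu (\<lambda>\<zeta>. g \<zeta> * S \<zeta>)" by (rule L2_mult_integrable[OF H2_L2[OF g] SL])
    have eq: "m \<zeta> * g \<zeta> = g \<zeta> * S \<zeta> * cnj (S \<zeta>) - c * (g \<zeta> * cnj (S \<zeta>)) - c * (g \<zeta> * S \<zeta>) + c * g \<zeta>" for \<zeta>
      by (simp add: m_def algebra_simps)
    have "(LINT \<zeta>|torus_mu. g \<zeta> * S \<zeta> * cnj (S \<zeta>)) = c * (LINT \<zeta>|torus_mu. g \<zeta> * cnj (S \<zeta>))"
      using H2_multiplier_reproduces[OF S g v] by (simp add: S_def c_def)
    moreover have "(LINT \<zeta>|torus_mu. g \<zeta> * S \<zeta>) = (LINT \<zeta>|torus_mu. g \<zeta>)"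
      using H2_multiplier_mean[OF S g] by (simp add: S_def)
    ultimately show ?thesis
      unfolding eq using i1 i2 i3 H2_integrable[OF g] by simp
  qed
  have m: "m \<in> M_torus"
  proof (rule M_torusI[OF mL orth])
    fix g assume g: "g \<in> (H2_torus :: (complex^'n \<Rightarrow> complex) set)"
    \<comment> \<open>Since \<open>c\<close> is real, \<open>m\<close> is real valued, and the
      second orthogonality is the conjugate of the first.\<close>
    have "cnj (m \<zeta>) = m \<zeta>" for \<zeta> by (simp add: m_def cnj_c algebra_simps)
    then have eq: "m \<zeta> * cnj (g \<zeta>) = cnj (m \<zeta> * g \<zeta>)" for \<zeta> by simp
    have "(LINT \<zeta>|torus_mu. m \<zeta> * cnj (g \<zeta>)) = cnj (LINT \<zeta>|torus_mu. m \<zeta> * g \<zeta>)"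
      unfolding eq by (rule Bochner_Integration.integral_cnj)
    then show "(LINT \<zeta>|torus_mu. m \<zeta> * cnj (g \<zeta>)) = 0"
      by (simp only: orth[OF g] complex_cnj_zero)
  qed
  \<comment> \<open>The component in \<open>Q_span z\<close> is zero, so the defect belongs to
    \<open>M_Q z\<close> for any nodes.\<close>
  from M_Q_I[OF fun_subspaceD(1)[OF fun_subspace_Q_span] m h]
  have "(\<lambda>\<zeta>. cnj 0 + m \<zeta> + h \<zeta>) \<in> M_Q z" .
  moreover have "cnj 0 + m \<zeta> + h \<zeta> = szego \<zeta> v * cnj (szego \<zeta> v) - szego v v * cnj (szego \<zeta> v)" for \<zeta>
    by (simp add: m_def h_def S_def c_def algebra_simps)
  ultimately show ?thesis by simp
qed

section \<open>From an interpolating Schur function to a contraction\<close>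

lemma schur_interpolation_imp_contraction:
  fixes z :: "'m::finite \<Rightarrow> complex^'n::finite"
  assumes inj: "inj z" and z: "\<And>i. z i \<in> polydisc"
    and \<phi>: "\<phi> \<in> schur_class" and \<phi>w: "\<And>i. \<phi> (z i) = w i" and f: "f \<in> M_Q z"
  shows "cmod (LINT \<zeta>|torus_mu. psi_ZW z w \<zeta> * f \<zeta>) \<le> (LINT \<zeta>|torus_mu. cmod (f \<zeta>))"
proof -
  have holo: "holo_polydisc \<phi>" and le1: "\<And>v. v \<in> polydisc \<Longrightarrow> cmod (\<phi> v) \<le> 1"
    using \<phi> by (auto simp: schur_class_def)
  obtain a where fi: "integrable torus_mu f"
    and pair: "\<And>u. H2_multiplier u \<Longrightarrow> (LINT \<zeta>|torus_mu. u \<zeta> * f \<zeta>) = (\<Sum>i\<in>UNIV. cnj (a i) * u (z i))"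
    using M_Q_pairing[OF f z] by blast
  define N where "N = (LINT \<zeta>|torus_mu. cmod (f \<zeta>))"
  define A where "A = (\<Sum>i\<in>UNIV. cmod (a i))"
  have N0: "0 \<le> N" by (simp add: N_def)
  have A0: "0 \<le> A" by (simp add: A_def sum_nonneg)
  \<comment> \<open>Only the prescribed values are left of \<psi>, so a multiplier that nearly takes
    them at the nodes and is nearly bounded by 1 on the torus can stand in for it.\<close>
  have psi: "(LINT \<zeta>|torus_mu. psi_ZW z w \<zeta> * f \<zeta>) = (\<Sum>i\<in>UNIV. cnj (a i) * w i)"
    using pair[OF H2_multiplier_psi_ZW[of z w]] z by (simp add: psi_ZW_interpolates[OF inj z])
  \<comment> \<open>The sup bound 1 + \<epsilon> of the approximant costs
    \<open>(1 + \<epsilon>) * N\<close>. Each node value is off by at most 2\<epsilon>, one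
    \<epsilon> for the dilation and one for the polynomial approximation, which costs
    \<open>2 * \<epsilon> * A\<close>.\<close>
  have bound: "cmod (\<Sum>i\<in>UNIV. cnj (a i) * w i) \<le> N + \<epsilon> * (N + 2 * A)" if e: "0 < \<epsilon>" for \<epsilon>
  proof -
    have lim: "((\<lambda>r. \<phi> (\<chi> k. complex_of_real r * z i $ k)) \<longlongrightarrow> w i) (at_left 1)" for i
    proof -
      have "isCont \<phi> (z i)"
        using holo z has_derivative_continuous unfolding holo_polydisc_def by blast
      moreover have "((\<lambda>r. \<chi> k. complex_of_real r * z i $ k) \<longlongrightarrow> z i) (at_left 1)"
        by (rule vec_tendstoI) (auto intro!: tendsto_eq_intros)
      ultimately show ?thesis
        using isCont_tendsto_compose[of "z i" \<phi>] by (simp add: \<phi>w)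
    qed
    have "eventually (\<lambda>r. \<forall>i. dist (\<phi> (\<chi> k. complex_of_real r * z i $ k)) (w i) < \<epsilon>) (at_left 1)"
      by (intro eventually_all_finite tendstoD[OF lim] e)
    moreover have "eventually (\<lambda>r::real. r \<in> {0<..<1}) (at_left 1)"
      by (rule eventually_at_left_real) simp
    ultimately have "eventually (\<lambda>r. (\<forall>i. dist (\<phi> (\<chi> k. complex_of_real r * z i $ k)) (w i) < \<epsilon>) \<and> r \<in> {0<..<1}) (at_left 1)"
      by (rule eventually_conj)
    from eventually_happens'[OF trivial_limit_at_left_real this]
    obtain r where r: "0 < r" "r < 1" "\<And>i. dist (\<phi> (\<chi> k. complex_of_real r * z i $ k)) (w i) < \<epsilon>"
      by auto
    obtain v where v: "H2_multiplier v"
      "\<And>\<zeta>. \<zeta> \<in> closed_polydisc \<Longrightarrow> cmod (\<phi> (\<chi> k. complex_of_real r * \<zeta>$k) - v \<zeta>) \<le> \<epsilon>"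
      using holo_polydisc_dilate_approx[OF holo r(1,2) e] by blast
    note [measurable] = H2_multiplier_borel[OF v(1)]
    have vb: "cmod (v \<zeta>) \<le> 1 + \<epsilon>" if "\<zeta> \<in> torus" for \<zeta>
    proof -
      have "(\<chi> k. complex_of_real r * \<zeta>$k) \<in> polydisc"
        using r that by (auto simp: polydisc_def norm_mult torusD)
      from le1[OF this] v(2)[OF torus_subset_closed_polydisc[OF that]]
      show ?thesis
        using norm_triangle_ineq3[of "\<phi> (\<chi> k. complex_of_real r * \<zeta>$k)" "v \<zeta>"] by linarith
    qed
    have "cmod (LINT \<zeta>|torus_mu. v \<zeta> * f \<zeta>) \<le> (1 + \<epsilon>) * N"
      using integrable_mult_bounded(2)[OF fi _ vb] by (simp add: N_def mult.commute)
    then have 1: "cmod (\<Sum>i\<in>UNIV. cnj (a i) * v (z i)) \<le> (1 + \<epsilon>) * N"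
      by (simp add: pair[OF v(1)])
    have close: "cmod (w i - v (z i)) \<le> 2 * \<epsilon>" for i
    proof -
      have "cmod (w i - v (z i)) \<le> cmod (w i - \<phi> (\<chi> k. complex_of_real r * z i $ k))
          + cmod (\<phi> (\<chi> k. complex_of_real r * z i $ k) - v (z i))"
        using norm_triangle_ineq[of "w i - \<phi> (\<chi> k. complex_of_real r * z i $ k)"
            "\<phi> (\<chi> k. complex_of_real r * z i $ k) - v (z i)"] by simp
      then show ?thesis
        using r(3)[of i] v(2)[OF polydisc_subset_closed_polydisc[OF z], of i]
        by (simp add: dist_norm norm_minus_commute)
    qed
    have "cmod (\<Sum>i\<in>UNIV. cnj (a i) * (w i - v (z i))) \<le> (\<Sum>i\<in>UNIV. cmod (a i) * (2 * \<epsilon>))"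
      by (rule sum_norm_le) (auto simp: norm_mult intro!: mult_left_mono close)
    then have 2: "cmod (\<Sum>i\<in>UNIV. cnj (a i) * (w i - v (z i))) \<le> 2 * \<epsilon> * A"
      by (simp add: A_def sum_distrib_left mult.commute)
    have "(\<Sum>i\<in>UNIV. cnj (a i) * w i) = (\<Sum>i\<in>UNIV. cnj (a i) * v (z i)) + (\<Sum>i\<in>UNIV. cnj (a i) * (w i - v (z i)))"
      by (simp add: sum.distrib[symmetric] algebra_simps)
    then have "cmod (\<Sum>i\<in>UNIV. cnj (a i) * w i)
        \<le> cmod (\<Sum>i\<in>UNIV. cnj (a i) * v (z i)) + cmod (\<Sum>i\<in>UNIV. cnj (a i) * (w i - v (z i)))"
      by (simp only: norm_triangle_ineq)
    also have "\<dots> \<le> (1 + \<epsilon>) * N + 2 * \<epsilon> * A" using 1 2 by (rule add_mono)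
    finally show ?thesis by (simp add: algebra_simps)
  qed
  have "cmod (\<Sum>i\<in>UNIV. cnj (a i) * w i) \<le> N + \<delta>" if "0 < \<delta>" for \<delta>
  proof -
    have "\<delta> / (N + 2 * A + 1) * (N + 2 * A) \<le> \<delta>" using that N0 A0 by (simp add: field_simps)
    then show ?thesis using bound[of "\<delta> / (N + 2 * A + 1)"] that N0 A0 by simp
  qed
  then show ?thesis unfolding psi N_def by (rule field_le_epsilon)
qed

section \<open>From a contraction to an interpolating Schur function\<close>

lemma clinear_on_sum:
  assumes V: "fun_subspace V" and L: "clinear_on V L" and f: "\<And>k. k \<in> K \<Longrightarrow> f k \<in> V"
  shows "(\<lambda>x. \<Sum>k\<in>K. c k * f k x) \<in> V \<and> L (\<lambda>x. \<Sum>k\<in>K. c k * f k x) = (\<Sum>k\<in>K. c k * L (f k))"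
  using f
proof (induction K rule: infinite_finite_induct)
  case (insert k K)
  then show ?case
    using L fun_subspaceD(2)[OF V fun_subspaceD(3)[OF V, of "f k" "c k"], of "\<lambda>x. \<Sum>k\<in>K. c k * f k x"]
      fun_subspaceD(3)[OF V, of "f k" "c k"] by (simp add: clinear_on_def)
qed (use fun_subspaceD(1)[OF V] L in \<open>force simp: clinear_on_def\<close>)+

lemma clinear_onD:
  assumes "clinear_on V L"
  shows "f \<in> V \<Longrightarrow> g \<in> V \<Longrightarrow> L (\<lambda>x. f x + g x) = L f + L g"
    and "f \<in> V \<Longrightarrow> L (\<lambda>x. c * f x) = c * L f"
  using assms by (auto simp: clinear_on_def)

lemma clinear_on_diff:
  assumes V: "fun_subspace V" and L: "clinear_on V L" and f: "f \<in> V" "g \<in> V"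
  shows "(\<lambda>x. f x - g x) \<in> V" and "L (\<lambda>x. f x - g x) = L f - L g"
proof -
  note g' = fun_subspaceD(3)[OF V f(2), of "-1"]
  show "(\<lambda>x. f x - g x) \<in> V" using fun_subspaceD(2)[OF V f(1) g'] by simp
  have "L (\<lambda>x. f x + (-1) * g x) = L f + L (\<lambda>x. (-1) * g x)"
    by (rule clinear_onD(1)[OF L f(1) g'])
  moreover have "L (\<lambda>x. (-1) * g x) = (-1) * L g" by (rule clinear_onD(2)[OF L f(2)])
  ultimately show "L (\<lambda>x. f x - g x) = L f - L g" by simp
qed

lemma fun_subspace_integrable: "fun_subspace {f. integrable torus_mu f}"
  by (auto simp: fun_subspace_def)

lemma integral_cmod_torus_le:
  fixes u :: "complex^'n::finite \<Rightarrow> complex"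
  assumes u: "integrable torus_mu u" and le: "\<And>\<zeta>. \<zeta> \<in> torus \<Longrightarrow> cmod (u \<zeta>) \<le> B"
  shows "(LINT \<zeta>|torus_mu. cmod (u \<zeta>)) \<le> B"
proof -
  interpret finite_measure "torus_mu :: (complex^'n) measure" by (rule finite_measure_torus_mu)
  have "(LINT \<zeta>|torus_mu. cmod (u \<zeta>)) \<le> (LINT \<zeta>|(torus_mu :: (complex^'n) measure). B)"
    using u AE_torus by (intro integral_mono_AE) (auto elim!: eventually_mono dest: le)
  then show ?thesis by simp
qed

lemma has_derivative_prod_inverse_at_0:
  "((\<lambda>x::complex^'n::finite. \<Prod>j\<in>UNIV. inverse (1 - x$j)) has_derivative (\<lambda>h. \<Sum>j\<in>UNIV. h$j)) (at 0)"
proof -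
  have "((\<lambda>x::complex^'n. inverse (1 - x$j)) has_derivative (\<lambda>h. h$j)) (at 0)" for j
  proof -
    have "((\<lambda>x::complex^'n. x$j) has_derivative (\<lambda>h. h$j)) (at 0)"
      by (rule bounded_linear_imp_has_derivative) (rule bounded_linear_vec_nth)
    then show ?thesis by (auto intro!: derivative_eq_intros)
  qed
  from has_derivative_prod[where I = UNIV, OF this] show ?thesis by simp
qed

text \<open>Write \<open>F\<close> for the conjugated Szego kernel at \<open>v\<close>.  On the torus
  \<open>cnj S\<^sub>v\<^sub>+\<^sub>h = F \<cdot> R (h \<cdot> y)\<close> with \<open>R x = \<Prod>\<^sub>j (1 - x\<^sub>j)\<^sup>-\<^sup>1\<close> and bounded
  \<open>y\<close>, so differentiability of \<open>R\<close> at \<open>0\<close> gives differentiability uniformly on the torus.\<close>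

lemma holo_polydisc_functional_szego:
  fixes L :: "(complex^'n::finite \<Rightarrow> complex) \<Rightarrow> complex"
  assumes L: "clinear_on {f. integrable torus_mu f} L"
    and L_le: "\<And>f. integrable torus_mu f \<Longrightarrow> cmod (L f) \<le> (LINT \<zeta>|torus_mu. cmod (f \<zeta>))"
  shows "holo_polydisc (\<lambda>v. L (\<lambda>\<zeta>. cnj (szego \<zeta> v)))"
  unfolding holo_polydisc_def
proof
  let ?V = "{f :: complex^'n \<Rightarrow> complex. integrable torus_mu f}"
  have V: "fun_subspace ?V" by (rule fun_subspace_integrable)
  fix v :: "complex^'n" assume v: "v \<in> polydisc"
  define F where "F \<zeta> = cnj (szego \<zeta> v)" for \<zeta>
  have [measurable]: "F \<in> borel_measurable borel" unfolding F_def by measurable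
  \<comment> \<open>\<open>y k\<close> is the logarithmic derivative of the conjugated kernel in
    \<open>v$k\<close>; \<open>D\<close> below is therefore \<open>L\<close> applied to the
    derivative of the kernel.\<close>
  define y where "y k \<zeta> = cnj (\<zeta>$k) * inverse (1 - v$k * cnj (\<zeta>$k))" for k and \<zeta> :: "complex^'n"
  have [measurable]: "y k \<in> borel_measurable borel" for k unfolding y_def by measurable
  define D where "D h = (\<Sum>k\<in>UNIV. h$k * L (\<lambda>\<zeta>. F \<zeta> * y k \<zeta>))" for h :: "complex^'n"
  define R where "R x = (\<Prod>j\<in>UNIV. inverse (1 - x$j))" for x :: "complex^'n"
  obtain q where q: "0 \<le> q" "q < 1" "\<And>k. cmod (v$k) \<le> q" using polydisc_radius[OF v] by blast
  obtain B where B: "0 \<le> B" "\<And>\<zeta>. \<zeta> \<in> torus \<Longrightarrow> cmod (F \<zeta>) \<le> B"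
    using szego_torus_bounded[OF v] unfolding F_def by auto
  define C where "C = inverse (1 - q)"
  have C: "0 < C" using q by (simp add: C_def)
  have ge: "1 - q \<le> cmod (1 - v$k * cnj (\<zeta>$k))" if "\<zeta> \<in> torus" for k \<zeta>
    using norm_triangle_ineq2[of 1 "v$k * cnj (\<zeta>$k)"] q(3)[of k] that by (simp add: norm_mult torusD)
  have y_le: "cmod (y k \<zeta>) \<le> C" if "\<zeta> \<in> torus" for k \<zeta>
    using le_imp_inverse_le[OF ge[OF that, of k]] q that
    unfolding y_def C_def norm_mult norm_inverse by (simp add: torusD)
  have F_int: "integrable torus_mu F"
    by (rule integrable_torus_bounded[OF _ B(2)]) auto
  have Fy_int: "integrable torus_mu (\<lambda>\<zeta>. F \<zeta> * y k \<zeta>)" for k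
    by (rule integrable_mult_bounded[OF F_int _ y_le]) auto
  have bl: "bounded_linear D"
    by (rule linear_conv_bounded_linear[THEN iffD1], rule linearI)
       (auto simp: D_def distrib_right sum.distrib scaleR_sum_right)
  have "((\<lambda>v. L (\<lambda>\<zeta>. cnj (szego \<zeta> v))) has_derivative D) (at v)"
    unfolding has_derivative_at_alt
  proof (intro conjI bl allI impI)
    fix e :: real assume e: "0 < e"
    \<comment> \<open>The remainder picks up the bounds \<open>B\<close> of \<open>F\<close> and
      \<open>C\<close> of \<open>y\<close>; the added 1 keeps the denominator positive even if
      \<open>B\<close> is 0.\<close>
    define e' where "e' = e / (B * C + 1)"
    have BC: "0 \<le> B * C" using B C by simp
    have e': "0 < e'" using e BC by (simp add: e'_def)
    have "\<exists>d>0. \<forall>x. norm (x - 0) < d \<longrightarrow> norm (R x - R 0 - (\<Sum>j\<in>UNIV. (x - 0)$j)) \<le> e' * norm (x - 0)"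
      using has_derivative_prod_inverse_at_0[where 'n = 'n] e'
      unfolding has_derivative_at_alt R_def by blast
    then obtain d where d: "0 < d" "\<And>x. norm x < d \<Longrightarrow> cmod (R x - 1 - (\<Sum>j\<in>UNIV. x$j)) \<le> e' * norm x"
      by (auto simp: R_def)
    \<comment> \<open>The first bound keeps \<open>x \<zeta>\<close> inside the ball on which the
      expansion of \<open>R\<close> is valid, the second keeps \<open>v'\<close> in the
      polydisc.\<close>
    define \<delta> where "\<delta> = min (d / C) (1 - q)"
    show "\<exists>\<delta>>0. \<forall>v'. norm (v' - v) < \<delta> \<longrightarrow>
        cmod (L (\<lambda>\<zeta>. cnj (szego \<zeta> v')) - L (\<lambda>\<zeta>. cnj (szego \<zeta> v)) - D (v' - v)) \<le> e * norm (v' - v)"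
    proof (intro exI[of _ \<delta>] conjI allI impI)
      show "0 < \<delta>" using d C q by (simp add: \<delta>_def)
      fix v' :: "complex^'n" assume small: "norm (v' - v) < \<delta>"
      define h where "h = v' - v"
      have hd: "C * norm h < d" and hq: "norm h < 1 - q"
        using small C by (simp_all add: h_def \<delta>_def field_simps)
      have v': "v' \<in> polydisc"
      proof -
        have "cmod (v'$k) < 1" for k
        proof -
          have "cmod (v'$k) \<le> cmod (v$k) + cmod (h$k)"
            using norm_triangle_ineq[of "v$k" "h$k"] by (simp add: h_def)
          then show ?thesis using q(3)[of k] Finite_Cartesian_Product.norm_nth_le[of h k] hq by linarith
        qed
        then show ?thesis by (simp add: polydisc_def)
      qed
      define x where "x \<zeta> = (\<chi> k. h$k * y k \<zeta>)" for \<zeta>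
      have x_le: "norm (x \<zeta>) \<le> C * norm h" if "\<zeta> \<in> torus" for \<zeta>
      proof -
        have "norm (x \<zeta>) \<le> L2_set (\<lambda>k. C * cmod (h$k)) UNIV"
          unfolding norm_vec_def x_def
          by (intro L2_set_mono) (auto simp: norm_mult mult.commute[of C] intro!: mult_left_mono y_le[OF that])
        also have "\<dots> = C * norm h" using C by (simp add: norm_vec_def L2_set_right_distrib)
        finally show ?thesis .
      qed
      have S': "cnj (szego \<zeta> v') = F \<zeta> * R (x \<zeta>)" if "\<zeta> \<in> torus" for \<zeta>
      proof -
        have "1 - v'$k * cnj (\<zeta>$k) = (1 - v$k * cnj (\<zeta>$k)) * (1 - x \<zeta> $ k)" for k
        proof -
          have "1 - v$k * cnj (\<zeta>$k) \<noteq> 0" using ge[OF that, of k] q by auto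
          then show ?thesis by (simp add: x_def y_def h_def field_simps)
        qed
        then show ?thesis
          unfolding cnj_szego F_def R_def by (simp add: prod.distrib[symmetric])
      qed
      \<comment> \<open>The first-order remainder of the kernel as a function on the torus. Its sup
        bound controls its L^1 norm, and the contractivity of \<open>L\<close> passes this on to the
        remainder of the functional.\<close>
      define G where "G \<zeta> = cnj (szego \<zeta> v') - F \<zeta> - (\<Sum>k\<in>UNIV. h$k * (F \<zeta> * y k \<zeta>))" for \<zeta>
      have G_le: "cmod (G \<zeta>) \<le> e * norm h" if "\<zeta> \<in> torus" for \<zeta>
      proof -
        have "G \<zeta> = F \<zeta> * (R (x \<zeta>) - 1 - (\<Sum>k\<in>UNIV. x \<zeta> $ k))"
          by (simp add: G_def S'[OF that] x_def algebra_simps sum_distrib_left)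
        then have "cmod (G \<zeta>) = cmod (F \<zeta>) * cmod (R (x \<zeta>) - 1 - (\<Sum>k\<in>UNIV. x \<zeta> $ k))"
          by (simp add: norm_mult)
        also have "\<dots> \<le> B * (e' * (C * norm h))"
        proof (intro mult_mono B that)
          have "cmod (R (x \<zeta>) - 1 - (\<Sum>k\<in>UNIV. x \<zeta> $ k)) \<le> e' * norm (x \<zeta>)"
            using x_le[OF that] hd by (intro d) simp
          also have "\<dots> \<le> e' * (C * norm h)" using x_le[OF that] e' by (intro mult_left_mono) auto
          finally show "cmod (R (x \<zeta>) - 1 - (\<Sum>k\<in>UNIV. x \<zeta> $ k)) \<le> e' * (C * norm h)" .
        qed auto
        also have "\<dots> = (e * (B * C) / (B * C + 1)) * norm h" by (simp add: e'_def)
        also have "\<dots> \<le> e * norm h"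
          using e BC by (intro mult_right_mono) (auto simp: field_simps)
        finally show ?thesis .
      qed
      have S'_int: "integrable torus_mu (\<lambda>\<zeta>. cnj (szego \<zeta> v'))"
        using integrable_mult_cnj_szego[OF H2_integrable[OF one_in_H2] v'] by simp
      have sum: "(\<lambda>\<zeta>. \<Sum>k\<in>UNIV. h$k * (F \<zeta> * y k \<zeta>)) \<in> ?V"
        "L (\<lambda>\<zeta>. \<Sum>k\<in>UNIV. h$k * (F \<zeta> * y k \<zeta>)) = D h"
        using clinear_on_sum[OF V L, of UNIV "\<lambda>k \<zeta>. F \<zeta> * y k \<zeta>" "\<lambda>k. h$k"] Fy_int by (auto simp: D_def)
      have S'F: "(\<lambda>\<zeta>. cnj (szego \<zeta> v') - F \<zeta>) \<in> ?V"
        "L (\<lambda>\<zeta>. cnj (szego \<zeta> v') - F \<zeta>) = L (\<lambda>\<zeta>. cnj (szego \<zeta> v')) - L F"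
        using clinear_on_diff[OF V L] S'_int F_int by auto
      have G: "integrable torus_mu G" "L G = L (\<lambda>\<zeta>. cnj (szego \<zeta> v')) - L F - D h"
        using clinear_on_diff[OF V L S'F(1) sum(1)] unfolding G_def S'F(2) sum(2) by auto
      have "cmod (L G) \<le> e * norm h"
        using L_le[OF G(1)] integral_cmod_torus_le[OF G(1) G_le] by linarith
      then show "cmod (L (\<lambda>\<zeta>. cnj (szego \<zeta> v')) - L (\<lambda>\<zeta>. cnj (szego \<zeta> v)) - D (v' - v)) \<le> e * norm (v' - v)"
        unfolding G(2) by (simp add: h_def F_def[abs_def])
    qed
  qed
  moreover have "D (\<chi> k. \<i> * x$k) = \<i> * D x" for x
    by (simp add: D_def sum_distrib_left mult.assoc)
  ultimately show "\<exists>L'. ((\<lambda>v. L (\<lambda>\<zeta>. cnj (szego \<zeta> v))) has_derivative L') (at v) \<and>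
      (\<forall>x. L' (\<chi> k. \<i> * x$k) = \<i> * L' x)"
    by blast
qed

lemma contraction_imp_schur_interpolation:
  fixes z :: "'m::finite \<Rightarrow> complex^'n::finite"
  assumes inj: "inj z" and z: "\<And>i. z i \<in> polydisc"
    and contr: "\<And>f. f \<in> M_Q z \<Longrightarrow>
      cmod (LINT \<zeta>|torus_mu. psi_ZW z w \<zeta> * f \<zeta>) \<le> (LINT \<zeta>|torus_mu. cmod (f \<zeta>))"
  shows "\<exists>\<phi>\<in>schur_class. \<forall>i. \<phi> (z i) = w i"
proof -
  let ?V = "{f :: complex^'n \<Rightarrow> complex. integrable torus_mu f}"
  let ?\<psi> = "psi_ZW z w"
  note \<psi> = H2_multiplier_psi_ZW[where z = z and w = w, OF z]
  obtain B where B: "0 \<le> B" "\<And>\<zeta>. \<zeta> \<in> torus \<Longrightarrow> cmod (?\<psi> \<zeta>) \<le> B"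
    using H2_multiplier_bounded[OF \<psi>] by blast
  have MV: "M_Q z \<subseteq> ?V" using M_Q_pairing[where z = z, OF _ z] by blast
  have \<psi>f: "integrable torus_mu (\<lambda>\<zeta>. ?\<psi> \<zeta> * f \<zeta>)" if "f \<in> M_Q z" for f
    using integrable_mult_bounded(1)[of f ?\<psi> B] MV that B(2) H2_multiplier_borel[OF \<psi>]
    by (auto simp: mult.commute)
  obtain L where L: "clinear_on ?V L" and L_M: "\<And>f. f \<in> M_Q z \<Longrightarrow> L f = (LINT \<zeta>|torus_mu. ?\<psi> \<zeta> * f \<zeta>)"
    and L_le: "\<And>f. f \<in> ?V \<Longrightarrow> cmod (L f) \<le> (LINT \<zeta>|torus_mu. cmod (f \<zeta>))"
  proof (rule hahn_banach_complex[OF fun_subspace_integrable fun_subspace_M_Q MV,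
        where p = "\<lambda>f. LINT \<zeta>|torus_mu. cmod (f \<zeta>)" and l = "\<lambda>f. LINT \<zeta>|torus_mu. ?\<psi> \<zeta> * f \<zeta>"])
    fix f g :: "complex^'n \<Rightarrow> complex" and c
    assume f: "f \<in> ?V"
    show "(LINT \<zeta>|torus_mu. cmod (c * f \<zeta>)) = cmod c * (LINT \<zeta>|torus_mu. cmod (f \<zeta>))"
      by (simp add: norm_mult)
    assume g: "g \<in> ?V"
    have "(LINT \<zeta>|torus_mu. cmod (f \<zeta> + g \<zeta>)) \<le> (LINT \<zeta>|torus_mu. cmod (f \<zeta>) + cmod (g \<zeta>))"
      using f g by (intro integral_mono) (auto intro: norm_triangle_ineq)
    then show "(LINT \<zeta>|torus_mu. cmod (f \<zeta> + g \<zeta>)) \<le> (LINT \<zeta>|torus_mu. cmod (f \<zeta>)) + (LINT \<zeta>|torus_mu. cmod (g \<zeta>))"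
      using f g by simp
  next
    show "clinear_on (M_Q z) (\<lambda>f. LINT \<zeta>|torus_mu. ?\<psi> \<zeta> * f \<zeta>)"
      using \<psi>f by (auto simp: clinear_on_def distrib_left mult.left_commute)
  qed (use contr in auto)
  define \<phi> where "\<phi> v = L (\<lambda>\<zeta>. cnj (szego \<zeta> v))" for v
  have "\<phi> (z i) = w i" for i
    using L_M[OF cnj_szego_in_M_Q] H2_multiplier_cauchy[OF \<psi> z, of i]
    by (simp add: \<phi>_def psi_ZW_interpolates[OF inj z])
  moreover have "holo_polydisc \<phi>"
    unfolding \<phi>_def using L_le by (intro holo_polydisc_functional_szego L) auto
  moreover have "cmod (\<phi> v) \<le> 1" if v: "v \<in> polydisc" for v
  proof -
    define S where "S \<zeta> = szego \<zeta> v" for \<zeta>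
    have S: "H2_multiplier S" unfolding S_def by (rule H2_multiplier_szego[OF v])
    note SL = H2_L2[OF H2_multiplier_in_H2[OF S]]
    have cS: "(\<lambda>\<zeta>. cnj (S \<zeta>)) \<in> ?V" using L2_integrable[OF L2_cnj[OF SL]] by simp
    have SS: "(\<lambda>\<zeta>. S \<zeta> * cnj (S \<zeta>)) \<in> ?V" using L2_mult_integrable[OF SL L2_cnj[OF SL]] by simp
    have SvS: "(\<lambda>\<zeta>. S v * cnj (S \<zeta>)) \<in> ?V" using cS by simp
    \<comment> \<open>The multiplier \<open>S\<close> comes out of the pairing of
      \<open>\<psi> * S\<close> with the kernel at \<open>v\<close> as the constant
      \<open>S v\<close>, so the functional of \<psi> cannot tell |S|^2 from
      \<open>S v * cnj S\<close>. Both need not lie in \<open>M_Q\<close>, but their difference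
      does, and there \<open>L\<close> agrees with \<psi>.\<close>
    have "(LINT \<zeta>|torus_mu. ?\<psi> \<zeta> * (S \<zeta> * cnj (S \<zeta>) - S v * cnj (S \<zeta>)))
        = (LINT \<zeta>|torus_mu. ?\<psi> \<zeta> * S \<zeta> * cnj (S \<zeta>)) - S v * (LINT \<zeta>|torus_mu. ?\<psi> \<zeta> * cnj (S \<zeta>))"
      using integrable_mult_cnj_szego[OF H2_integrable[OF H2_multiplier_mult_H2[OF S H2_multiplier_in_H2[OF \<psi>]]] v]
        integrable_mult_cnj_szego[OF H2_integrable[OF H2_multiplier_in_H2[OF \<psi>]] v]
      by (simp add: S_def[symmetric] right_diff_distrib mult.assoc mult.left_commute[of _ "S v"])
    also have "\<dots> = 0"
      using H2_multiplier_reproduces[OF S H2_multiplier_in_H2[OF \<psi>] v] by (simp add: S_def)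
    finally have "L (\<lambda>\<zeta>. S \<zeta> * cnj (S \<zeta>) - S v * cnj (S \<zeta>)) = 0"
      using L_M[OF poisson_defect_in_M_Q[OF v]] by (simp add: S_def)
    then have "L (\<lambda>\<zeta>. S \<zeta> * cnj (S \<zeta>)) = L (\<lambda>\<zeta>. S v * cnj (S \<zeta>))"
      using clinear_on_diff(2)[OF fun_subspace_integrable L SS SvS] by simp
    also have "\<dots> = S v * \<phi> v"
      using clinear_onD(2)[OF L cS] by (simp add: \<phi>_def S_def)
    finally have "cmod (S v) * cmod (\<phi> v) \<le> (LINT \<zeta>|torus_mu. cmod (S \<zeta> * cnj (S \<zeta>)))"
      using L_le[OF SS] by (simp add: norm_mult)
    \<comment> \<open>The function |S|^2 is nonnegative, so its L^1 norm is its integral, and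
      Cauchy's formula for \<open>S\<close> evaluates this to \<open>S v\<close>. Dividing by the
      positive number \<open>cmod (S v)\<close> then leaves exactly the bound 1.\<close>
    moreover have "complex_of_real (LINT \<zeta>|torus_mu. cmod (S \<zeta> * cnj (S \<zeta>))) = S v"
    proof -
      have "complex_of_real (LINT \<zeta>|torus_mu. cmod (S \<zeta> * cnj (S \<zeta>)))
          = (LINT \<zeta>|torus_mu. complex_of_real (cmod (S \<zeta> * cnj (S \<zeta>))))"
        by (rule integral_complex_of_real[symmetric])
      also have "\<dots> = (LINT \<zeta>|torus_mu. S \<zeta> * cnj (S \<zeta>))"
        by (simp only: norm_mult complex_mod_cnj power2_eq_square[symmetric] complex_norm_square)
      also have "\<dots> = S v"
        using H2_multiplier_cauchy[OF S v] by (simp add: S_def)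
      finally show ?thesis .
    qed
    from arg_cong[OF this, of cmod]
    have "(LINT \<zeta>|torus_mu. cmod (S \<zeta> * cnj (S \<zeta>))) = cmod (S v)"
      unfolding norm_of_real by simp
    moreover have "S v \<noteq> 0"
    proof -
      have "1 - v$k * cnj (v$k) \<noteq> 0" for k
      proof
        assume "1 - v$k * cnj (v$k) = 0"
        then have "v$k * cnj (v$k) = 1" by simp
        from arg_cong[OF this, of cmod] have "cmod (v$k) * cmod (v$k) = 1"
          unfolding norm_mult complex_mod_cnj by simp
        moreover have "cmod (v$k) * cmod (v$k) < 1 * 1"
          using v by (intro mult_strict_mono) (auto simp: polydisc_def)
        ultimately show False by simp
      qed
      then show ?thesis by (simp add: S_def szego_def)
    qed
    ultimately show ?thesis by simp
  qed
  ultimately show ?thesis by (auto simp: schur_class_def)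
qed

theorem theorem6p6:
  fixes z :: "'m::finite \<Rightarrow> complex^'n::finite" and w :: "'m \<Rightarrow> complex"
  assumes "inj z" and "\<forall>i. z i \<in> polydisc" and "\<forall>i. cmod (w i) < 1"
  shows "(\<exists>\<phi>\<in>schur_class. \<forall>i. \<phi> (z i) = w i) \<longleftrightarrow>
         (\<forall>f \<in> M_Q z. cmod (LINT \<zeta>|torus_mu. psi_ZW z w \<zeta> * f \<zeta>)
                        \<le> (LINT \<zeta>|torus_mu. cmod (f \<zeta>)))"
proof
  show "\<forall>f\<in>M_Q z. cmod (LINT \<zeta>|torus_mu. psi_ZW z w \<zeta> * f \<zeta>) \<le> (LINT \<zeta>|torus_mu. cmod (f \<zeta>))"
    if "\<exists>\<phi>\<in>schur_class. \<forall>i. \<phi> (z i) = w i"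
    using that assms by (auto intro: schur_interpolation_imp_contraction)
  show "\<exists>\<phi>\<in>schur_class. \<forall>i. \<phi> (z i) = w i"
    if "\<forall>f\<in>M_Q z. cmod (LINT \<zeta>|torus_mu. psi_ZW z w \<zeta> * f \<zeta>) \<le> (LINT \<zeta>|torus_mu. cmod (f \<zeta>))"
    using that assms by (intro contraction_imp_schur_interpolation) auto
qed

end
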